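(* Let $p$ be a complex polynomial of degree $d\ge 1$ with $d$ distinct roots, and let $\mathbb{B}_p$ be its branched annulus. Then $\mathbb{B}_p$ is a compact metric surface of genus $0$ with $d+1$ boundary components. The metric on $\mathbb{B}_p$ is locally $\mathrm{CAT}(0)$, and it is locally Euclidean away from a finite set of interior points indexed by the critical points of $p$ (namely the points $i_B(b)$ for $b\in\mathbf{cpt}$).
   Context: Branched annulus. Let $\mathbb{S}=\{u\in\mathbb{C}:|u|=1\}$, $\mathbb{I}=[-1,1]$, and let $\mathbb{A}=\mathbb{S}\times\mathbb{I}$ carry the flat product Riemannian metric (so $\mathbb{S}$ has length $2\pi$), with interior $\mathbb{A}^{\mathrm{int}}=\mathbb{S}\times(-1,1)$. Let $i_A\colon\mathbb{C}\setminus\{0\}\to\mathbb{A}$ be the map $i_A(ru)=\left(u,\frac{r^2-1}{r^2+1}\right)$ for $r>0$, $u\in\mathbb{S}$; it is a homeomorphism onto $\mathbb{A}^{\mathrm{int}}$. For a complex polynomial $p$ of degree $d\ge 1$ with $d$ distinct roots, let $\mathbf{rts}$ be its set of roots, $\mathbf{cpt}$ its set of critical points (zeros of $p'$) and $\mathbf{cvl}=p(\mathbf{cpt})\subset\mathbb{C}\setminus\{0\}$ its set of critical values. The open branched annulus $\mathbb{B}_p^{\mathrm{int}}$ is $\mathbb{C}\setminus\mathbf{rts}$ with the pullback metric along $i_A\circ p$: a curve is rectifiable if its image under $i_A\circ p$ is, its length is the length of this image, and the distance between two points is the infimum of the lengths of rectifiable curves joining them. The branched annulus $\mathbb{B}_p$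 is the metric completion of $\mathbb{B}_p^{\mathrm{int}}$, and $i_B\colon\mathbb{C}\setminus\mathbf{rts}\to\mathbb{B}_p$ is the natural inclusion. "Locally Euclidean" means that the point has a neighbourhood isometric to an open subset of the Euclidean plane or (for boundary points) of a closed Euclidean half-plane. A genus $0$ surface with $d+1$ boundary components is one homeomorphic to a $2$-sphere with $d+1$ disjoint open disks (with disjoint closures that are closed disks) removed. *)

theory Defs
  imports "HOL-Analysis.Analysis" "HOL-Computational_Algebra.Polynomial"
begin

section \<open>Lengths of curves and pulled-back length metrics\<close>

text \<open>The length of a curve parametrised by the unit interval is the supremum of its polygonal sums.
  Working in \<^typ>\<open>ennreal\<close> makes this total; it is infinite for non-rectifiable curves.\<close>

definition curve_length :: "('a \<Rightarrow> 'a \<Rightarrow> real) \<Rightarrow> (real \<Rightarrow> 'a) \<Rightarrow> ennreal" where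
  "curve_length d g =
     (SUP (n, t) \<in> {(n :: nat, t :: nat \<Rightarrow> real). t \<in> {..n} \<rightarrow> {0..1} \<and> mono_on {..n} t}.
        ennreal (\<Sum>i<n. d (g (t i)) (g (t (Suc i)))))"

definition rectifiable_curve :: "('a \<Rightarrow> 'a \<Rightarrow> real) \<Rightarrow> (real \<Rightarrow> 'a) \<Rightarrow> bool" where
  "rectifiable_curve d g \<longleftrightarrow> curve_length d g < \<infinity>"

text \<open>The length metric on \<open>S\<close> for which the length of a curve is the length of its image under \<open>f\<close>
  in a space with distance \<open>d\<close>.\<close>

definition pullback_dist ::
    "'a::topological_space set \<Rightarrow> ('a \<Rightarrow> 'b) \<Rightarrow> ('b \<Rightarrow> 'b \<Rightarrow> real) \<Rightarrow> 'a \<Rightarrow> 'a \<Rightarrow> real" where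
  "pullback_dist S f d x y =
     enn2real (INF g \<in> {g. path g \<and> path_image g \<subseteq> S \<and> pathstart g = x \<and> pathfinish g = y \<and>
                           rectifiable_curve d (f \<circ> g)}. curve_length d (f \<circ> g))"


section \<open>Metric completion\<close>

text \<open>The completion consists of the classes of Cauchy sequences modulo being at asymptotic
  distance zero. Its distance is set to zero off the carrier because the locale
  \<^locale>\<open>Metric_space\<close> requires nonnegativity and symmetry for all arguments.\<close>

definition completion_rel ::
    "'a set \<Rightarrow> ('a \<Rightarrow> 'a \<Rightarrow> real) \<Rightarrow> ((nat \<Rightarrow> 'a) \<times> (nat \<Rightarrow> 'a)) set" where
  "completion_rel M d =
     {(\<sigma>, \<tau>). Metric_space.MCauchy M d \<sigma> \<and> Metric_space.MCauchy M d \<tau> \<and>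
              (\<lambda>n. d (\<sigma> n) (\<tau> n)) \<longlonglongrightarrow> 0}"

definition completion_carrier :: "'a set \<Rightarrow> ('a \<Rightarrow> 'a \<Rightarrow> real) \<Rightarrow> (nat \<Rightarrow> 'a) set set" where
  "completion_carrier M d = {\<sigma>. Metric_space.MCauchy M d \<sigma>} // completion_rel M d"

definition completion_dist ::
    "'a set \<Rightarrow> ('a \<Rightarrow> 'a \<Rightarrow> real) \<Rightarrow> (nat \<Rightarrow> 'a) set \<Rightarrow> (nat \<Rightarrow> 'a) set \<Rightarrow> real" where
  "completion_dist M d X Y =
     (if X \<in> completion_carrier M d \<and> Y \<in> completion_carrier M d
      then lim (\<lambda>n. d ((SOME \<sigma>. \<sigma> \<in> X) n) ((SOME \<tau>. \<tau> \<in> Y) n)) else 0)"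

definition completion_embed :: "'a set \<Rightarrow> ('a \<Rightarrow> 'a \<Rightarrow> real) \<Rightarrow> 'a \<Rightarrow> (nat \<Rightarrow> 'a) set" where
  "completion_embed M d x = completion_rel M d `` {\<lambda>n. x}"


section \<open>The branched annulus\<close>

text \<open>The annulus is \<open>sphere 0 1 \<times> {-1..1} :: (complex \<times> real) set\<close>. On the unit circle
  \<open>\<bar>Arg (u / v)\<bar>\<close> is the length of a shortest arc between \<open>u\<close> and \<open>v\<close>, so \<open>annulus_dist\<close> is the
  distance of the flat product Riemannian metric.\<close>

definition circle_dist :: "complex \<Rightarrow> complex \<Rightarrow> real" where
  "circle_dist u v = \<bar>Arg (u / v)\<bar>"

definition annulus_dist :: "complex \<times> real \<Rightarrow> complex \<times> real \<Rightarrow> real" where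
  "annulus_dist = prod_dist circle_dist dist"

definition i_A :: "complex \<Rightarrow> complex \<times> real" where
  "i_A z = (sgn z, ((cmod z)\<^sup>2 - 1) / ((cmod z)\<^sup>2 + 1))"

definition rts :: "complex poly \<Rightarrow> complex set" where
  "rts p = {z. poly p z = 0}"

definition cpt :: "complex poly \<Rightarrow> complex set" where
  "cpt p = {z. poly (pderiv p) z = 0}"

definition open_branched_annulus_dist :: "complex poly \<Rightarrow> complex \<Rightarrow> complex \<Rightarrow> real" where
  "open_branched_annulus_dist p = pullback_dist (- rts p) (i_A \<circ> poly p) annulus_dist"

definition branched_annulus :: "complex poly \<Rightarrow> (nat \<Rightarrow> complex) set set" where
  "branched_annulus p = completion_carrier (- rts p) (open_branched_annulus_dist p)"

definition branched_annulus_dist ::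
    "complex poly \<Rightarrow> (nat \<Rightarrow> complex) set \<Rightarrow> (nat \<Rightarrow> complex) set \<Rightarrow> real" where
  "branched_annulus_dist p = completion_dist (- rts p) (open_branched_annulus_dist p)"

definition i_B :: "complex poly \<Rightarrow> complex \<Rightarrow> (nat \<Rightarrow> complex) set" where
  "i_B p = completion_embed (- rts p) (open_branched_annulus_dist p)"


section \<open>Surfaces\<close>

definition surface_interior :: "'a topology \<Rightarrow> 'a set" where
  "surface_interior X =
     {x \<in> topspace X. \<exists>U (V :: complex set). openin X U \<and> x \<in> U \<and> open V \<and>
        subtopology X U homeomorphic_space top_of_set V}"

definition surface_boundary :: "'a topology \<Rightarrow> 'a set" where
  "surface_boundary X = topspace X - surface_interior X"

text \<open>An open disk whose closure is a closed disk is required to be the interior of that disk: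
  the two are homeomorphic to the standard ones as a pair. This excludes, for instance, a round disk
  with a radial slit, which is also homeomorphic to an open disk.\<close>

definition open_disk_with_closed_disk_closure :: "(real^3) set \<Rightarrow> bool" where
  "open_disk_with_closed_disk_closure D \<longleftrightarrow>
     openin (top_of_set (sphere 0 1)) D \<and>
     (\<exists>h k. homeomorphism (cball (0 :: complex) 1) (closure D) h k \<and> h ` ball 0 1 = D)"

definition genus_0_surface :: "'a topology \<Rightarrow> nat \<Rightarrow> bool" where
  "genus_0_surface X n \<longleftrightarrow>
     (\<exists>D :: nat \<Rightarrow> (real^3) set.
        (\<forall>i<n. open_disk_with_closed_disk_closure (D i)) \<and>
        disjoint_family_on (\<lambda>i. closure (D i)) {..<n} \<and>
        X homeomorphic_space top_of_set (sphere 0 1 - (\<Union>i<n. D i)))"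


section \<open>Locally Euclidean points\<close>

definition isometric_sets ::
    "'a set \<Rightarrow> ('a \<Rightarrow> 'a \<Rightarrow> real) \<Rightarrow> 'b set \<Rightarrow> ('b \<Rightarrow> 'b \<Rightarrow> real) \<Rightarrow> bool" where
  "isometric_sets U d V d' \<longleftrightarrow>
     (\<exists>f. bij_betw f U V \<and> (\<forall>x\<in>U. \<forall>y\<in>U. d' (f x) (f y) = d x y))"

definition locally_Euclidean_at :: "'a set \<Rightarrow> ('a \<Rightarrow> 'a \<Rightarrow> real) \<Rightarrow> 'a \<Rightarrow> bool" where
  "locally_Euclidean_at M d x \<longleftrightarrow>
     (\<exists>U (V :: complex set). openin (Metric_space.mtopology M d) U \<and> x \<in> U \<and>
        open V \<and> isometric_sets U d V dist) \<or>
     x \<in> surface_boundary (Metric_space.mtopology M d) \<and>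
     (\<exists>U (V :: complex set). openin (Metric_space.mtopology M d) U \<and> x \<in> U \<and>
        openin (top_of_set {z. Im z \<ge> 0}) V \<and> isometric_sets U d V dist)"


section \<open>CAT(0) spaces\<close>

definition geodesic_segment :: "'a set \<Rightarrow> ('a \<Rightarrow> 'a \<Rightarrow> real) \<Rightarrow> 'a \<Rightarrow> 'a \<Rightarrow> 'a set \<Rightarrow> bool" where
  "geodesic_segment M d x y S \<longleftrightarrow> S \<subseteq> M \<and>
     (\<exists>\<gamma>. \<gamma> ` {0..d x y} = S \<and> \<gamma> 0 = x \<and> \<gamma> (d x y) = y \<and>
          (\<forall>s\<in>{0..d x y}. \<forall>t\<in>{0..d x y}. d (\<gamma> s) (\<gamma> t) = \<bar>s - t\<bar>))"

text \<open>\<open>a'\<close> is a comparison point on the segment from \<open>x'\<close> to \<open>y'\<close> for the point \<open>a\<close> of the geodesic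
  segment \<open>S\<close> issuing from \<open>x\<close>.\<close>

definition comparison_point ::
    "('a \<Rightarrow> 'a \<Rightarrow> real) \<Rightarrow> 'a \<Rightarrow> 'a set \<Rightarrow> complex \<Rightarrow> complex \<Rightarrow> 'a \<Rightarrow> complex \<Rightarrow> bool" where
  "comparison_point d x S x' y' a a' \<longleftrightarrow>
     a \<in> S \<and> a' \<in> closed_segment x' y' \<and> dist x' a' = d x a"

definition CAT0_inequality ::
    "('a \<Rightarrow> 'a \<Rightarrow> real) \<Rightarrow> 'a \<Rightarrow> 'a \<Rightarrow> 'a \<Rightarrow> 'a set \<Rightarrow> 'a set \<Rightarrow> 'a set \<Rightarrow> bool" where
  "CAT0_inequality d x y z Sxy Syz Szx \<longleftrightarrow>
     (\<forall>x' y' z' :: complex.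
        dist x' y' = d x y \<and> dist y' z' = d y z \<and> dist z' x' = d z x \<longrightarrow>
        (let cmp = (\<lambda>a a'. comparison_point d x Sxy x' y' a a' \<or>
                           comparison_point d y Syz y' z' a a' \<or>
                           comparison_point d z Szx z' x' a a')
         in \<forall>a a' b b'. cmp a a' \<and> cmp b b' \<longrightarrow> d a b \<le> dist a' b'))"

definition CAT0_space :: "'a set \<Rightarrow> ('a \<Rightarrow> 'a \<Rightarrow> real) \<Rightarrow> bool" where
  "CAT0_space M d \<longleftrightarrow> Metric_space M d \<and>
     (\<forall>x\<in>M. \<forall>y\<in>M. \<exists>S. geodesic_segment M d x y S) \<and>
     (\<forall>x\<in>M. \<forall>y\<in>M. \<forall>z\<in>M. \<forall>Sxy Syz Szx.
        geodesic_segment M d x y Sxy \<and> geodesic_segment M d y z Syz \<and>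
        geodesic_segment M d z x Szx \<longrightarrow> CAT0_inequality d x y z Sxy Syz Szx)"

definition locally_CAT0 :: "'a set \<Rightarrow> ('a \<Rightarrow> 'a \<Rightarrow> real) \<Rightarrow> bool" where
  "locally_CAT0 M d \<longleftrightarrow> (\<forall>x\<in>M. \<exists>r>0. CAT0_space (Metric_space.mball M d x r) d)"

end

theory Submission
  imports Defs "HOL-Complex_Analysis.Conformal_Mappings"
begin

text \<open>
  Since \<open>i_A (exp w) = (cis (Im w), tanh (Re w))\<close>, the map \<open>i_A \<circ> p\<close> is locally
  \<open>log p\<close> followed by a homeomorphism of a strip. Near an interior point \<open>log p\<close> is a \<open>k\<close>-th power
  of a local coordinate, and a continuous \<open>k\<close>-th root of the flat coordinate identifies a ball with
  a ball around the apex of the Euclidean cone of angle \<open>2 * pi * k\<close>; here \<open>k = 1\<close> away from the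
  critical points. Curves which leave such a chart are too long to be shortcuts, so the identification
  is isometric. Cones of angle at least \<open>2 * pi\<close> satisfy Stewart's inequality, which implies the CAT(0)
  inequality.

  The remaining ends of the punctured plane are the roots, where \<open>p\<close> itself is a coordinate, and infinity,
  where a \<open>d\<close>-th root of \<open>1 / p\<close> is one. Each is covered by a Euclidean half strip, whose
  missing boundary line is added by the completion, so a boundary point has a half disk as neighbourhood.
  Stretching a collar of a disk around each of the \<open>d + 1\<close> ends over the punctured disk
  gives a continuous bijection from the sphere minus \<open>d + 1\<close> open disks onto the completion.
\<close>


subsection \<open>Lengths of curves and pulled-back length metrics\<close>

text \<open>The height \<open>tanh (Re w)\<close> is not holomorphic in \<open>w = log p\<close>, so
  the flat coordinate is only continuous: its root is built by hand in polar coordinates, and images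
  are open by invariance of domain. Shortcuts are excluded because the radius \<open>N\<close> of a
  chart is 1-Lipschitz for the distance of the annulus: a curve from \<open>x\<close> to
  \<open>y\<close> that reaches a level \<open>r > N x + N y\<close> has length at least
  \<open>2 * r - N x - N y\<close>, more than the detour \<open>N x + N y\<close> through the
  centre. The centre itself may be missing from the space, so one argument serves interior and
  boundary points. Points of the completion are classes about which nothing is known beforehand;
  compactness of closed model balls, together with density of the image of \<open>i_B\<close>, shows
  that no unexpected points occur. Stewart's inequality replaces comparison angles: it concerns the
  distances to one division point, and is applied once for each of the two points to be compared.
  The boundary of a surface is defined as the complement of its interior, so boundary points also
  need a proof that no plane chart exists there.\<close>

lemma curve_length_ge_sum:
  assumes "t \<in> {..n} \<rightarrow> {0..1}" "mono_on {..n} t"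
  shows "ennreal (\<Sum>i<n. d (g (t i)) (g (t (Suc i)))) \<le> curve_length d g"
  unfolding curve_length_def using assms by (intro SUP_upper2[of "(n,t)"]) auto

lemma curve_length_leI:
  assumes "\<And>n t. t \<in> {..n} \<rightarrow> {0..1} \<Longrightarrow> mono_on {..n} t \<Longrightarrow>
    ennreal (\<Sum>i<n. d (g (t i)) (g (t (Suc i)))) \<le> L"
  shows "curve_length d g \<le> L"
  unfolding curve_length_def using assms by (intro SUP_least) auto

lemma curve_length_ge_chord:
  assumes "0 \<le> s" "s \<le> t" "t \<le> 1"
  shows "ennreal (d (g s) (g t)) \<le> curve_length d g"
  using curve_length_ge_sum[of "\<lambda>i. if i = 0 then s else t" 1 d g] assms
  by (auto simp: mono_on_def)

lemma curve_length_ge_chords: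
  assumes "0 \<le> s" "s \<le> t" "t \<le> u" "u \<le> 1"
  shows "ennreal (d (g s) (g t) + d (g t) (g u)) \<le> curve_length d g"
  using curve_length_ge_sum[of "\<lambda>i. if i = 0 then s else if i = 1 then t else u" 2 d g] assms
  by (auto simp: mono_on_def numeral_2_eq_2)

lemma curve_length_le_Lipschitz:
  assumes L: "0 \<le> L"
    and le: "\<And>s t. 0 \<le> s \<Longrightarrow> s \<le> t \<Longrightarrow> t \<le> 1 \<Longrightarrow> d (g s) (g t) \<le> L * (t - s)"
  shows "curve_length d g \<le> ennreal L"
proof (rule curve_length_leI)
  fix n :: nat and t :: "nat \<Rightarrow> real" assume t: "t \<in> {..n} \<rightarrow> {0..1}" "mono_on {..n::nat} t"
  have b: "0 \<le> t i \<and> t i \<le> 1" if "i \<le> n" for i using t that by auto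
  have "(\<Sum>i<n. d (g (t i)) (g (t (Suc i)))) \<le> (\<Sum>i<n. L * (t (Suc i) - t i))"
    using b t by (intro sum_mono le) (auto simp: mono_on_def)
  also have "\<dots> = L * (t n - t 0)"
    by (simp add: sum_distrib_left[symmetric] sum_lessThan_telescope)
  also have "\<dots> \<le> L * 1" using b[of n] b[of 0] L by (intro mult_left_mono) auto
  finally show "ennreal (\<Sum>i<n. d (g (t i)) (g (t (Suc i)))) \<le> ennreal L"
    by (simp add: ennreal_leI)
qed

lemma curve_length_join_le:
  assumes nn: "\<And>x y. 0 \<le> d x y"
    and tri: "\<And>s t. 0 \<le> s \<Longrightarrow> s \<le> 1 \<Longrightarrow> 0 \<le> t \<Longrightarrow> t \<le> 1 \<Longrightarrow>
      d (f (g1 s)) (f (g2 t)) \<le> d (f (g1 s)) (f (g1 1)) + d (f (g2 0)) (f (g2 t))"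
    and eq: "g1 1 = g2 0"
  shows "curve_length d (f \<circ> (g1 +++ g2)) \<le> curve_length d (f \<circ> g1) + curve_length d (f \<circ> g2)"
proof (rule curve_length_leI)
  fix n :: nat and t :: "nat \<Rightarrow> real" assume t: "t \<in> {..n} \<rightarrow> {0..1}" "mono_on {..n::nat} t"
  \<comment> \<open>Clamping the partition to each half avoids inserting 1/2 as a partition point: a
    step on one side of 1/2 is constant in the other sequence, and only the step across 1/2 needs
    \<open>tri\<close>.\<close>
  define a where "a i = min 1 (2 * t i)" for i
  define b where "b i = max 0 (2 * t i - 1)" for i
  have tb: "0 \<le> t i \<and> t i \<le> 1" if "i \<le> n" for i using t that by auto
  have tm: "t i \<le> t j" if "i \<le> j" "j \<le> n" for i j using t that by (auto simp: mono_on_def)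
  have ab: "a \<in> {..n} \<rightarrow> {0..1}" "mono_on {..n} a" "b \<in> {..n} \<rightarrow> {0..1}" "mono_on {..n} b"
    using tb unfolding a_def b_def by (auto intro!: mono_onI min.mono max.mono mult_left_mono tm diff_right_mono)
  have step: "d ((f \<circ> (g1 +++ g2)) (t i)) ((f \<circ> (g1 +++ g2)) (t (Suc i)))
    \<le> d ((f \<circ> g1) (a i)) ((f \<circ> g1) (a (Suc i))) + d ((f \<circ> g2) (b i)) ((f \<circ> g2) (b (Suc i)))"
    if "i < n" for i
  proof -
    have m: "t i \<le> t (Suc i)" using t that by (auto simp: mono_on_def)
    note B = tb[of i] tb[of "Suc i"]
    consider "t (Suc i) \<le> 1/2" | "t i \<le> 1/2" "t (Suc i) > 1/2" | "t i > 1/2" by linarith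
    then show ?thesis
    proof cases
      case 1 then have "t i \<le> 1/2" using m by linarith
      with 1 show ?thesis using nn by (auto simp: joinpaths_def a_def b_def)
    next
      case 2
      have "a (Suc i) = 1" "b i = 0" "a i = 2 * t i" "b (Suc i) = 2 * t (Suc i) - 1"
        using 2 by (auto simp: a_def b_def)
      then show ?thesis using 2 tri[of "a i" "b (Suc i)"] B that
        by (auto simp: joinpaths_def)
    next
      case 3 then have "t (Suc i) > 1/2" using m by linarith
      with 3 show ?thesis using nn by (auto simp: joinpaths_def a_def b_def)
    qed
  qed
  have "(\<Sum>i<n. d ((f \<circ> (g1 +++ g2)) (t i)) ((f \<circ> (g1 +++ g2)) (t (Suc i))))
    \<le> (\<Sum>i<n. d ((f \<circ> g1) (a i)) ((f \<circ> g1) (a (Suc i)))) + (\<Sum>i<n. d ((f \<circ> g2) (b i)) ((f \<circ> g2) (b (Suc i))))"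
    unfolding sum.distrib[symmetric] by (intro sum_mono step) auto
  then have "ennreal (\<Sum>i<n. d ((f \<circ> (g1 +++ g2)) (t i)) ((f \<circ> (g1 +++ g2)) (t (Suc i))))
    \<le> ennreal (\<Sum>i<n. d ((f \<circ> g1) (a i)) ((f \<circ> g1) (a (Suc i)))) + ennreal (\<Sum>i<n. d ((f \<circ> g2) (b i)) ((f \<circ> g2) (b (Suc i))))"
    using nn by (simp add: ennreal_leI ennreal_plus[symmetric] sum_nonneg del: ennreal_plus)
  also have "\<dots> \<le> curve_length d (f \<circ> g1) + curve_length d (f \<circ> g2)"
    using ab by (intro add_mono curve_length_ge_sum)
  finally show "ennreal (\<Sum>i<n. d ((f \<circ> (g1 +++ g2)) (t i)) ((f \<circ> (g1 +++ g2)) (t (Suc i))))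
    \<le> curve_length d (f \<circ> g1) + curve_length d (f \<circ> g2)" .
qed

lemma curve_length_reversepath_le:
  assumes sym: "\<And>x y. d x y = d y x"
  shows "curve_length d (f \<circ> reversepath g) \<le> curve_length d (f \<circ> g)"
proof (rule curve_length_leI)
  fix n :: nat and t :: "nat \<Rightarrow> real" assume t: "t \<in> {..n} \<rightarrow> {0..1}" "mono_on {..n::nat} t"
  define b where "b i = 1 - t (n - i)" for i
  have b: "b \<in> {..n} \<rightarrow> {0..1}" "mono_on {..n} b"
    using t unfolding b_def by (auto simp: mono_on_def Pi_iff)
  have "(\<Sum>i<n. d ((f \<circ> reversepath g) (t i)) ((f \<circ> reversepath g) (t (Suc i))))
     = (\<Sum>i<n. d (f (g (1 - t (n - Suc i)))) (f (g (1 - t (Suc (n - Suc i))))))"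
    by (subst sum.nat_diff_reindex[symmetric]) (simp add: reversepath_def)
  also have "\<dots> = (\<Sum>i<n. d ((f \<circ> g) (b i)) ((f \<circ> g) (b (Suc i))))"
    by (intro sum.cong) (auto simp: b_def sym Suc_diff_Suc)
  finally show "ennreal (\<Sum>i<n. d ((f \<circ> reversepath g) (t i)) ((f \<circ> reversepath g) (t (Suc i))))
    \<le> curve_length d (f \<circ> g)"
    using curve_length_ge_sum[OF b, of d "f \<circ> g"] by simp
qed

section \<open>Distances as infima over rectifiable paths\<close>

definition rect_paths ::
    "'a::topological_space set \<Rightarrow> ('a \<Rightarrow> 'b) \<Rightarrow> ('b \<Rightarrow> 'b \<Rightarrow> real) \<Rightarrow> 'a \<Rightarrow> 'a \<Rightarrow> (real \<Rightarrow> 'a) set" where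
  "rect_paths S f d x y = {g. path g \<and> path_image g \<subseteq> S \<and> pathstart g = x \<and> pathfinish g = y \<and>
                           rectifiable_curve d (f \<circ> g)}"

lemma pullback_dist_eq: "pullback_dist S f d x y = enn2real (INF g \<in> rect_paths S f d x y. curve_length d (f \<circ> g))"
  by (simp add: pullback_dist_def rect_paths_def)

lemma pullback_dist_nonneg [simp]: "0 \<le> pullback_dist S f d x y"
  by (simp add: pullback_dist_eq)

lemma pullback_dist_le:
  assumes "g \<in> rect_paths S f d x y" "curve_length d (f \<circ> g) \<le> ennreal L" "0 \<le> L"
  shows "pullback_dist S f d x y \<le> L"
proof -
  have "(INF g \<in> rect_paths S f d x y. curve_length d (f \<circ> g)) \<le> ennreal L"
    using assms by (intro INF_lower2)
  then show ?thesis using assms(3) unfolding pullback_dist_eq by (simp add: enn2real_leI)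
qed

lemma INF_curve_length_finite:
  assumes "rect_paths S f d x y \<noteq> {}"
  shows "(INF g \<in> rect_paths S f d x y. curve_length d (f \<circ> g)) < \<infinity>"
proof -
  obtain g where "g \<in> rect_paths S f d x y" using assms by auto
  then show ?thesis unfolding INF_less_iff by (auto simp: rect_paths_def rectifiable_curve_def)
qed

text \<open>If no rectifiable path existed, the infimum would be infinite and
  \<open>enn2real\<close> would turn it into 0; hence the nonemptiness assumption.\<close>

lemma pullback_dist_ge:
  assumes "rect_paths S f d x y \<noteq> {}"
    and "\<And>g. g \<in> rect_paths S f d x y \<Longrightarrow> ennreal L \<le> curve_length d (f \<circ> g)"
  shows "L \<le> pullback_dist S f d x y"
proof (cases "L \<ge> 0")
  case True
  have "ennreal L \<le> (INF g \<in> rect_paths S f d x y. curve_length d (f \<circ> g))"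
    using assms(2) by (intro INF_greatest)
  then have "enn2real (ennreal L) \<le> pullback_dist S f d x y"
    unfolding pullback_dist_eq using INF_curve_length_finite[OF assms(1)]
    by (intro enn2real_mono) auto
  then show ?thesis using True by simp
qed (use pullback_dist_nonneg[of S f d x y] in linarith)

lemma pullback_dist_approx:
  assumes "rect_paths S f d x y \<noteq> {}" "0 < e"
  obtains g where "g \<in> rect_paths S f d x y" "curve_length d (f \<circ> g) < ennreal (pullback_dist S f d x y + e)"
proof -
  let ?I = "INF g \<in> rect_paths S f d x y. curve_length d (f \<circ> g)"
  have fin: "?I < \<infinity>" by (rule INF_curve_length_finite[OF assms(1)])
  have "?I = ennreal (pullback_dist S f d x y)" using fin by (simp add: pullback_dist_eq)
  also have "\<dots> < ennreal (pullback_dist S f d x y + e)"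
    using assms(2) by (intro ennreal_lessI) (auto intro: add_nonneg_pos)
  finally obtain g where "g \<in> rect_paths S f d x y" "curve_length d (f \<circ> g) < ennreal (pullback_dist S f d x y + e)"
    unfolding INF_less_iff by auto
  then show ?thesis by (rule that)
qed

lemma rect_paths_reverse:
  assumes sym: "\<And>x y. d x y = d y x" and "g \<in> rect_paths S f d x y"
  shows "reversepath g \<in> rect_paths S f d y x"
  using assms curve_length_reversepath_le[of d f g, OF sym]
  by (auto simp: rect_paths_def rectifiable_curve_def top.not_eq_extremum)

lemma pullback_dist_commute:
  assumes sym: "\<And>x y. d x y = d y x"
  shows "pullback_dist S f d x y = pullback_dist S f d y x"
proof -
  have "(INF g \<in> rect_paths S f d x y. curve_length d (f \<circ> g)) \<le> (INF g \<in> rect_paths S f d y x. curve_length d (f \<circ> g))" for x y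
    by (rule INF_mono) (use rect_paths_reverse[of d, OF sym] curve_length_reversepath_le[of d, OF sym] in blast)
  then show ?thesis unfolding pullback_dist_eq by (metis order_antisym)
qed

lemma curve_length_joinpaths_le:
  assumes M: "Metric_space M d" and fS: "f ` S \<subseteq> M"
    and g: "path_image g1 \<subseteq> S" "path_image g2 \<subseteq> S" "pathfinish g1 = pathstart g2"
  shows "curve_length d (f \<circ> (g1 +++ g2)) \<le> curve_length d (f \<circ> g1) + curve_length d (f \<circ> g2)"
proof (rule curve_length_join_le)
  show "0 \<le> d x y" for x y using M by (simp add: Metric_space.nonneg)
  show "g1 1 = g2 0" using g by (simp add: pathfinish_def pathstart_def)
  show "d (f (g1 s)) (f (g2 t)) \<le> d (f (g1 s)) (f (g1 1)) + d (f (g2 0)) (f (g2 t))"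
    if "0 \<le> s" "s \<le> 1" "0 \<le> t" "t \<le> 1" for s t
  proof -
    have "g1 s \<in> S" "g1 1 \<in> S" "g2 t \<in> S" using that g by (auto simp: path_image_def)
    then show ?thesis using M fS g unfolding pathfinish_def pathstart_def
      by (metis Metric_space.triangle image_subset_iff)
  qed
qed

lemma rect_paths_join:
  assumes M: "Metric_space M d" and fS: "f ` S \<subseteq> M"
    and g: "g1 \<in> rect_paths S f d x y" "g2 \<in> rect_paths S f d y z"
  shows "g1 +++ g2 \<in> rect_paths S f d x z"
proof -
  have "curve_length d (f \<circ> (g1 +++ g2)) \<le> curve_length d (f \<circ> g1) + curve_length d (f \<circ> g2)"
    using g by (intro curve_length_joinpaths_le[OF M fS]) (auto simp: rect_paths_def)
  also have "\<dots> < \<infinity>" using g by (simp add: rect_paths_def rectifiable_curve_def)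
  finally show ?thesis using g
    by (auto simp: rect_paths_def rectifiable_curve_def path_image_join)
qed

lemma pullback_dist_triangle:
  assumes M: "Metric_space M d" and fS: "f ` S \<subseteq> M"
    and ne: "rect_paths S f d x y \<noteq> {}" "rect_paths S f d y z \<noteq> {}"
  shows "pullback_dist S f d x z \<le> pullback_dist S f d x y + pullback_dist S f d y z"
proof (rule field_le_epsilon)
  fix e :: real assume "e > 0" then have e: "e/2 > 0" by simp
  obtain g1 where g1: "g1 \<in> rect_paths S f d x y" "curve_length d (f \<circ> g1) < ennreal (pullback_dist S f d x y + e/2)"
    using pullback_dist_approx[OF ne(1) e] .
  obtain g2 where g2: "g2 \<in> rect_paths S f d y z" "curve_length d (f \<circ> g2) < ennreal (pullback_dist S f d y z + e/2)"
    using pullback_dist_approx[OF ne(2) e] .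
  show "pullback_dist S f d x z \<le> pullback_dist S f d x y + pullback_dist S f d y z + e"
  proof (rule pullback_dist_le[OF rect_paths_join[OF M fS g1(1) g2(1)]])
    have "curve_length d (f \<circ> (g1 +++ g2)) \<le> curve_length d (f \<circ> g1) + curve_length d (f \<circ> g2)"
      using g1 g2 by (intro curve_length_joinpaths_le[OF M fS]) (auto simp: rect_paths_def)
    also have "\<dots> \<le> ennreal (pullback_dist S f d x y + e/2) + ennreal (pullback_dist S f d y z + e/2)"
      using g1 g2 by (intro add_mono) auto
    also have "\<dots> = ennreal (pullback_dist S f d x y + pullback_dist S f d y z + e)"
      using \<open>e > 0\<close> by (subst ennreal_plus[symmetric]) (auto simp: add.commute add.left_commute intro!: arg_cong[where f=ennreal] add_nonneg_nonneg)
    finally show "curve_length d (f \<circ> (g1 +++ g2)) \<le> ennreal (pullback_dist S f d x y + pullback_dist S f d y z + e)" .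
  qed (use \<open>e > 0\<close> in \<open>auto intro!: add_nonneg_nonneg\<close>)
qed

lemma path_leaves_sublevel:
  fixes S :: "'a::topological_space set" and N :: "'a \<Rightarrow> real"
  assumes cl: "closedin (top_of_set S) {x \<in> U. N x \<le> r}"
    and op: "openin (top_of_set S) {x \<in> U. N x < r}"
    and g: "path g" "path_image g \<subseteq> S" "g 0 \<in> U" "N (g 0) < r"
  shows "path_image g \<subseteq> {x \<in> U. N x < r} \<or> (\<exists>s\<in>{0..1}. g s \<in> U \<and> N (g s) = r)"
proof (rule disjCI)
  \<comment> \<open>otherwise the part of the path inside the sublevel set is open and closed\<close>
  assume no: "\<not> (\<exists>s\<in>{0..1}. g s \<in> U \<and> N (g s) = r)"
  let ?A = "{0..1} \<inter> g -` {x \<in> U. N x < r}"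
  have eq: "?A = {0..1} \<inter> g -` {x \<in> U. N x \<le> r}" using no by force
  have gc: "continuous_on {0..1} g" "g ` {0..1} \<subseteq> S" using g by (auto simp: path_def path_image_def)
  have "openin (top_of_set {0..1}) ?A"
    using continuous_openin_preimage[OF gc(1) _ op] gc by auto
  moreover have "closedin (top_of_set {0..1}) ?A"
    unfolding eq using continuous_closedin_preimage_gen[OF gc(1) _ cl] gc(2) by blast
  ultimately have "?A = {} \<or> ?A = {0..1}"
    using connected_clopen[of "{0..1::real}"] connected_Icc[of 0 "1::real"] by auto
  moreover have "0 \<in> ?A" using g by auto
  ultimately have "?A = {0..1}" by blast
  then show "path_image g \<subseteq> {x \<in> U. N x < r}" by (auto simp: path_image_def)
qed

text \<open>A chart around a point of \<open>S\<close>, or around a missing point: \<open>N\<close> is the distance to the centre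
  in the model space, whose distance is \<open>D\<close>.\<close>

locale pullback_chart =
  fixes S :: "'a::topological_space set" and f :: "'a \<Rightarrow> 'b" and d :: "'b \<Rightarrow> 'b \<Rightarrow> real"
    and U :: "'a set" and N :: "'a \<Rightarrow> real" and D :: "'a \<Rightarrow> 'a \<Rightarrow> real" and R :: real
  assumes sublevel_closed: "\<And>r. r < R \<Longrightarrow> closedin (top_of_set S) {x \<in> U. N x \<le> r}"
    and sublevel_open: "\<And>r. r < R \<Longrightarrow> openin (top_of_set S) {x \<in> U. N x < r}"
    and N_Lipschitz: "\<And>x y. x \<in> U \<Longrightarrow> y \<in> U \<Longrightarrow> \<bar>N x - N y\<bar> \<le> d (f x) (f y)"
    and length_ge: "\<And>g. path g \<Longrightarrow> path_image g \<subseteq> U \<Longrightarrow>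
       ennreal (D (pathstart g) (pathfinish g)) \<le> curve_length d (f \<circ> g)"
    and D_le: "\<And>x y. x \<in> U \<Longrightarrow> y \<in> U \<Longrightarrow> D x y \<le> N x + N y"
    and D_nonneg: "\<And>x y. x \<in> U \<Longrightarrow> y \<in> U \<Longrightarrow> 0 \<le> D x y"
    and short_path: "\<And>x y. x \<in> U \<Longrightarrow> y \<in> U \<Longrightarrow> \<exists>g. path g \<and> path_image g \<subseteq> S \<and>
       pathstart g = x \<and> pathfinish g = y \<and> curve_length d (f \<circ> g) \<le> ennreal (D x y)"
begin

lemma rect_paths_chart:
  assumes "x \<in> U" "y \<in> U"
  shows "\<exists>g \<in> rect_paths S f d x y. curve_length d (f \<circ> g) \<le> ennreal (D x y)"
proof -
  obtain g where g: "path g \<and> path_image g \<subseteq> S \<and>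
       pathstart g = x \<and> pathfinish g = y \<and> curve_length d (f \<circ> g) \<le> ennreal (D x y)"
    using short_path[OF assms] by blast
  moreover have "curve_length d (f \<circ> g) < \<infinity>" using g le_less_trans[OF _ ennreal_less_top] by fastforce
  ultimately show ?thesis by (auto simp: rect_paths_def rectifiable_curve_def)
qed

lemma pullback_dist_le_chart:
  assumes "x \<in> U" "y \<in> U" shows "pullback_dist S f d x y \<le> D x y"
proof -
  obtain g where g: "g \<in> rect_paths S f d x y" "curve_length d (f \<circ> g) \<le> ennreal (D x y)"
    using rect_paths_chart[OF assms] by blast
  show ?thesis by (rule pullback_dist_le[OF g D_nonneg[OF assms]])
qed

text \<open>No curve gains by running outside. Choose \<open>r\<close> between
  \<open>N x + N y\<close> and \<open>R\<close>: a path that stays below level \<open>r\<close> is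
  measured by \<open>length_ge\<close>, and one that meets the level climbs \<open>r - N x\<close>
  and descends \<open>r - N y\<close>, which together exceed \<open>N x + N y\<close> and hence
  \<open>D x y\<close>.\<close>

lemma pullback_dist_chart:
  assumes x: "x \<in> U" and y: "y \<in> U" and s: "N x + N y < R" "N x < R"
  shows "pullback_dist S f d x y = D x y"
proof (rule antisym[OF pullback_dist_le_chart[OF x y]])
  show "D x y \<le> pullback_dist S f d x y"
  proof (rule pullback_dist_ge)
    show "rect_paths S f d x y \<noteq> {}" using rect_paths_chart[OF x y] by auto
    fix g assume "g \<in> rect_paths S f d x y"
    then have g: "path g" "path_image g \<subseteq> S" "pathstart g = x" "pathfinish g = y"
      by (auto simp: rect_paths_def)
    obtain r where r: "max (N x) (N x + N y) < r" "r < R" using s dense[of "max (N x) (N x + N y)" R] by auto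
    have "path_image g \<subseteq> {x \<in> U. N x < r} \<or> (\<exists>s\<in>{0..1}. g s \<in> U \<and> N (g s) = r)"
      using path_leaves_sublevel[OF sublevel_closed[OF r(2)] sublevel_open[OF r(2)] g(1,2)] g(3) r x
      by (simp add: pathstart_def)
    then show "ennreal (D x y) \<le> curve_length d (f \<circ> g)"
    proof (elim disjE)
      assume "path_image g \<subseteq> {x \<in> U. N x < r}"
      then show ?thesis using length_ge[of g] g by auto
    next
      assume "\<exists>s\<in>{0..1}. g s \<in> U \<and> N (g s) = r"
      then obtain s where s: "s \<in> {0..1}" "g s \<in> U" "N (g s) = r" by auto
      have g01: "g 0 = x" "g 1 = y" using g by (auto simp: pathstart_def pathfinish_def)
      have "D x y \<le> (r - N x) + (r - N y)" using D_le[OF x y] r by linarith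
      also have "\<dots> \<le> d (f (g 0)) (f (g s)) + d (f (g s)) (f (g 1))"
        using N_Lipschitz[of "g 0" "g s"] N_Lipschitz[of "g s" "g 1"] g01 x y s by auto
      finally have "ennreal (D x y) \<le> ennreal (d (f (g 0)) (f (g s)) + d (f (g s)) (f (g 1)))"
        by (rule ennreal_leI)
      also have "\<dots> \<le> curve_length d (f \<circ> g)"
        using curve_length_ge_chords[of 0 s 1 d "f \<circ> g"] s by auto
      finally show ?thesis .
    qed
  qed
qed

text \<open>Leaving the sublevel set costs at least \<open>r - N x\<close> by the Lipschitz
  property. This separates points and keeps small balls of the length metric inside the
  chart.\<close>

lemma pullback_dist_ge_chart:
  assumes x: "x \<in> U" "N x < r" "r < R" and y: "\<not> (y \<in> U \<and> N y < r)"
    and ne: "rect_paths S f d x y \<noteq> {}"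
  shows "r - N x \<le> pullback_dist S f d x y"
proof (rule pullback_dist_ge[OF ne])
  fix g assume "g \<in> rect_paths S f d x y"
  then have g: "path g" "path_image g \<subseteq> S" "pathstart g = x" "pathfinish g = y"
    by (auto simp: rect_paths_def)
  have g01: "g 0 = x" "g 1 = y" using g by (auto simp: pathstart_def pathfinish_def)
  have "path_image g \<subseteq> {x \<in> U. N x < r} \<or> (\<exists>s\<in>{0..1}. g s \<in> U \<and> N (g s) = r)"
    using path_leaves_sublevel[OF sublevel_closed[OF x(3)] sublevel_open[OF x(3)] g(1,2)] g(3) x
    by (simp add: pathstart_def)
  moreover have "\<not> path_image g \<subseteq> {x \<in> U. N x < r}"
    using y g pathfinish_in_path_image[of g] by auto
  ultimately obtain s where s: "s \<in> {0..1}" "g s \<in> U" "N (g s) = r" by blast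
  have "ennreal (r - N x) \<le> ennreal (d (f (g 0)) (f (g s)))"
    using N_Lipschitz[of "g 0" "g s"] g01 x s by (intro ennreal_leI) auto
  also have "\<dots> \<le> curve_length d (f \<circ> g)"
    using curve_length_ge_chord[of 0 s d "f \<circ> g"] s by auto
  finally show "ennreal (r - N x) \<le> curve_length d (f \<circ> g)" .
qed

end

subsection \<open>Metric completion\<close>

context Metric_space
begin

abbreviation cclass :: "(nat \<Rightarrow> 'a) \<Rightarrow> (nat \<Rightarrow> 'a) set" where
  "cclass \<sigma> \<equiv> completion_rel M d `` {\<sigma>}"

lemma MCauchy_in: "MCauchy \<sigma> \<Longrightarrow> \<sigma> n \<in> M"
  by (auto simp: MCauchy_def)

lemma dist_quadrilateral:
  assumes "a \<in> M" "b \<in> M" "a' \<in> M" "b' \<in> M"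
  shows "\<bar>d a b - d a' b'\<bar> \<le> d a a' + d b b'"
  using triangle[of a a' b] triangle[of a' b' b] triangle[of a' a b'] triangle[of a b b'] assms
  by (simp add: commute[of b' b] commute[of a' a])

lemma completion_rel_equiv: "equiv {\<sigma>. MCauchy \<sigma>} (completion_rel M d)"
proof (intro equivI refl_onI symI transI subsetI)
  fix \<sigma> assume "\<sigma> \<in> {\<sigma>. MCauchy \<sigma>}"
  then show "(\<sigma>, \<sigma>) \<in> completion_rel M d"
    by (simp add: completion_rel_def MCauchy_in)
next
  fix \<sigma> \<tau> assume "(\<sigma>, \<tau>) \<in> completion_rel M d"
  then show "(\<tau>, \<sigma>) \<in> completion_rel M d" by (simp add: completion_rel_def commute)
next
  fix \<sigma> \<tau> \<rho> assume a: "(\<sigma>, \<tau>) \<in> completion_rel M d" "(\<tau>, \<rho>) \<in> completion_rel M d"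
  then have "(\<lambda>n. d (\<sigma> n) (\<tau> n) + d (\<tau> n) (\<rho> n)) \<longlonglongrightarrow> 0 + 0"
    unfolding completion_rel_def by (intro tendsto_add) auto
  moreover have "\<forall>n. norm (d (\<sigma> n) (\<rho> n)) \<le> d (\<sigma> n) (\<tau> n) + d (\<tau> n) (\<rho> n)"
    using a by (auto simp: completion_rel_def intro!: triangle dest: MCauchy_in)
  ultimately have "(\<lambda>n. d (\<sigma> n) (\<rho> n)) \<longlonglongrightarrow> 0"
    using Lim_null_comparison always_eventually by (metis (mono_tags, lifting) add_0)
  then show "(\<sigma>, \<rho>) \<in> completion_rel M d" using a by (auto simp: completion_rel_def)
next
  fix x assume "x \<in> completion_rel M d" 
  then show "x \<in> {\<sigma>. MCauchy \<sigma>} \<times> {\<sigma>. MCauchy \<sigma>}" by (auto simp: completion_rel_def)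
qed

lemma dist_MCauchy_convergent:
  assumes "MCauchy \<sigma>" "MCauchy \<tau>"
  shows "convergent (\<lambda>n. d (\<sigma> n) (\<tau> n))"
proof (rule Cauchy_convergent, rule metric_CauchyI)
  fix e :: real assume "e > 0"
  then obtain N1 N2 where N: "\<And>m n. N1 \<le> m \<Longrightarrow> N1 \<le> n \<Longrightarrow> d (\<sigma> m) (\<sigma> n) < e/2"
    "\<And>m n. N2 \<le> m \<Longrightarrow> N2 \<le> n \<Longrightarrow> d (\<tau> m) (\<tau> n) < e/2"
    using assms unfolding MCauchy_def by (metis half_gt_zero)
  show "\<exists>L. \<forall>m\<ge>L. \<forall>n\<ge>L. dist (d (\<sigma> m) (\<tau> m)) (d (\<sigma> n) (\<tau> n)) < e"
  proof (intro exI[of _ "max N1 N2"] allI impI)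
    fix m n assume "max N1 N2 \<le> m" "max N1 N2 \<le> n"
    then have "d (\<sigma> m) (\<sigma> n) + d (\<tau> m) (\<tau> n) < e" using N[of m n] by fastforce
    then show "dist (d (\<sigma> m) (\<tau> m)) (d (\<sigma> n) (\<tau> n)) < e"
      using dist_quadrilateral[of "\<sigma> m" "\<tau> m" "\<sigma> n" "\<tau> n"] assms by (simp add: dist_real_def MCauchy_in)
  qed
qed

lemma cclass_in_carrier: "MCauchy \<sigma> \<Longrightarrow> cclass \<sigma> \<in> completion_carrier M d"
  by (auto simp: completion_carrier_def quotient_def)

lemma completion_carrier_cases:
  assumes "X \<in> completion_carrier M d"
  obtains \<sigma> where "MCauchy \<sigma>" "X = cclass \<sigma>"
  using assms by (auto simp: completion_carrier_def quotient_def)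

lemma cclass_eq_iff:
  assumes "MCauchy \<sigma>" "MCauchy \<tau>"
  shows "cclass \<sigma> = cclass \<tau> \<longleftrightarrow> (\<lambda>n. d (\<sigma> n) (\<tau> n)) \<longlonglongrightarrow> 0"
  using eq_equiv_class_iff[OF completion_rel_equiv, of \<sigma> \<tau>] assms by (auto simp: completion_rel_def)

text \<open>\<open>completion_dist\<close> picks representatives by \<open>SOME\<close>. The
  quadrilateral inequality shows that equivalent sequences yield the same limit, so every pair of
  representatives computes the distance.\<close>

lemma completion_dist_lim:
  assumes "MCauchy \<sigma>" "MCauchy \<tau>"
  shows "(\<lambda>n. d (\<sigma> n) (\<tau> n)) \<longlonglongrightarrow> completion_dist M d (cclass \<sigma>) (cclass \<tau>)"
proof -
  define \<sigma>' where "\<sigma>' = (SOME \<rho>. \<rho> \<in> cclass \<sigma>)"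
  define \<tau>' where "\<tau>' = (SOME \<rho>. \<rho> \<in> cclass \<tau>)"
  have "\<sigma> \<in> cclass \<sigma>" "\<tau> \<in> cclass \<tau>"
    using equiv_class_self[OF completion_rel_equiv] assms by auto
  then have "\<sigma>' \<in> cclass \<sigma>" "\<tau>' \<in> cclass \<tau>" unfolding \<sigma>'_def \<tau>'_def by (metis someI)+
  then have rel: "(\<sigma>, \<sigma>') \<in> completion_rel M d" "(\<tau>, \<tau>') \<in> completion_rel M d" by auto
  then have C: "MCauchy \<sigma>'" "MCauchy \<tau>'" by (auto simp: completion_rel_def)
  have "(\<lambda>n. d (\<sigma> n) (\<sigma>' n) + d (\<tau> n) (\<tau>' n)) \<longlonglongrightarrow> 0 + 0"
    using rel unfolding completion_rel_def by (intro tendsto_add) auto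
  then have lim0: "(\<lambda>n. d (\<sigma> n) (\<tau> n) - d (\<sigma>' n) (\<tau>' n)) \<longlonglongrightarrow> 0"
    by (intro Lim_null_comparison[where f = "\<lambda>n. d (\<sigma> n) (\<tau> n) - d (\<sigma>' n) (\<tau>' n)"])
       (auto intro!: always_eventually dist_quadrilateral simp: MCauchy_in C assms)
  have "(\<lambda>n. d (\<sigma>' n) (\<tau>' n)) \<longlonglongrightarrow> lim (\<lambda>n. d (\<sigma>' n) (\<tau>' n))"
    using dist_MCauchy_convergent[OF C] by (simp add: convergent_LIMSEQ_iff)
  also have "lim (\<lambda>n. d (\<sigma>' n) (\<tau>' n)) = completion_dist M d (cclass \<sigma>) (cclass \<tau>)"
    using assms by (simp add: completion_dist_def cclass_in_carrier \<sigma>'_def \<tau>'_def)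
  finally show ?thesis using tendsto_add[OF lim0] by fastforce
qed

lemma completion_dist_cclass_le:
  assumes "MCauchy \<sigma>" "MCauchy \<tau>" "b \<longlonglongrightarrow> c" "\<And>n. d (\<sigma> n) (\<tau> n) \<le> b n"
  shows "completion_dist M d (cclass \<sigma>) (cclass \<tau>) \<le> c"
  using LIMSEQ_le[OF completion_dist_lim[OF assms(1,2)] assms(3)] assms(4) by blast

lemma Metric_space_completion: "Metric_space (completion_carrier M d) (completion_dist M d)"
proof
  show nn: "0 \<le> completion_dist M d X Y" for X Y
  proof (cases "X \<in> completion_carrier M d \<and> Y \<in> completion_carrier M d")
    case True
    then obtain \<sigma> \<tau> where *: "MCauchy \<sigma>" "X = cclass \<sigma>" "MCauchy \<tau>" "Y = cclass \<tau>"
      by (meson completion_carrier_cases)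
    then show ?thesis using LIMSEQ_le_const[OF completion_dist_lim[of \<sigma> \<tau>], of 0] by auto
  qed (auto simp: completion_dist_def)
  show "completion_dist M d X Y = completion_dist M d Y X" for X Y
    by (auto simp: completion_dist_def commute)
  show "completion_dist M d X Y = 0 \<longleftrightarrow> X = Y"
    if XY: "X \<in> completion_carrier M d" "Y \<in> completion_carrier M d" for X Y
  proof -
    obtain \<sigma> \<tau> where *: "MCauchy \<sigma>" "X = cclass \<sigma>" "MCauchy \<tau>" "Y = cclass \<tau>"
      using XY by (meson completion_carrier_cases)
    show ?thesis unfolding * cclass_eq_iff[OF *(1,3)]
      using completion_dist_lim[OF *(1,3)] LIMSEQ_unique by fastforce
  qed
  show "completion_dist M d X Z \<le> completion_dist M d X Y + completion_dist M d Y Z"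
    if XYZ: "X \<in> completion_carrier M d" "Y \<in> completion_carrier M d" "Z \<in> completion_carrier M d" for X Y Z
  proof -
    obtain \<sigma> \<tau> \<rho> where *: "MCauchy \<sigma>" "X = cclass \<sigma>" "MCauchy \<tau>" "Y = cclass \<tau>" "MCauchy \<rho>" "Z = cclass \<rho>"
      using XYZ by (meson completion_carrier_cases)
    show ?thesis unfolding *
      by (rule completion_dist_cclass_le[OF *(1,5) tendsto_add[OF completion_dist_lim[OF *(1,3)] completion_dist_lim[OF *(3,5)]]])
         (use * in \<open>auto intro!: triangle dest: MCauchy_in\<close>)
  qed
qed

lemma completion_embed_eq: "completion_embed M d x = cclass (\<lambda>n. x)"
  by (simp add: completion_embed_def)

lemma completion_embed_in: "x \<in> M \<Longrightarrow> completion_embed M d x \<in> completion_carrier M d"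
  by (simp add: completion_embed_eq cclass_in_carrier)

lemma completion_dist_embed:
  assumes "x \<in> M" "y \<in> M"
  shows "completion_dist M d (completion_embed M d x) (completion_embed M d y) = d x y"
  using completion_dist_lim[of "\<lambda>n. x" "\<lambda>n. y"] assms
  by (simp add: completion_embed_eq LIMSEQ_const_iff)

lemma completion_embed_dense:
  assumes \<sigma>: "MCauchy \<sigma>"
  shows "(\<lambda>n. completion_dist M d (completion_embed M d (\<sigma> n)) (cclass \<sigma>)) \<longlonglongrightarrow> 0"
proof (rule metric_LIMSEQ_I)
  fix e :: real assume "e > 0"
  then obtain N where N: "\<And>m n. N \<le> m \<Longrightarrow> N \<le> n \<Longrightarrow> d (\<sigma> m) (\<sigma> n) < e/2"
    using assms unfolding MCauchy_def by (metis half_gt_zero)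
  interpret C: Metric_space "completion_carrier M d" "completion_dist M d" by (rule Metric_space_completion)
  show "\<exists>no. \<forall>n\<ge>no. dist (completion_dist M d (completion_embed M d (\<sigma> n)) (cclass \<sigma>)) 0 < e"
  proof (intro exI[of _ N] allI impI)
    fix n assume n: "N \<le> n"
    have "(\<lambda>m. d (\<sigma> n) (\<sigma> m)) \<longlonglongrightarrow> completion_dist M d (cclass (\<lambda>m. \<sigma> n)) (cclass \<sigma>)"
      using completion_dist_lim[of "\<lambda>m. \<sigma> n" \<sigma>] \<sigma> by (simp add: MCauchy_in)
    then have "completion_dist M d (cclass (\<lambda>m. \<sigma> n)) (cclass \<sigma>) \<le> e/2"
      by (rule LIMSEQ_le_const2) (use N n in \<open>auto intro!: exI[of _ N] less_imp_le\<close>)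
    then show "dist (completion_dist M d (completion_embed M d (\<sigma> n)) (cclass \<sigma>)) 0 < e"
      using \<open>e > 0\<close> by (simp add: completion_embed_eq)
  qed
qed

lemma completion_cclass_eventually_const:
  assumes "MCauchy \<sigma>" "x \<in> M" "eventually (\<lambda>n. \<sigma> n = x) sequentially"
  shows "cclass \<sigma> = completion_embed M d x"
  unfolding completion_embed_eq using assms
  by (subst cclass_eq_iff) (auto intro!: tendsto_eventually elim!: eventually_mono)

end

subsection \<open>The CAT(0) inequality from Stewart's inequality\<close>

lemma Euclidean_Stewart:
  fixes x y z :: "'a::real_inner"
  shows "(dist z ((1 - t) *\<^sub>R x + t *\<^sub>R y))\<^sup>2 = (1 - t) * (dist z x)\<^sup>2 + t * (dist z y)\<^sup>2 - t * (1 - t) * (dist x y)\<^sup>2"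
  unfolding dist_norm power2_norm_eq_inner
  by (simp add: inner_simps inner_commute algebra_simps power2_eq_square)

text \<open>For \<open>t = 1/2\<close> this is the CN inequality of Bruhat and Tits. Demanding it
  for every \<open>t\<close> yields all division points of a segment at once, whereas building them
  from midpoints would use completeness, which open balls need not have.\<close>

definition Stewart_space :: "'a set \<Rightarrow> ('a \<Rightarrow> 'a \<Rightarrow> real) \<Rightarrow> bool" where
  "Stewart_space M d \<longleftrightarrow> (\<forall>x\<in>M. \<forall>y\<in>M. \<forall>t\<in>{0..1}. \<exists>a\<in>M. \<forall>z\<in>M.
     (d z a)\<^sup>2 \<le> (1 - t) * (d z x)\<^sup>2 + t * (d z y)\<^sup>2 - t * (1 - t) * (d x y)\<^sup>2)"

context Metric_space
begin

text \<open>The division point is unique: putting \<open>z = a\<close> into the inequality for the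
  point \<open>b\<close> provided by \<open>Stewart_space\<close> makes the right-hand side vanish,
  so \<open>a = b\<close>. The inequality thus holds along every geodesic.\<close>

lemma Stewart_division_point:
  assumes St: "Stewart_space M d" and M: "x \<in> M" "y \<in> M" "a \<in> M" "z \<in> M" and t: "0 \<le> t" "t \<le> 1"
    and a: "d x a = t * d x y" "d a y = (1 - t) * d x y"
  shows "(d z a)\<^sup>2 \<le> (1 - t) * (d z x)\<^sup>2 + t * (d z y)\<^sup>2 - t * (1 - t) * (d x y)\<^sup>2"
proof -
  obtain b where b: "b \<in> M"
    "\<And>z. z \<in> M \<Longrightarrow> (d z b)\<^sup>2 \<le> (1 - t) * (d z x)\<^sup>2 + t * (d z y)\<^sup>2 - t * (1 - t) * (d x y)\<^sup>2"
    using St M t unfolding Stewart_space_def by (metis atLeastAtMost_iff)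
  have "(d a b)\<^sup>2 \<le> (1 - t) * (t * d x y)\<^sup>2 + t * ((1 - t) * d x y)\<^sup>2 - t * (1 - t) * (d x y)\<^sup>2"
    using b(2)[OF M(3)] a by (simp add: commute)
  also have "\<dots> = 0" by (simp add: power2_eq_square algebra_simps)
  finally have "a = b" using M b by simp
  with b M show ?thesis by blast
qed

lemma Stewart_geodesic_segment:
  assumes St: "Stewart_space M d" and M: "x \<in> M" "y \<in> M"
  shows "\<exists>S. geodesic_segment M d x y S"
proof (cases "x = y")
  case True
  then show ?thesis using M by (intro exI[of _ "{x}"]) (auto simp: geodesic_segment_def intro!: exI[of _ "\<lambda>_. x"])
next
  case False
  define L where "L = d x y"
  have L: "L > 0" using False M by (simp add: L_def)
  have "\<forall>t\<in>{0..1}. \<exists>a\<in>M. \<forall>z\<in>M. (d z a)\<^sup>2 \<le> (1 - t) * (d z x)\<^sup>2 + t * (d z y)\<^sup>2 - t * (1 - t) * L\<^sup>2"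
    using St M unfolding Stewart_space_def L_def by blast
  then obtain c where c: "\<And>t. t \<in> {0..1} \<Longrightarrow> c t \<in> M"
    "\<And>t z. t \<in> {0..1} \<Longrightarrow> z \<in> M \<Longrightarrow>
      (d z (c t))\<^sup>2 \<le> (1 - t) * (d z x)\<^sup>2 + t * (d z y)\<^sup>2 - t * (1 - t) * L\<^sup>2"
    by metis
  have x: "d x (c t) \<le> t * L" and y: "d y (c t) \<le> (1 - t) * L" if t: "t \<in> {0..1}" for t
  proof -
    have "(d x (c t))\<^sup>2 \<le> t * L\<^sup>2 - t * (1 - t) * L\<^sup>2"
      using c(2)[OF t M(1)] M by (simp add: L_def)
    also have "\<dots> = (t * L)\<^sup>2" by (simp add: power2_eq_square algebra_simps)
    finally show "d x (c t) \<le> t * L" using t L by (simp add: power2_le_iff_abs_le)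
    have "(d y (c t))\<^sup>2 \<le> (1 - t) * L\<^sup>2 - t * (1 - t) * L\<^sup>2"
      using c(2)[OF t M(2)] M by (simp add: L_def commute)
    also have "\<dots> = ((1 - t) * L)\<^sup>2" by (simp add: power2_eq_square algebra_simps)
    finally show "d y (c t) \<le> (1 - t) * L" using t L by (simp add: power2_le_iff_abs_le)
  qed
  \<comment> \<open>Stewart's inequality at \<open>z = c s\<close> gives the upper bound. The lower
    one holds because the route \<open>x\<close>, \<open>c s\<close>, \<open>c t\<close>,
    \<open>y\<close> is at least \<open>L\<close> long.\<close>
  have st: "d (c s) (c t) = (t - s) * L" if s: "s \<in> {0..1}" and t: "t \<in> {0..1}" and "s \<le> t" for s t
  proof (rule antisym)
    have "(d (c s) (c t))\<^sup>2 \<le> (1 - t) * (d (c s) x)\<^sup>2 + t * (d (c s) y)\<^sup>2 - t * (1 - t) * L\<^sup>2"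
      by (rule c(2)[OF t c(1)[OF s]])
    also have "\<dots> \<le> (1 - t) * (s * L)\<^sup>2 + t * ((1 - s) * L)\<^sup>2 - t * (1 - t) * L\<^sup>2"
      using x[OF s] y[OF s] s t by (intro diff_right_mono add_mono mult_left_mono power_mono) (auto simp: commute)
    also have "\<dots> = ((t - s) * L)\<^sup>2" by (simp add: power2_eq_square algebra_simps)
    finally show "d (c s) (c t) \<le> (t - s) * L" using \<open>s \<le> t\<close> L by (simp add: power2_le_iff_abs_le)
    have "L \<le> d x (c s) + d (c s) (c t) + d y (c t)"
      using triangle[of x "c s" y] triangle[of "c s" "c t" y] M c(1) s t unfolding L_def
      by (simp add: commute[of y])
    then have "L \<le> s * L + d (c s) (c t) + (1 - t) * L" using x[OF s] y[OF t] by linarith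
    then show "(t - s) * L \<le> d (c s) (c t)" by (simp add: algebra_simps)
  qed
  have c0: "c 0 = x" using x[of 0] c(1)[of 0] M zero[of x "c 0"] nonneg[of x "c 0"] by force
  have c1: "c 1 = y" using y[of 1] c(1)[of 1] M zero[of y "c 1"] nonneg[of y "c 1"] by force
  have "d (c (s / L)) (c (t / L)) = \<bar>s - t\<bar>" if "s \<in> {0..L}" "t \<in> {0..L}" for s t
  proof (cases "s \<le> t")
    case True
    then show ?thesis using st[of "s/L" "t/L"] that L by (simp add: divide_simps)
  next
    case False
    then show ?thesis using st[of "t/L" "s/L"] that L by (simp add: divide_simps commute[of "c (s/L)"])
  qed
  then have "geodesic_segment M d x y ((\<lambda>s. c (s / L)) ` {0..L})"
    unfolding geodesic_segment_def L_def[symmetric] using c(1) c0 c1 L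
    by (auto intro!: exI[of _ "\<lambda>s. c (s / L)"] simp: divide_simps)
  then show ?thesis ..
qed

text \<open>One parameter \<open>t\<close> locates the point and its comparison point
  simultaneously, which is the form in which Stewart's inequality applies.\<close>

lemma comparison_point_division:
  assumes S: "geodesic_segment M d x y S" and c: "comparison_point d x S x' y' a a'"
    and L: "dist x' y' = d x y"
  obtains t where "0 \<le> t" "t \<le> 1" "a \<in> M" "d x a = t * d x y" "d a y = (1 - t) * d x y"
    "a' = (1 - t) *\<^sub>R x' + t *\<^sub>R y'"
proof -
  obtain \<gamma> where \<gamma>: "\<gamma> ` {0..d x y} = S" "\<gamma> 0 = x" "\<gamma> (d x y) = y"
    "\<And>s t. s\<in>{0..d x y} \<Longrightarrow> t\<in>{0..d x y} \<Longrightarrow> d (\<gamma> s) (\<gamma> t) = \<bar>s - t\<bar>" and SM: "S \<subseteq> M"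
    using S unfolding geodesic_segment_def by blast
  obtain s where s: "s \<in> {0..d x y}" "a = \<gamma> s" using c \<gamma>(1) by (auto simp: comparison_point_def)
  have xa: "d x a = s" "d a y = d x y - s" using \<gamma>(4)[of 0 s] \<gamma>(4)[of s "d x y"] \<gamma>(2,3) s by auto
  have "a' \<in> closed_segment x' y'" using c by (simp add: comparison_point_def)
  then obtain t where t: "0 \<le> t" "t \<le> 1" "a' = (1 - t) *\<^sub>R x' + t *\<^sub>R y'" by (auto simp: in_segment)
  have "dist x' a' = norm (t *\<^sub>R (x' - y'))" unfolding t(3) dist_norm by (simp add: algebra_simps)
  also have "\<dots> = t * d x y" using t L by (simp add: dist_norm)
  finally have "s = t * d x y" using c xa by (simp add: comparison_point_def)
  moreover have "a \<in> M" using s SM \<gamma>(1) by blast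
  ultimately show ?thesis using that[of t] t xa by (simp add: algebra_simps)
qed

text \<open>Stewart's inequality is used for \<open>b\<close> on the side from \<open>u\<close> to
  \<open>v\<close>, and then for \<open>a\<close> on the side from \<open>x\<close> to
  \<open>y\<close> as seen from \<open>u\<close> and from \<open>v\<close>. In the plane both
  relations are equalities, so the resulting bound is the square of \<open>dist a' b'\<close>. The
  two sides may coincide or share a vertex.\<close>

lemma Stewart_comparison:
  assumes St: "Stewart_space M d"
    and M: "x \<in> M" "y \<in> M" "u \<in> M" "v \<in> M" "a \<in> M" "b \<in> M"
    and t: "0 \<le> t" "t \<le> 1" "d x a = t * d x y" "d a y = (1 - t) * d x y" "a' = (1 - t) *\<^sub>R x' + t *\<^sub>R y'"
    and s: "0 \<le> s" "s \<le> 1" "d u b = s * d u v" "d b v = (1 - s) * d u v" "b' = (1 - s) *\<^sub>R u' + s *\<^sub>R v'"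
    and eq: "dist x' y' = d x y" "dist u' v' = d u v" "dist x' u' = d x u" "dist x' v' = d x v"
      "dist y' u' = d y u" "dist y' v' = d y v"
  shows "d a b \<le> dist a' (b'::complex)"
proof -
  have "(d a b)\<^sup>2 \<le> (1 - s) * (d a u)\<^sup>2 + s * (d a v)\<^sup>2 - s * (1 - s) * (d u v)\<^sup>2"
    using Stewart_division_point[OF St M(3,4,6,5) s(1-4)] .
  also have "\<dots> \<le> (1 - s) * ((1 - t) * (d u x)\<^sup>2 + t * (d u y)\<^sup>2 - t * (1 - t) * (d x y)\<^sup>2)
     + s * ((1 - t) * (d v x)\<^sup>2 + t * (d v y)\<^sup>2 - t * (1 - t) * (d x y)\<^sup>2) - s * (1 - s) * (d u v)\<^sup>2"
    using Stewart_division_point[OF St M(1,2,5,3) t(1-4)] Stewart_division_point[OF St M(1,2,5,4) t(1-4)] s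
    by (intro diff_right_mono add_mono mult_left_mono) (auto simp: commute)
  also have "\<dots> = (1 - s) * (dist a' u')\<^sup>2 + s * (dist a' v')\<^sup>2 - s * (1 - s) * (dist u' v')\<^sup>2"
    using Euclidean_Stewart[of u' t x' y'] Euclidean_Stewart[of v' t x' y']
    unfolding t(5)[symmetric] dist_commute[of u' x'] dist_commute[of u' y'] dist_commute[of v' x']
      dist_commute[of v' y'] dist_commute[of u' a'] dist_commute[of v' a'] eq
      commute[of u x] commute[of u y] commute[of v x] commute[of v y] by simp
  also have "\<dots> = (dist a' b')\<^sup>2" unfolding s(5) by (rule Euclidean_Stewart[symmetric])
  finally show ?thesis by (rule power2_le_imp_le) simp
qed

lemma CAT0_space_if_Stewart:
  assumes St: "Stewart_space M d"
  shows "CAT0_space M d"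
  unfolding CAT0_space_def
proof (intro conjI ballI allI impI)
  show "Metric_space M d" ..
  show "\<exists>S. geodesic_segment M d x y S" if "x \<in> M" "y \<in> M" for x y
    using Stewart_geodesic_segment[OF St that] .
  fix x y z Sxy Syz Szx
  assume M: "x \<in> M" "y \<in> M" "z \<in> M"
    and G: "geodesic_segment M d x y Sxy \<and> geodesic_segment M d y z Syz \<and> geodesic_segment M d z x Szx"
  show "CAT0_inequality d x y z Sxy Syz Szx"
    unfolding CAT0_inequality_def Let_def
  proof (intro allI impI)
    fix x' y' z' a a' b b'
    assume eq: "dist x' y' = d x y \<and> dist y' z' = d y z \<and> dist z' x' = d z x"
      and cmp: "(comparison_point d x Sxy x' y' a a' \<or> comparison_point d y Syz y' z' a a' \<or>
         comparison_point d z Szx z' x' a a') \<and>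
        (comparison_point d x Sxy x' y' b b' \<or> comparison_point d y Syz y' z' b b' \<or>
         comparison_point d z Szx z' x' b b')"
    \<comment> \<open>Pairing the vertices with their comparison vertices lets
      \<open>on_side\<close> forget which side carries a point, so the nine combinations of sides
      become one application of \<open>Stewart_comparison\<close>.\<close>
    define V where "V = {(x, x'), (y, y'), (z, z')}"
    define on_side where "on_side a a' \<longleftrightarrow> (\<exists>(u, u')\<in>V. \<exists>(v, v')\<in>V. \<exists>t. 0 \<le> t \<and> t \<le> 1 \<and> a \<in> M \<and>
       d u a = t * d u v \<and> d a v = (1 - t) * d u v \<and> a' = (1 - t) *\<^sub>R u' + t *\<^sub>R v')" for a and a' :: complex
    have sub: "on_side a a'" if h: "geodesic_segment M d u v S" "comparison_point d u S u' v' a a'"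
      "dist u' v' = d u v" "(u, u') \<in> V" "(v, v') \<in> V" for u v S u' v' a a'
    proof -
      obtain t where "0 \<le> t" "t \<le> 1" "a \<in> M" "d u a = t * d u v" "d a v = (1 - t) * d u v"
        "a' = (1 - t) *\<^sub>R u' + t *\<^sub>R v'"
        using comparison_point_division[OF h(1-3)] by blast
      then show ?thesis unfolding on_side_def
        by (intro bexI[OF _ h(4)] case_prodI bexI[OF _ h(5)] exI[of _ t]) simp
    qed
    have on: "on_side a a'" if "comparison_point d x Sxy x' y' a a' \<or> comparison_point d y Syz y' z' a a' \<or>
         comparison_point d z Szx z' x' a a'" for a a'
      using that
    proof (elim disjE)
      assume "comparison_point d x Sxy x' y' a a'"
      with G eq show ?thesis by (intro sub[of x y Sxy x' y']) (simp_all add: V_def)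
    next
      assume "comparison_point d y Syz y' z' a a'"
      with G eq show ?thesis by (intro sub[of y z Syz y' z']) (simp_all add: V_def)
    next
      assume "comparison_point d z Szx z' x' a a'"
      with G eq show ?thesis by (intro sub[of z x Szx z' x']) (simp_all add: V_def)
    qed
    have Veq: "u \<in> M" "dist u' v' = d u v" if "(u, u') \<in> V" "(v, v') \<in> V" for u u' v v'
      using that eq M unfolding V_def by (auto simp: dist_commute commute)
    obtain u u' v v' t where 1: "(u, u') \<in> V" "(v, v') \<in> V" "0 \<le> t" "t \<le> 1" "a \<in> M"
      "d u a = t * d u v" "d a v = (1 - t) * d u v" "a' = (1 - t) *\<^sub>R u' + t *\<^sub>R v'"
      using on[of a a'] cmp unfolding on_side_def by blast
    obtain p p' q q' s where 2: "(p, p') \<in> V" "(q, q') \<in> V" "0 \<le> s" "s \<le> 1" "b \<in> M"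
      "d p b = s * d p q" "d b q = (1 - s) * d p q" "b' = (1 - s) *\<^sub>R p' + s *\<^sub>R q'"
      using on[of b b'] cmp unfolding on_side_def by blast
    show "d a b \<le> dist a' b'"
      by (rule Stewart_comparison[OF St, of u v p q a b t a' u' v' s b' p' q']) (use 1 2 Veq in blast)+
  qed
qed

end

lemma Stewart_space_isometric:
  assumes "Stewart_space Q D" "\<phi> ` Q = M" "\<And>u v. u \<in> Q \<Longrightarrow> v \<in> Q \<Longrightarrow> d (\<phi> u) (\<phi> v) = D u v"
  shows "Stewart_space M d"
  unfolding Stewart_space_def
proof (intro ballI)
  fix x y t assume *: "x \<in> M" "y \<in> M" "t \<in> {0..1::real}"
  then obtain u v where uv: "u \<in> Q" "v \<in> Q" "x = \<phi> u" "y = \<phi> v" using assms(2) by blast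
  obtain a where a: "a \<in> Q" "\<forall>z\<in>Q. (D z a)\<^sup>2 \<le> (1 - t) * (D z u)\<^sup>2 + t * (D z v)\<^sup>2 - t * (1 - t) * (D u v)\<^sup>2"
    using assms(1) uv * unfolding Stewart_space_def by blast
  show "\<exists>a\<in>M. \<forall>z\<in>M. (d z a)\<^sup>2 \<le> (1 - t) * (d z x)\<^sup>2 + t * (d z y)\<^sup>2 - t * (1 - t) * (d x y)\<^sup>2"
    using a assms(2,3) uv by (intro bexI[of _ "\<phi> a"]) auto
qed

lemma Stewart_space_convex:
  fixes C :: "'a::real_inner set"
  assumes "convex C" shows "Stewart_space C dist"
  unfolding Stewart_space_def
proof (intro ballI)
  fix x y and t :: real assume "x \<in> C" "y \<in> C" "t \<in> {0..1}"
  then have "(1 - t) *\<^sub>R x + t *\<^sub>R y \<in> C" using assms by (simp add: convex_alt)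
  then show "\<exists>a\<in>C. \<forall>z\<in>C. (dist z a)\<^sup>2 \<le> (1 - t) * (dist z x)\<^sup>2 + t * (dist z y)\<^sup>2 - t * (1 - t) * (dist x y)\<^sup>2"
    by (rule bexI[rotated]) (simp add: Euclidean_Stewart)
qed

subsection \<open>Cones over circles\<close>

lemma abs_Arg_mult_le: "\<bar>Arg (u * v)\<bar> \<le> \<bar>Arg u\<bar> + \<bar>Arg v\<bar>"
proof (cases "u = 0 \<or> v = 0")
  case False
  then show ?thesis
    using Arg_times'[of u v] Arg_bounded[of u] Arg_bounded[of v] by (auto split: if_splits)
qed auto

lemma abs_Arg_inverse: "\<bar>Arg (inverse z)\<bar> = \<bar>Arg z\<bar>"
  by (simp add: Arg_inverse)

lemma abs_Arg_divide_commute: "\<bar>Arg (u / v)\<bar> = \<bar>Arg (v / u)\<bar>"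
  using abs_Arg_inverse[of "u / v"] by simp

lemma abs_Arg_le_pi: "\<bar>Arg z\<bar> \<le> pi"
  using Arg_bounded[of z] by auto

lemma abs_Arg_divide_triangle:
  assumes "v \<noteq> 0"
  shows "\<bar>Arg (u / w)\<bar> \<le> \<bar>Arg (u / v)\<bar> + \<bar>Arg (v / w)\<bar>"
  using abs_Arg_mult_le[of "u / v" "v / w"] assms by simp

lemma abs_Arg_rcis:
  assumes "0 < r" "\<bar>a\<bar> \<le> pi" shows "\<bar>Arg (of_real r * cis a)\<bar> = \<bar>a\<bar>"
proof (cases "a = - pi")
  case True
  then have "of_real r * cis a = rcis r pi" by (simp add: rcis_def complex_eq_iff)
  then show ?thesis using Arg_rcis[of pi r] assms True by simp
next
  case False
  then have "a \<in> {-pi<..pi}" using assms by auto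
  then show ?thesis using Arg_rcis[of a r] assms by (simp add: rcis_def)
qed

lemma abs_Arg_cis: "\<bar>a\<bar> \<le> pi \<Longrightarrow> \<bar>Arg (cis a)\<bar> = \<bar>a\<bar>"
  using abs_Arg_rcis[of 1 a] by simp

lemma abs_Arg_cis_le: "\<bar>Arg (cis a)\<bar> \<le> \<bar>a\<bar>"
  using abs_Arg_cis[of a] abs_Arg_le_pi[of "cis a"] by linarith

lemma cmod_cis_diff_sq:
  "(cmod (of_real r * cis a - of_real s * cis b))\<^sup>2 = r\<^sup>2 + s\<^sup>2 - 2 * r * s * cos (a - b)"
proof -
  have "(cmod (of_real r * cis a - of_real s * cis b))\<^sup>2
    = r\<^sup>2 * ((cos a)\<^sup>2 + (sin a)\<^sup>2) + s\<^sup>2 * ((cos b)\<^sup>2 + (sin b)\<^sup>2) - 2 * r * s * (cos a * cos b + sin a * sin b)"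
    by (simp only: cmod_power2 minus_complex.simps times_complex.simps Re_complex_of_real Im_complex_of_real cis.simps) algebra
  then show ?thesis by (simp only: sin_cos_squared_add2 cos_diff)
qed

lemma Metric_space_circle: "Metric_space (sphere 0 1) circle_dist"
proof
  show "0 \<le> circle_dist x y" for x y by (simp add: circle_dist_def)
  show "circle_dist x y = circle_dist y x" for x y
    by (simp add: circle_dist_def abs_Arg_divide_commute)
  show "circle_dist x z \<le> circle_dist x y + circle_dist y z" if "y \<in> sphere 0 1" for x y z
    unfolding circle_dist_def using that by (intro abs_Arg_divide_triangle) auto
  show "circle_dist x y = 0 \<longleftrightarrow> x = y" if "x \<in> sphere 0 1" "y \<in> sphere 0 1" for x y
  proof -
    have "x \<noteq> 0" "y \<noteq> 0" "cmod x = 1" "cmod y = 1" using that by auto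
    moreover have "x = y" if "Arg (x / y) = 0"
    proof -
      have "cmod (x / y) = 1" using calculation by (simp add: norm_divide)
      then have "x / y = 1" using rcis_cmod_Arg[of "x / y"] that by (simp add: rcis_def)
      then show ?thesis using calculation by simp
    qed
    ultimately show ?thesis by (auto simp: circle_dist_def)
  qed
qed

lemma Metric_space_annulus: "Metric_space (sphere 0 1 \<times> UNIV) annulus_dist"
proof -
  interpret C: Metric_space "sphere 0 1" circle_dist by (rule Metric_space_circle)
  interpret Metric_space12 "sphere 0 1" circle_dist "UNIV :: real set" dist ..
  show ?thesis unfolding annulus_dist_def by (rule prod_metric)
qed

lemma annulus_dist_commute: "annulus_dist x y = annulus_dist y x"
  using Metric_space_annulus by (simp add: Metric_space.commute)

lemma annulus_dist_cis_le: "annulus_dist (cis a, s) (cis b, t) \<le> sqrt ((a - b)\<^sup>2 + (s - t)\<^sup>2)"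
  unfolding annulus_dist_def prod_dist_def circle_dist_def prod.case
  using abs_Arg_cis_le[of "a - b"] by (auto simp: cis_divide dist_real_def abs_le_square_iff)

lemma annulus_dist_cis:
  assumes "\<bar>a - b\<bar> \<le> pi"
  shows "annulus_dist (cis a, s) (cis b, t) = sqrt ((a - b)\<^sup>2 + (s - t)\<^sup>2)"
  unfolding annulus_dist_def prod_dist_def circle_dist_def prod.case
  using abs_Arg_cis[OF assms] by (simp add: cis_divide dist_real_def)

lemma i_A_eq: "z \<noteq> 0 \<Longrightarrow> i_A z \<in> sphere 0 1 \<times> UNIV"
  by (simp add: i_A_def norm_sgn)

lemma i_A_exp: "i_A (exp w) = (cis (Im w), tanh (Re w))"
proof -
  have "sgn (exp w) = sgn (of_real (exp (Re w)) * cis (Im w))" by (simp add: exp_eq_polar)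
  then have "sgn (exp w) = cis (Im w)" by (simp add: sgn_mult sgn_of_real)
  moreover have "((exp (Re w))\<^sup>2 - 1) / ((exp (Re w))\<^sup>2 + 1) = tanh (Re w)"
  proof -
    have "exp (Re w) > 0" by simp
    then show ?thesis unfolding tanh_def sinh_def cosh_def exp_minus
      by (simp add: divide_simps power2_eq_square add_pos_pos)
  qed
  ultimately show ?thesis by (simp add: i_A_def)
qed

text \<open>The projection of the cone onto the plane: it keeps the radius and multiplies the angle
  by \<open>k\<close>, and is a local isometry away from the apex.\<close>

definition cone_proj :: "nat \<Rightarrow> complex \<Rightarrow> complex" where
  "cone_proj k z = of_real (cmod z) * sgn z ^ k"

text \<open>Angles on the circle of length \<open>2 * pi * k\<close>, cut off at \<open>pi\<close>:
  beyond \<open>pi\<close> a shortest curve passes through the apex, and \<open>cis pi = -1\<close>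
  then makes \<open>cone_dist\<close> the sum of the radii.\<close>

definition cone_angle :: "nat \<Rightarrow> complex \<Rightarrow> complex \<Rightarrow> real" where
  "cone_angle k x y = min pi (real k * \<bar>Arg (x / y)\<bar>)"

text \<open>The distance of the cone of total angle \<open>2 * pi * k\<close>, whose points are given by the absolute
  value and by the argument divided by \<open>k\<close>.\<close>

definition cone_dist :: "nat \<Rightarrow> complex \<Rightarrow> complex \<Rightarrow> real" where
  "cone_dist k x y = cmod (of_real (cmod x) - of_real (cmod y) * cis (cone_angle k x y))"

lemma norm_cone_proj: "0 < k \<Longrightarrow> cmod (cone_proj k z) = cmod z"
  by (cases "z = 0") (auto simp: cone_proj_def norm_mult norm_power norm_sgn)

lemma cone_proj_1 [simp]: "cone_proj 1 z = z" "cone_proj (Suc 0) z = z"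
  by (cases "z = 0"; simp add: cone_proj_def sgn_div_norm scaleR_conv_of_real field_simps)+

lemma sgn_complex_cis_Arg: "z \<noteq> 0 \<Longrightarrow> sgn z = cis (Arg z)"
  by (simp add: cis_Arg)

lemma cone_angle_commute: "cone_angle k x y = cone_angle k y x"
  unfolding cone_angle_def by (simp add: abs_Arg_divide_commute[of x y])

lemma cone_angle_nonneg: "0 \<le> cone_angle k x y" and cone_angle_le_pi: "cone_angle k x y \<le> pi"
  by (simp_all add: cone_angle_def)

lemma cone_angle_triangle:
  assumes "y \<noteq> 0" shows "cone_angle k x z \<le> cone_angle k x y + cone_angle k y z"
proof -
  have "real k * \<bar>Arg (x / z)\<bar> \<le> real k * \<bar>Arg (x / y)\<bar> + real k * \<bar>Arg (y / z)\<bar>"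
    using mult_left_mono[OF abs_Arg_divide_triangle[OF assms, of x z], of "real k"] by (simp add: algebra_simps)
  moreover have "0 \<le> real k * \<bar>Arg (x / y)\<bar>" "0 \<le> real k * \<bar>Arg (y / z)\<bar>" by auto
  moreover have "min p a \<le> min p b + min p c" if "a \<le> b + c" "0 \<le> b" "0 \<le> c" "0 \<le> p" for a b c p :: real
    using that by (auto simp: min_def)
  ultimately show ?thesis unfolding cone_angle_def by simp
qed

lemma cone_dist_nonneg [simp]: "0 \<le> cone_dist k x y"
  by (simp add: cone_dist_def)

lemma cone_dist_sq: "(cone_dist k x y)\<^sup>2 = (cmod x)\<^sup>2 + (cmod y)\<^sup>2 - 2 * cmod x * cmod y * cos (cone_angle k x y)"
  using cmod_cis_diff_sq[of "cmod x" 0 "cmod y" "cone_angle k x y"] by (simp add: cone_dist_def)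

lemma cone_dist_commute: "cone_dist k x y = cone_dist k y x"
proof -
  have "(cone_dist k x y)\<^sup>2 = (cone_dist k y x)\<^sup>2"
    unfolding cone_dist_sq cone_angle_commute[of k x y] by simp
  then show ?thesis by (simp add: power2_eq_iff_nonneg)
qed

lemma cone_dist_le: "cone_dist k x y \<le> cmod x + cmod y"
  unfolding cone_dist_def by (rule order.trans[OF norm_triangle_ineq4]) (simp add: norm_mult)

lemma cone_dist_0 [simp]: "cone_dist k 0 y = cmod y" "cone_dist k x 0 = cmod x"
  by (simp_all add: cone_dist_def norm_mult)

text \<open>\<open>sgn x ^ k\<close> arises from \<open>sgn y ^ k\<close> by a rotation through
  \<open>k * Arg (x / y)\<close>. As long as this angle does not exceed \<open>pi\<close> in
  absolute value, it is the angle of the cone and the projection preserves the distance.\<close>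

lemma cone_dist_eq_proj:
  assumes k: "0 < k" and a: "real k * \<bar>Arg (x / y)\<bar> \<le> pi"
  shows "cone_dist k x y = cmod (cone_proj k x - cone_proj k y)"
proof (cases "x = 0 \<or> y = 0")
  case True
  then show ?thesis using norm_cone_proj[OF k] k by (auto simp: cone_proj_def norm_mult norm_power norm_sgn)
next
  case False
  have "sgn x = sgn y * sgn (x / y)" unfolding sgn_mult[symmetric] using False by simp
  then have "sgn x ^ k = (sgn y * sgn (x / y)) ^ k" by (rule arg_cong)
  also have "\<dots> = sgn y ^ k * cis (real k * Arg (x / y))"
    using False by (simp only: power_mult_distrib sgn_complex_cis_Arg[of "x / y"] Complex.DeMoivre divide_eq_0_iff simp_thms)
  finally have "sgn x ^ k = sgn y ^ k * cis (real k * Arg (x / y))" .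
  then have "cone_proj k x - cone_proj k y = sgn y ^ k * (of_real (cmod x) * cis (real k * Arg (x / y)) - of_real (cmod y) * cis 0)"
    unfolding cone_proj_def by (simp add: algebra_simps)
  then have "cmod (cone_proj k x - cone_proj k y) = cmod (of_real (cmod x) * cis (real k * Arg (x / y)) - of_real (cmod y) * cis 0)"
    using False by (simp add: norm_mult norm_power norm_sgn)
  then have "(cmod (cone_proj k x - cone_proj k y))\<^sup>2 = (cmod x)\<^sup>2 + (cmod y)\<^sup>2 - 2 * cmod x * cmod y * cos (real k * Arg (x / y))"
    by (simp only: cmod_cis_diff_sq) simp
  also have "cos (real k * Arg (x / y)) = cos (cone_angle k x y)"
  proof -
    have "cone_angle k x y = \<bar>real k * Arg (x / y)\<bar>" using a by (simp add: cone_angle_def abs_mult)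
    then show ?thesis by simp
  qed
  finally have "(cone_dist k x y)\<^sup>2 = (cmod (cone_proj k x - cone_proj k y))\<^sup>2" by (simp add: cone_dist_sq)
  then show ?thesis by (simp add: power2_eq_iff_nonneg)
qed

lemma cone_dist_1: "cone_dist 1 x y = dist x y"
  using cone_dist_eq_proj[of 1 x y] abs_Arg_le_pi[of "x / y"] by (simp add: dist_norm)

lemma cmod_cis_mono:
  assumes "0 \<le> r" "0 \<le> s" "0 \<le> a" "a \<le> b" "b \<le> pi"
  shows "cmod (of_real r - of_real s * cis a) \<le> cmod (of_real r - of_real s * cis b)"
proof -
  have "cos b \<le> cos a" using assms by (intro cos_monotone_0_pi_le)
  then have "r * s * cos b \<le> r * s * cos a" using assms by (intro mult_left_mono) auto
  then have "(cmod (of_real r - of_real s * cis a))\<^sup>2 \<le> (cmod (of_real r - of_real s * cis b))\<^sup>2"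
    using cmod_cis_diff_sq[of r 0 s a] cmod_cis_diff_sq[of r 0 s b] by simp
  then show ?thesis by (rule power2_le_imp_le) simp
qed

text \<open>The sectors between \<open>x\<close> and \<open>y\<close> and between \<open>y\<close>
  and \<open>z\<close> are laid side by side in the plane. Shortening the second angle to at most
  \<open>pi - b\<close> keeps the sum in the range where a chord grows with its angle, so the planar
  triangle inequality for the unfolded points suffices.\<close>

lemma cone_dist_triangle: "cone_dist k x z \<le> cone_dist k x y + cone_dist k y z"
proof (cases "y = 0")
  case True
  then show ?thesis using cone_dist_le[of k x z] by simp
next
  case False
  define b where "b = cone_angle k x y"
  define c where "c = min (cone_angle k y z) (pi - b)"
  note A = cone_angle_nonneg[of k] cone_angle_le_pi[of k]
  have c: "0 \<le> c" "c \<le> cone_angle k y z" "0 \<le> b" "b + c \<le> pi" "cone_angle k x z \<le> b + c"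
    using cone_angle_triangle[OF False, of k x z] A[of x y] A[of y z] A[of x z] by (auto simp: b_def c_def)
  have "cone_dist k x z \<le> cmod (of_real (cmod x) - of_real (cmod z) * cis (b + c))"
    unfolding cone_dist_def using A c by (intro cmod_cis_mono) auto
  also have "\<dots> = cmod (of_real (cmod x) * cis (-b) - of_real (cmod z) * cis c)"
  proof -
    have "of_real (cmod x) - of_real (cmod z) * cis (b + c) = cis b * (of_real (cmod x) * cis (-b) - of_real (cmod z) * cis c)"
      by (simp add: right_diff_distrib mult.left_commute[of "cis b"] cis_mult)
    then show ?thesis by (simp add: norm_mult)
  qed
  also have "\<dots> \<le> cmod (of_real (cmod x) * cis (-b) - of_real (cmod y)) + cmod (of_real (cmod y) - of_real (cmod z) * cis c)"
    using norm_triangle_ineq[of "of_real (cmod x) * cis (-b) - of_real (cmod y)" "of_real (cmod y) - of_real (cmod z) * cis c"]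
    by simp
  also have "cmod (of_real (cmod x) * cis (-b) - of_real (cmod y)) = cone_dist k x y"
  proof -
    have "of_real (cmod x) * cis (-b) - of_real (cmod y) = cis (-b) * (of_real (cmod x) - of_real (cmod y) * cis b)"
      by (simp add: algebra_simps cis_mult)
    then show ?thesis by (simp add: norm_mult cone_dist_def b_def)
  qed
  also have "cmod (of_real (cmod y) - of_real (cmod z) * cis c) \<le> cone_dist k y z"
    unfolding cone_dist_def using A c by (intro cmod_cis_mono) auto
  finally show ?thesis by simp
qed

lemma Stewart_from_projection:
  fixes \<rho> w :: real
  assumes "\<rho>\<^sup>2 = (1 - t) * X\<^sup>2 + t * Y\<^sup>2 - t * (1 - t) * L" "0 \<le> w"
    and "(1 - t) * (X * cx) + t * (Y * cy) \<le> \<rho> * ca"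
  shows "w\<^sup>2 + \<rho>\<^sup>2 - 2 * w * \<rho> * ca \<le> (1 - t) * (w\<^sup>2 + X\<^sup>2 - 2 * w * X * cx)
     + t * (w\<^sup>2 + Y\<^sup>2 - 2 * w * Y * cy) - t * (1 - t) * L"
proof -
  have "w * ((1 - t) * (X * cx) + t * (Y * cy)) \<le> w * (\<rho> * ca)"
    using assms by (intro mult_left_mono)
  then show ?thesis unfolding assms(1) by (simp add: algebra_simps)
qed

text \<open>Since the Stewart relation holds with equality for the apex, the one for \<open>z\<close> reduces to the
  concavity of \<open>cmod a * cos (cone_angle k z a)\<close> along the segment.\<close>

lemma cone_Stewart_if_projection:
  assumes "(cmod a)\<^sup>2 = (1 - t) * (cmod x)\<^sup>2 + t * (cmod y)\<^sup>2 - t * (1 - t) * (cone_dist k x y)\<^sup>2"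
    and "\<And>z. z \<noteq> 0 \<Longrightarrow> (1 - t) * (cmod x * cos (cone_angle k z x)) + t * (cmod y * cos (cone_angle k z y))
       \<le> cmod a * cos (cone_angle k z a)"
  shows "(cone_dist k z a)\<^sup>2 \<le> (1 - t) * (cone_dist k z x)\<^sup>2 + t * (cone_dist k z y)\<^sup>2 - t * (1 - t) * (cone_dist k x y)\<^sup>2"
proof (cases "z = 0")
  case True
  then show ?thesis using assms(1) by simp
next
  case False
  show ?thesis
    using Stewart_from_projection[OF assms(1) norm_ge_zero[of z] assms(2)[OF False]]
    unfolding cone_dist_sq[of k z] by simp
qed

text \<open>The segment from \<open>X\<close> to \<open>Y * cis b\<close> avoids the cut of the
  principal argument, so \<open>Arg\<close> is continuous along it.\<close>

lemma segment_not_nonpos_Reals: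
  assumes "0 < X" "0 < Y" "\<bar>b\<bar> < pi" "0 \<le> t" "t \<le> 1"
  shows "of_real ((1 - t) * X) + of_real (t * Y) * cis b \<notin> \<real>\<^sub>\<le>\<^sub>0"
proof
  assume "of_real ((1 - t) * X) + of_real (t * Y) * cis b \<in> \<real>\<^sub>\<le>\<^sub>0"
  then have *: "(1 - t) * X + t * Y * cos b \<le> 0" "t * Y * sin b = 0"
    by (auto simp: complex_nonpos_Reals_iff)
  have "sin b = 0 \<Longrightarrow> b = 0" using sin_eq_0_pi[of b] assms(3) by auto
  then have "t = 0 \<or> b = 0" using * assms by auto
  then show False
  proof
    assume "t = 0" then show False using * assms by simp
  next
    assume "b = 0"
    then have "(1 - t) * X + t * Y \<le> 0" using * by simp
    moreover have "0 \<le> (1 - t) * X" "0 \<le> t * Y" using assms by auto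
    ultimately have "(1 - t) * X = 0" "t * Y = 0" by linarith+
    then show False using assms by auto
  qed
qed

text \<open>\<open>Im c\<close> has weakly the sign of \<open>sin b\<close>, so \<open>Arg c\<close>
  lies on the same side of 0 as \<open>b\<close>.\<close>

lemma segment_Arg:
  assumes "0 < X" "0 < Y" "\<bar>b\<bar> < pi" "0 \<le> t" "t \<le> 1"
  defines "c \<equiv> of_real ((1 - t) * X) + of_real (t * Y) * cis b"
  shows "\<bar>Arg c\<bar> \<le> pi" "\<bar>b - Arg c\<bar> \<le> pi"
proof -
  show "\<bar>Arg c\<bar> \<le> pi" by (rule abs_Arg_le_pi)
  have Im: "Im c = t * Y * sin b" by (simp add: c_def)
  have nn: "c \<notin> \<real>\<^sub>\<le>\<^sub>0" unfolding c_def by (rule segment_not_nonpos_Reals) fact+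
  show "\<bar>b - Arg c\<bar> \<le> pi"
  proof (cases "b \<ge> 0")
    case True
    then have "0 \<le> Im c" using assms sin_ge_zero[of b] by (simp add: Im)
    then have "0 \<le> Arg c" by (simp add: Arg_less_0)
    then show ?thesis using True assms Arg_bounded[of c] by auto
  next
    case False
    then have "sin b \<le> 0" using sin_ge_zero[of "-b"] assms by simp
    then have "Im c \<le> 0" using assms by (simp add: Im mult_nonneg_nonpos)
    then have "Arg c \<le> 0"
    proof (cases "Im c = 0")
      case True
      then have "Arg c = 0" using nn by (auto simp: Arg_eq_0 complex_nonpos_Reals_iff complex_is_Real_iff)
      then show ?thesis by simp
    next
      case False
      then have "Arg c < 0" using \<open>Im c \<le> 0\<close> by (simp add: Arg_neg_iff)
      then show ?thesis by simp
    qed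
    then show ?thesis using False assms Arg_bounded[of c] by auto
  qed
qed

text \<open>The sector between \<open>x\<close> and \<open>y\<close> has an angle below
  \<open>pi\<close>, so it unfolds isometrically into the plane with \<open>x\<close> on the
  positive axis and \<open>y\<close> at angle \<open>\<beta>\<close>. There \<open>c\<close> is the
  division point, and \<open>a\<close> is the point of the cone above it. What remains is that the
  projections of \<open>x\<close> and \<open>y\<close> onto the direction of any \<open>z\<close>
  average to at most that of \<open>a\<close>.\<close>

lemma cone_Stewart_sector:
  assumes k: "2 \<le> k" and xy: "x \<noteq> 0" "y \<noteq> 0" and b: "real k * \<bar>Arg (x / y)\<bar> < pi" and t: "0 \<le> t" "t \<le> 1"
  shows "\<exists>a. \<forall>z. (cone_dist k z a)\<^sup>2 \<le> (1 - t) * (cone_dist k z x)\<^sup>2 + t * (cone_dist k z y)\<^sup>2 - t * (1 - t) * (cone_dist k x y)\<^sup>2"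
proof -
  define \<beta> where "\<beta> = real k * Arg (y / x)"
  define c where "c = of_real ((1 - t) * cmod x) + of_real (t * cmod y) * cis \<beta>"
  define \<psi> where "\<psi> = Arg c"
  define a where "a = of_real (cmod c) * sgn x * cis (\<psi> / k)"
  have k0: "real k > 0" using k by simp
  have \<beta>: "\<bar>\<beta>\<bar> < pi" "\<bar>\<beta>\<bar> = real k * \<bar>Arg (x / y)\<bar>"
    using b by (simp_all add: \<beta>_def abs_mult abs_Arg_divide_commute[of x])
  have cn: "c \<notin> \<real>\<^sub>\<le>\<^sub>0" unfolding c_def using xy \<beta> t by (intro segment_not_nonpos_Reals) auto
  then have c0: "c \<noteq> 0" by auto
  have \<psi>: "\<bar>\<psi>\<bar> \<le> pi" "\<bar>\<beta> - \<psi>\<bar> \<le> pi"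
    using segment_Arg[of "cmod x" "cmod y" \<beta> t] xy \<beta> t by (auto simp: \<psi>_def c_def)
  have cpol: "c = of_real (cmod c) * cis \<psi>" using rcis_cmod_Arg[of c] by (simp add: rcis_def \<psi>_def)
  have sx: "sgn x = x / of_real (cmod x)" "cmod (sgn x) = 1" using xy by (simp add: sgn_eq, simp add: norm_sgn)
  have na: "cmod a = cmod c" using sx(2) by (simp add: a_def norm_mult)
  have a0: "a \<noteq> 0" using c0 na by auto
  have xa: "x / a = of_real (cmod x / cmod c) * cis (- \<psi> / k)"
    using xy c0 by (simp add: a_def sx(1) cis_divide[symmetric] cis_inverse[symmetric] field_simps)
  have yx: "y / x = of_real (cmod y / cmod x) * cis (\<beta> / k)"
    using rcis_cmod_Arg[of "y / x"] k0 by (simp add: rcis_def norm_divide \<beta>_def)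
  have ya: "y / a = of_real (cmod y / cmod c) * cis ((\<beta> - \<psi>) / k)"
  proof -
    have "y / a = (y / x) * (x / a)" using xy by simp
    also have "\<dots> = of_real (cmod y / cmod x) * of_real (cmod x / cmod c) * (cis (\<beta> / k) * cis (- \<psi> / k))"
      unfolding xa yx by (simp only: mult_ac)
    also have "\<dots> = of_real (cmod y / cmod c) * cis ((\<beta> - \<psi>) / k)"
      using xy by (simp add: cis_mult diff_divide_distrib)
    finally show ?thesis .
  qed
  \<comment> \<open>The component of \<open>c\<close> in any direction is the weighted mean of the
    components of the end points; \<open>\<phi>\<close> is the angle between \<open>c\<close> and
    that direction.\<close>
  have c_phase: "cmod c * cos \<phi> = (1 - t) * (cmod x * cos (\<phi> - \<psi>)) + t * (cmod y * cos (\<phi> + (\<beta> - \<psi>)))" for \<phi>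
  proof -
    have "of_real (cmod c) * cis \<phi> = c * cis (\<phi> - \<psi>)"
      by (subst cpol) (simp add: cis_mult mult.assoc)
    also have "\<dots> = of_real ((1 - t) * cmod x) * cis (\<phi> - \<psi>) + of_real (t * cmod y) * cis (\<phi> + (\<beta> - \<psi>))"
      by (simp add: c_def distrib_right mult.assoc cis_mult add_diff_eq add.commute)
    finally have "Re (of_real (cmod c) * cis \<phi>) = Re (of_real ((1 - t) * cmod x) * cis (\<phi> - \<psi>) + of_real (t * cmod y) * cis (\<phi> + (\<beta> - \<psi>)))"
      by simp
    then show ?thesis by simp
  qed
  have Stewart0: "(cmod a)\<^sup>2 = (1 - t) * (cmod x)\<^sup>2 + t * (cmod y)\<^sup>2 - t * (1 - t) * (cone_dist k x y)\<^sup>2"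
  proof -
    have "cone_angle k x y = \<bar>\<beta>\<bar>" using \<beta> by (simp add: cone_angle_def)
    then have L: "(cone_dist k x y)\<^sup>2 = (cmod x)\<^sup>2 + (cmod y)\<^sup>2 - 2 * cmod x * cmod y * cos \<beta>"
      by (simp add: cone_dist_sq)
    have "(cmod c)\<^sup>2 = ((1 - t) * cmod x)\<^sup>2 + (t * cmod y)\<^sup>2 + 2 * ((1 - t) * cmod x) * (t * cmod y) * cos \<beta>"
      using cmod_cis_diff_sq[of "(1 - t) * cmod x" 0 "- (t * cmod y)" \<beta>] by (simp add: c_def)
    then show ?thesis unfolding na L by (simp add: power2_eq_square algebra_simps)
  qed
  show ?thesis
  proof (intro exI[of _ a] allI cone_Stewart_if_projection[OF Stewart0])
    fix z :: complex assume z: "z \<noteq> 0"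
    define \<gamma> where "\<gamma> = real k * Arg (a / z)"
    have az: "a / z = of_real (cmod a / cmod z) * cis (\<gamma> / k)"
      using rcis_cmod_Arg[of "a / z"] k0 by (simp add: rcis_def norm_divide \<gamma>_def)
    have ang_a: "cone_angle k z a = min pi \<bar>\<gamma>\<bar>"
      by (simp add: cone_angle_def \<gamma>_def abs_mult abs_Arg_divide_commute[of z])
    show "(1 - t) * (cmod x * cos (cone_angle k z x)) + t * (cmod y * cos (cone_angle k z y))
       \<le> cmod a * cos (cone_angle k z a)"
    proof (cases "\<bar>\<gamma>\<bar> \<le> pi")
      case True
      \<comment> \<open>Here \<open>k >= 2\<close> enters: \<open>\<gamma> + \<xi>\<close> is at
        most \<open>2 * pi <= k * pi\<close> in absolute value, so the angle between
        \<open>w\<close> and \<open>z\<close> is not reduced modulo a full turn. Cutting it off at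
        \<open>pi\<close> can only lower the cosine, to -1.\<close>
      have bound: "cos (cone_angle k z w) \<le> cos (\<gamma> + \<xi>)"
        if w: "w / a = of_real r * cis (\<xi> / k)" "0 < r" "\<bar>\<xi>\<bar> \<le> pi" for w \<xi> r
      proof -
        have "w / z = (w / a) * (a / z)" using a0 by simp
        also have "\<dots> = of_real (r * (cmod a / cmod z)) * cis ((\<gamma> + \<xi>) / k)"
          unfolding w(1) az by (simp add: add_divide_distrib cis_mult[symmetric] mult_ac)
        finally have wz: "w / z = of_real (r * (cmod a / cmod z)) * cis ((\<gamma> + \<xi>) / k)" .
        have "\<bar>\<gamma> + \<xi>\<bar> \<le> 2 * pi" using True w by linarith
        moreover have "2 * pi \<le> real k * pi" using k by simp
        ultimately have "\<bar>\<gamma> + \<xi>\<bar> \<le> real k * pi" by linarith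
        then have "\<bar>(\<gamma> + \<xi>) / k\<bar> \<le> pi" using k0 by (simp add: abs_divide divide_le_eq mult.commute)
        then have "\<bar>Arg (w / z)\<bar> = \<bar>(\<gamma> + \<xi>) / k\<bar>"
          unfolding wz using w a0 z by (intro abs_Arg_rcis) auto
        then have ang: "cone_angle k z w = min pi \<bar>\<gamma> + \<xi>\<bar>"
          using k0 by (simp add: cone_angle_def abs_Arg_divide_commute[of z] abs_divide)
        show ?thesis unfolding ang
          by (cases "\<bar>\<gamma> + \<xi>\<bar> \<le> pi") (simp_all add: min_def)
      qed
      have "cos (cone_angle k z x) \<le> cos (\<gamma> + - \<psi>)"
        using bound[OF xa] xy c0 \<psi> by simp
      moreover have "cos (cone_angle k z y) \<le> cos (\<gamma> + (\<beta> - \<psi>))"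
        using bound[OF ya] xy c0 \<psi> by simp
      ultimately have "(1 - t) * (cmod x * cos (cone_angle k z x)) + t * (cmod y * cos (cone_angle k z y))
        \<le> (1 - t) * (cmod x * cos (\<gamma> - \<psi>)) + t * (cmod y * cos (\<gamma> + (\<beta> - \<psi>)))"
        using t by (intro add_mono mult_left_mono) auto
      also have "\<dots> = cmod c * cos \<gamma>" by (rule c_phase[symmetric])
      finally show ?thesis using True by (simp add: na ang_a)
    next
      case False
      then have ang_a': "cone_angle k z a = pi" using ang_a by simp
      \<comment> \<open>Now \<open>z\<close> sees \<open>a\<close> through the apex. By the triangle
        inequality for angles, \<open>w\<close> is at least \<open>pi - |\<xi>|\<close> away from
        \<open>z\<close>, so its projection is bounded by the one onto the ray opposite to
        \<open>a\<close>.\<close>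
      have bound: "cos (cone_angle k z w) \<le> - cos \<xi>"
        if w: "w / a = of_real r * cis (\<xi> / k)" "0 < r" "\<bar>\<xi>\<bar> \<le> pi" for w \<xi> r
      proof -
        have "\<bar>Arg (w / a)\<bar> \<le> \<bar>\<xi> / k\<bar>"
          using abs_Arg_rcis[of r "\<xi> / k"] w k0 k by (simp add: abs_divide divide_le_eq order.trans[OF w(3)])
        then have "real k * \<bar>Arg (a / w)\<bar> \<le> \<bar>\<xi>\<bar>"
          using k0 by (simp add: abs_Arg_divide_commute[of a] abs_divide field_simps)
        then have "cone_angle k w a \<le> \<bar>\<xi>\<bar>" by (simp add: abs_Arg_divide_commute[of w] cone_angle_def)
        moreover have "w \<noteq> 0" using w by auto
        ultimately have "pi - \<bar>\<xi>\<bar> \<le> cone_angle k z w"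
          using cone_angle_triangle[of w k z a] ang_a' by linarith
        then have "cos (cone_angle k z w) \<le> cos (pi - \<bar>\<xi>\<bar>)"
          using w(3) cone_angle_le_pi by (intro cos_monotone_0_pi_le) auto
        also have "\<dots> = - cos \<xi>" by simp
        finally show ?thesis .
      qed
      have "cos (cone_angle k z x) \<le> - cos \<psi>"
        using bound[OF xa] xy c0 \<psi> by simp
      moreover have "cos (cone_angle k z y) \<le> - cos (\<beta> - \<psi>)"
        using bound[OF ya] xy c0 \<psi> by simp
      ultimately have "(1 - t) * (cmod x * cos (cone_angle k z x)) + t * (cmod y * cos (cone_angle k z y))
        \<le> (1 - t) * (cmod x * - cos \<psi>) + t * (cmod y * - cos (\<beta> - \<psi>))"
        using t by (intro add_mono mult_left_mono) auto
      also have "\<dots> = - cmod c" using c_phase[of 0] by (simp add: algebra_simps)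
      finally show ?thesis using ang_a' na by simp
    qed
  qed
qed

text \<open>The geodesic from \<open>x\<close> to \<open>y\<close> runs through the apex and has
  length \<open>cmod x + cmod y\<close>; the bound on \<open>t\<close> puts the division point on
  the ray of \<open>x\<close>. If \<open>y\<close> is not the apex, the angles from any
  \<open>z\<close> to \<open>x\<close> and to \<open>y\<close> add up to at least \<open>pi\<close>,
  so their cosines have a nonpositive sum.\<close>

lemma cone_Stewart_through_apex:
  assumes k: "0 < k" and x: "x \<noteq> 0" and y: "y = 0 \<or> cone_angle k x y = pi"
    and t: "0 \<le> t" "t * (cmod x + cmod y) \<le> cmod x"
  shows "\<exists>a. \<forall>z. (cone_dist k z a)\<^sup>2 \<le> (1 - t) * (cone_dist k z x)\<^sup>2 + t * (cone_dist k z y)\<^sup>2 - t * (1 - t) * (cone_dist k x y)\<^sup>2"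
proof -
  define l where "l = 1 - t * (cmod x + cmod y) / cmod x"
  define a where "a = of_real l * x"
  have l0: "0 \<le> l" using t x by (simp add: l_def)
  have na: "cmod a = cmod x - t * (cmod x + cmod y)"
  proof -
    have "cmod a = l * cmod x" using l0 by (simp add: a_def norm_mult)
    also have "\<dots> = cmod x - t * (cmod x + cmod y)" using x by (simp add: l_def left_diff_distrib)
    finally show ?thesis .
  qed
  have L: "(cone_dist k x y)\<^sup>2 = (cmod x + cmod y)\<^sup>2"
    unfolding cone_dist_sq power2_sum using y by auto
  have Stewart0: "(cmod a)\<^sup>2 = (1 - t) * (cmod x)\<^sup>2 + t * (cmod y)\<^sup>2 - t * (1 - t) * (cone_dist k x y)\<^sup>2"
    unfolding L na by (simp add: power2_eq_square algebra_simps)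
  show ?thesis
  proof (intro exI[of _ a] allI cone_Stewart_if_projection[OF Stewart0])
    fix z :: complex assume z: "z \<noteq> 0"
    have ca: "cmod a * cos (cone_angle k z a) = cmod a * cos (cone_angle k z x)"
    proof (cases "l = 0")
      case False
      then have "l > 0" using l0 by simp
      then have "Arg (z / a) = Arg (z / x)"
        using Arg_divide_of_real[of l "z / x"] by (simp add: a_def mult.commute)
      then show ?thesis by (simp add: cone_angle_def)
    qed (simp add: a_def)
    have "cmod y * (cos (cone_angle k z x) + cos (cone_angle k z y)) \<le> 0"
    proof (cases "y = 0")
      case False
      then have "pi \<le> cone_angle k z x + cone_angle k z y"
        using y cone_angle_triangle[OF z, of k x y] by (simp add: cone_angle_commute[of k x])
      then have "cos (cone_angle k z y) \<le> cos (pi - cone_angle k z x)"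
        using cone_angle_le_pi by (intro cos_monotone_0_pi_le) auto
      then show ?thesis by (simp add: mult_nonneg_nonpos)
    qed auto
    then have "t * (cmod y * (cos (cone_angle k z x) + cos (cone_angle k z y))) \<le> 0"
      using t by (simp add: mult_nonneg_nonpos)
    then show "(1 - t) * (cmod x * cos (cone_angle k z x)) + t * (cmod y * cos (cone_angle k z y))
       \<le> cmod a * cos (cone_angle k z a)"
      unfolding ca unfolding na by (simp add: algebra_simps)
  qed
qed

lemma cone_Stewart:
  assumes k: "0 < k" and t: "0 \<le> t" "t \<le> 1"
  shows "\<exists>a. \<forall>z. (cone_dist k z a)\<^sup>2 \<le> (1 - t) * (cone_dist k z x)\<^sup>2 + t * (cone_dist k z y)\<^sup>2 - t * (1 - t) * (cone_dist k x y)\<^sup>2"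
proof -
  consider "k = 1" | "x = 0" "y = 0" | "2 \<le> k" "x \<noteq> 0" "y \<noteq> 0" "real k * \<bar>Arg (x / y)\<bar> < pi"
    | "x \<noteq> 0" "y = 0 \<or> cone_angle k x y = pi" "t * (cmod x + cmod y) \<le> cmod x"
    | "y \<noteq> 0" "x = 0 \<or> cone_angle k y x = pi" "(1 - t) * (cmod y + cmod x) \<le> cmod y"
  proof (cases "k = 1 \<or> x = 0 \<and> y = 0 \<or> 2 \<le> k \<and> x \<noteq> 0 \<and> y \<noteq> 0 \<and> real k * \<bar>Arg (x / y)\<bar> < pi")
    case False
    then have *: "x \<noteq> 0 \<or> y \<noteq> 0" "x = 0 \<or> y = 0 \<or> cone_angle k x y = pi"
      using k by (auto simp: cone_angle_def)
    show ?thesis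
    proof (cases "x = 0")
      case True
      then have "(1 - t) * (cmod y + cmod x) \<le> cmod y" using t mult_right_mono[of "1 - t" 1 "cmod y"] by simp
      then show ?thesis using that(5) * True by auto
    next
      case x: False
      show ?thesis
      proof (cases "y = 0")
        case True
        then have "t * (cmod x + cmod y) \<le> cmod x" using t mult_right_mono[of t 1 "cmod x"] by simp
        then show ?thesis using that(4) * True x by auto
      next
        case False
        \<comment> \<open>The division point lies on the ray of \<open>x\<close> or on that of
          \<open>y\<close>; the second case becomes the first after exchanging \<open>x\<close> with
          \<open>y\<close> and \<open>t\<close> with \<open>1 - t\<close>.\<close>
        have "t * (cmod x + cmod y) \<le> cmod x \<or> (1 - t) * (cmod y + cmod x) \<le> cmod y"
          by (simp add: algebra_simps) linarith
        then show ?thesis using that(4,5) * False x by (auto simp: cone_angle_commute[of k x])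
      qed
    qed
  qed (use that in blast)
  then show ?thesis
  proof cases
    case 1
    show ?thesis unfolding 1 cone_dist_1
      by (intro exI[of _ "(1 - t) *\<^sub>R x + t *\<^sub>R y"]) (simp add: Euclidean_Stewart)
  next
    case 2
    then show ?thesis by (intro exI[of _ 0]) (simp add: algebra_simps)
  next
    case 3
    then show ?thesis using cone_Stewart_sector t by blast
  next
    case 4
    then show ?thesis using cone_Stewart_through_apex k t by blast
  next
    case 5
    then show ?thesis using cone_Stewart_through_apex[OF k 5(1,2), of "1 - t"] t
      by (simp add: cone_dist_commute[of k y x] algebra_simps)
  qed
qed

lemma Stewart_space_cone:
  assumes k: "0 < k"
  shows "Stewart_space (ball 0 r) (cone_dist k)"
  unfolding Stewart_space_def
proof (intro ballI)
  fix x y :: complex and t :: real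
  assume xy: "x \<in> ball 0 r" "y \<in> ball 0 r" and t: "t \<in> {0..1}"
  obtain a where a: "\<And>z. (cone_dist k z a)\<^sup>2 \<le> (1 - t) * (cone_dist k z x)\<^sup>2 + t * (cone_dist k z y)\<^sup>2 - t * (1 - t) * (cone_dist k x y)\<^sup>2"
    using cone_Stewart[OF k] t by (metis atLeastAtMost_iff)
  \<comment> \<open>Taking the apex for \<open>z\<close> shows that the division point is no farther
    from the apex than the farther end point, so it stays in the ball.\<close>
  define m where "m = max (cmod x) (cmod y)"
  have "(cmod a)\<^sup>2 \<le> (1 - t) * (cmod x)\<^sup>2 + t * (cmod y)\<^sup>2 - t * (1 - t) * (cone_dist k x y)\<^sup>2"
    using a[of 0] by simp
  also have "\<dots> \<le> (1 - t) * m\<^sup>2 + t * m\<^sup>2 - 0"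
    using t by (intro diff_mono add_mono mult_left_mono power_mono) (auto simp: m_def)
  finally have "(cmod a)\<^sup>2 \<le> m\<^sup>2" by (simp add: algebra_simps)
  then have "cmod a \<le> m" by (rule power2_le_imp_le) (simp add: m_def le_max_iff_disj)
  then have "a \<in> ball 0 r" using xy by (auto simp: m_def)
  with a show "\<exists>a\<in>ball 0 r. \<forall>z\<in>ball 0 r.
     (cone_dist k z a)\<^sup>2 \<le> (1 - t) * (cone_dist k z x)\<^sup>2 + t * (cone_dist k z y)\<^sup>2 - t * (1 - t) * (cone_dist k x y)\<^sup>2"
    by blast
qed

lemma cone_proj_of_real_mult_sgn:
  assumes "0 < k" "0 \<le> r" "cmod u = 1 \<or> u = 0"
  shows "cone_proj k (of_real r * u) = of_real r * u ^ k"
proof (cases "r = 0 \<or> u = 0")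
  case False
  then have "sgn u = u" using assms by (simp add: sgn_eq)
  then show ?thesis using False assms by (simp add: cone_proj_def norm_mult sgn_mult sgn_of_real)
qed (use assms in \<open>auto simp: cone_proj_def\<close>)

lemma cone_proj_0 [simp]: "cone_proj k 0 = 0"
  by (simp add: cone_proj_def)

lemma cone_dist_self [simp]: "cone_dist k x x = 0"
  by (cases "x = 0") (simp_all add: cone_dist_def cone_angle_def)

text \<open>The speed is measured after \<open>cone_proj\<close>, because this is how the distance
  of the target sees a curve in the chart. The path is a geodesic of the cone: through the apex if
  the angle is \<open>pi\<close>, otherwise the lift of a straight segment in the unfolded
  sector.\<close>

lemma cone_short_path:
  assumes k: "0 < k"
  shows "\<exists>\<gamma>. path \<gamma> \<and> \<gamma> 0 = x \<and> \<gamma> 1 = y \<and> (\<forall>t\<in>{0..1}. cmod (\<gamma> t) \<le> max (cmod x) (cmod y)) \<and>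
    (\<forall>s\<in>{0..1}. \<forall>t\<in>{0..1}. cmod (cone_proj k (\<gamma> s) - cone_proj k (\<gamma> t)) \<le> cone_dist k x y * \<bar>s - t\<bar>)"
proof (cases "x = 0 \<or> y = 0 \<or> cone_angle k x y = pi")
  case True
  define L where "L = cmod x + cmod y"
  have L: "cone_dist k x y = L"
  proof -
    have "(cone_dist k x y)\<^sup>2 = L\<^sup>2"
      unfolding cone_dist_sq L_def power2_sum using True by auto
    then show ?thesis by (simp add: L_def power2_eq_iff_nonneg)
  qed
  \<comment> \<open>At constant speed \<open>L\<close> the curve descends the ray of
    \<open>x\<close>, reaches the apex when \<open>t * L = cmod x\<close>, and climbs the ray of
    \<open>y\<close>; at every time at least one summand vanishes.\<close>
  define \<gamma> where "\<gamma> t = of_real (max 0 (cmod x - t * L)) * sgn x + of_real (max 0 (t * L - cmod x)) * sgn y" for t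
  have u: "cmod (sgn z) = 1 \<or> sgn z = 0" for z :: complex by (simp add: norm_sgn sgn_zero_iff)
  have proj: "cone_proj k (\<gamma> t) = of_real (max 0 (cmod x - t * L)) * sgn x ^ k + of_real (max 0 (t * L - cmod x)) * sgn y ^ k" for t
  proof (cases "t * L \<le> cmod x")
    case True
    then show ?thesis using cone_proj_of_real_mult_sgn[OF k _ u, of "cmod x - t * L" x] by (simp add: \<gamma>_def max_def)
  next
    case False
    then show ?thesis using cone_proj_of_real_mult_sgn[OF k _ u, of "t * L - cmod x" y] by (simp add: \<gamma>_def max_def)
  qed
  have "path \<gamma>" unfolding path_def \<gamma>_def by (intro continuous_intros)
  moreover have "of_real (cmod z) * sgn z = z" for z :: complex by (simp add: sgn_eq)
  then have "\<gamma> 0 = x" "\<gamma> 1 = y" by (simp_all add: \<gamma>_def L_def)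
  moreover have "cmod (\<gamma> t) \<le> max (cmod x) (cmod y)" if t: "t \<in> {0..1}" for t
  proof -
    have tL: "0 \<le> t * L" "t * L \<le> L" using t mult_right_mono[of t 1 L] by (auto simp: L_def)
    have le: "cmod (of_real r * sgn z) \<le> \<bar>r\<bar>" for r and z :: complex by (simp add: norm_mult norm_sgn)
    have "cmod (\<gamma> t) \<le> \<bar>max 0 (cmod x - t * L)\<bar> + \<bar>max 0 (t * L - cmod x)\<bar>"
      unfolding \<gamma>_def by (intro order.trans[OF norm_triangle_ineq] add_mono le)
    also have "\<dots> \<le> max (cmod x) (cmod y)" using tL by (auto simp: max_def L_def)
    finally show ?thesis .
  qed
  moreover have "cmod (cone_proj k (\<gamma> s) - cone_proj k (\<gamma> t)) \<le> cone_dist k x y * \<bar>s - t\<bar>" for s t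
  proof -
    have n: "cmod (sgn z ^ k) \<le> 1" for z :: complex using k by (simp add: norm_power norm_sgn power_0_left)
    have "cone_proj k (\<gamma> s) - cone_proj k (\<gamma> t)
      = of_real (max 0 (cmod x - s * L) - max 0 (cmod x - t * L)) * sgn x ^ k
      + of_real (max 0 (s * L - cmod x) - max 0 (t * L - cmod x)) * sgn y ^ k"
      by (simp add: proj algebra_simps)
    also have "cmod \<dots> \<le> \<bar>max 0 (cmod x - s * L) - max 0 (cmod x - t * L)\<bar> * 1
      + \<bar>max 0 (s * L - cmod x) - max 0 (t * L - cmod x)\<bar> * 1"
      by (rule order.trans[OF norm_triangle_ineq])
        (use n in \<open>auto simp only: norm_mult norm_of_real intro!: add_mono mult_left_mono\<close>)
    also have "\<dots> = \<bar>s * L - t * L\<bar>" by (auto simp: max_def)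
    also have "\<dots> = L * \<bar>s - t\<bar>" by (simp add: L_def abs_mult left_diff_distrib[symmetric])
    finally show ?thesis by (simp add: L)
  qed
  ultimately show ?thesis by blast
next
  case False
  define \<beta> where "\<beta> = real k * Arg (y / x)"
  define c where "c t = of_real ((1 - t) * cmod x) + of_real (t * cmod y) * cis \<beta>" for t
  \<comment> \<open>The segment \<open>c\<close> avoids the cut of \<open>Arg\<close>, so dividing
    its principal argument by \<open>k\<close> is a continuous lift to the cone.\<close>
  define \<gamma> where "\<gamma> t = of_real (cmod (c t)) * (sgn x * cis (Arg (c t) / k))" for t
  have xy: "x \<noteq> 0" "y \<noteq> 0" and b: "\<bar>\<beta>\<bar> < pi" and ang: "cone_angle k x y = \<bar>\<beta>\<bar>"
    using False by (auto simp: cone_angle_def \<beta>_def abs_mult abs_Arg_divide_commute[of x] min_def split: if_splits)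
  have c: "c t \<notin> \<real>\<^sub>\<le>\<^sub>0" if "t \<in> {0..1}" for t
    unfolding c_def using xy b that by (intro segment_not_nonpos_Reals) auto
  have cc: "continuous_on A c" for A unfolding c_def by (intro continuous_intros)
  have "path \<gamma>" unfolding path_def \<gamma>_def
    using c k cc by (intro continuous_intros) auto
  moreover have "\<gamma> 0 = x"
    using xy by (simp add: \<gamma>_def c_def sgn_eq)
  moreover have "\<gamma> 1 = y"
  proof -
    have "\<beta> \<in> {-pi<..pi}" using b by auto
    then have "Arg (c 1) = \<beta>" using Arg_rcis[of \<beta> "cmod y"] xy b by (simp add: c_def rcis_def)
    moreover have "y / x \<noteq> 0" "\<beta> / k = Arg (y / x)" using xy k by (simp_all add: \<beta>_def)
    then have "sgn x * cis (\<beta> / k) = sgn (x * (y / x))"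
      by (simp only: sgn_mult sgn_complex_cis_Arg[of "y / x"] simp_thms)
    ultimately show ?thesis using xy by (simp add: \<gamma>_def c_def norm_mult sgn_eq)
  qed
  moreover have nx: "cmod (sgn x) = 1" using xy by (simp add: norm_sgn)
  moreover have "cmod (\<gamma> t) \<le> max (cmod x) (cmod y)" if t: "t \<in> {0..1}" for t
  proof -
    have "cmod (\<gamma> t) = cmod (c t)" by (simp add: \<gamma>_def norm_mult nx)
    also have "\<dots> \<le> cmod (of_real ((1 - t) * cmod x)) + cmod (of_real (t * cmod y) * cis \<beta>)"
      unfolding c_def by (rule norm_triangle_ineq)
    also have "\<dots> = (1 - t) * cmod x + t * cmod y"
      unfolding norm_mult[of _ "cis \<beta>"] norm_of_real norm_cis using t by (simp add: abs_mult)
    also have "\<dots> \<le> (1 - t) * max (cmod x) (cmod y) + t * max (cmod x) (cmod y)"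
      using t by (intro add_mono mult_left_mono) auto
    finally show ?thesis by (simp add: algebra_simps)
  qed
  moreover have "cmod (cone_proj k (\<gamma> s) - cone_proj k (\<gamma> t)) \<le> cone_dist k x y * \<bar>s - t\<bar>" for s t
  proof -
    have "cone_proj k (\<gamma> t) = sgn x ^ k * c t" for t
    proof -
      have "cone_proj k (\<gamma> t) = of_real (cmod (c t)) * (sgn x * cis (Arg (c t) / k)) ^ k"
        unfolding \<gamma>_def by (intro cone_proj_of_real_mult_sgn k) (auto simp: norm_mult nx)
      also have "\<dots> = sgn x ^ k * (of_real (cmod (c t)) * cis (Arg (c t)))"
        using k by (simp add: power_mult_distrib Complex.DeMoivre mult_ac)
      also have "of_real (cmod (c t)) * cis (Arg (c t)) = c t"
        using rcis_cmod_Arg[of "c t"] by (simp add: rcis_def)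
      finally show ?thesis .
    qed
    then have "cmod (cone_proj k (\<gamma> s) - cone_proj k (\<gamma> t)) = cmod (c s - c t)"
      by (simp add: right_diff_distrib[symmetric] norm_mult norm_power nx)
    also have "c s - c t = of_real (t - s) * (of_real (cmod x) - of_real (cmod y) * cis \<beta>)"
      by (simp add: c_def algebra_simps)
    also have "cmod \<dots> = \<bar>s - t\<bar> * cmod (of_real (cmod x) - of_real (cmod y) * cis \<beta>)"
      by (simp only: norm_mult norm_of_real abs_minus_commute[of t])
    also have "cmod (of_real (cmod x) - of_real (cmod y) * cis \<beta>) = cone_dist k x y"
    proof -
      have "(cmod (of_real (cmod x) - of_real (cmod y) * cis \<beta>))\<^sup>2 = (cone_dist k x y)\<^sup>2"
        using cmod_cis_diff_sq[of "cmod x" 0 "cmod y" \<beta>] by (simp add: cone_dist_sq ang)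
      then show ?thesis by (simp add: power2_eq_iff_nonneg)
    qed
    finally show ?thesis by (simp add: mult.commute)
  qed
  ultimately show ?thesis by blast
qed

lemma curve_length_cong:
  assumes "\<And>s t. 0 \<le> s \<Longrightarrow> s \<le> 1 \<Longrightarrow> 0 \<le> t \<Longrightarrow> t \<le> 1 \<Longrightarrow> d (g s) (g t) = d' (g' s) (g' t)"
  shows "curve_length d g = curve_length d' g'"
  unfolding curve_length_def
proof (rule SUP_cong[OF refl], clarify)
  fix n :: nat and t :: "nat \<Rightarrow> real" assume t: "t \<in> {..n} \<rightarrow> {0..1}"
  have "d (g (t i)) (g (t (Suc i))) = d' (g' (t i)) (g' (t (Suc i)))" if "i < n" for i
    using t that by (intro assms) (auto simp: Pi_iff)
  then show "ennreal (\<Sum>i<n. d (g (t i)) (g (t (Suc i)))) = ennreal (\<Sum>i<n. d' (g' (t i)) (g' (t (Suc i))))"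
    by simp
qed

text \<open>A path through the apex is at least as long as the sum of the radii of its ends.
  Otherwise its distance from the apex is bounded below, so by uniform continuity the steps of a
  fine partition have angle at most \<open>pi\<close>; there \<open>cone_proj\<close> preserves
  distances, and the triangle inequality sums the steps.\<close>

lemma cone_length_ge:
  assumes k: "0 < k" and g: "path g"
  shows "ennreal (cone_dist k (g 0) (g 1)) \<le> curve_length (\<lambda>u v. cmod (cone_proj k u - cone_proj k v)) g"
proof (cases "\<exists>s\<in>{0..1}. g s = 0")
  case True
  then obtain s where s: "0 \<le> s" "s \<le> 1" "g s = 0" by auto
  have "cone_dist k (g 0) (g 1) \<le> cmod (cone_proj k (g 0) - cone_proj k (g s)) + cmod (cone_proj k (g s) - cone_proj k (g 1))"
    using s cone_dist_le[of k "g 0" "g 1"] by (simp add: norm_cone_proj[OF k] cone_proj_def[of k 0])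
  then show ?thesis
    using curve_length_ge_chords[of 0 s 1 "\<lambda>u v. cmod (cone_proj k u - cone_proj k v)" g] s
    by (meson ennreal_leI order.trans order_refl)
next
  case False
  have gc: "continuous_on {0..1} g" using g by (simp add: path_def)
  have comp: "compact {0..1::real}" by simp
  obtain \<eta> where \<eta>: "\<eta> > 0" "\<And>z. dist z 1 < \<eta> \<Longrightarrow> dist (Arg z) (Arg 1) < pi / k"
    using continuous_at_Arg[of 1] k unfolding continuous_at_eps_delta
    by (metis divide_pos_pos of_nat_0_less_iff pi_gt_zero complex_nonpos_Reals_iff one_complex.sel(1) not_one_le_zero)
  obtain m where m: "m \<in> {0..1}" "\<And>s. s \<in> {0..1} \<Longrightarrow> cmod (g m) \<le> cmod (g s)"
    using continuous_attains_inf[OF comp _ continuous_on_norm[OF gc]] by auto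
  have gm: "cmod (g m) > 0" using False m(1) by auto
  obtain \<delta> where \<delta>: "\<delta> > 0" "\<And>s t. s \<in> {0..1} \<Longrightarrow> t \<in> {0..1} \<Longrightarrow> dist t s < \<delta> \<Longrightarrow> dist (g t) (g s) < \<eta> * cmod (g m)"
    using compact_uniformly_continuous[OF gc comp] \<eta>(1) gm unfolding uniformly_continuous_on_def
    by (metis mult_pos_pos)
  have close: "cone_dist k (g s) (g t) = cmod (cone_proj k (g s) - cone_proj k (g t))"
    if st: "s \<in> {0..1}" "t \<in> {0..1}" "dist t s < \<delta>" for s t
  proof (rule cone_dist_eq_proj[OF k])
    have t0: "g t \<noteq> 0" using False st by auto
    have "dist (g s / g t) 1 = dist (g t) (g s) / cmod (g t)"
      using t0 by (simp add: dist_norm norm_divide[symmetric] diff_divide_distrib norm_minus_commute)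
    also have "\<dots> < \<eta> * cmod (g m) / cmod (g t)"
      using \<delta>(2)[OF st] t0 by (simp add: divide_strict_right_mono)
    also have "\<dots> \<le> \<eta>" using m(2)[OF st(2)] \<eta>(1) t0 by (simp add: divide_le_eq)
    finally have "\<bar>Arg (g s / g t)\<bar> < pi / k" using \<eta>(2) by (simp add: dist_real_def)
    then show "real k * \<bar>Arg (g s / g t)\<bar> \<le> pi" using k by (simp add: field_simps)
  qed
  obtain n :: nat where n: "n > 0" "1 / n < \<delta>" using \<delta>(1) nat_approx_posE[of \<delta>]
    by (metis zero_less_Suc)
  have "cone_dist k (g (real 0 / n)) (g (real j / n)) \<le> (\<Sum>i<j. cmod (cone_proj k (g (real i / n)) - cone_proj k (g (real (Suc i) / n))))"
    if "j \<le> n" for j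
    using that
  proof (induction j)
    case (Suc j)
    have "cone_dist k (g (real j / n)) (g (real (Suc j) / n)) = cmod (cone_proj k (g (real j / n)) - cone_proj k (g (real (Suc j) / n)))"
      using Suc.prems n by (intro close) (auto simp: dist_real_def diff_divide_distrib[symmetric])
    then show ?case using Suc cone_dist_triangle[of k "g (real 0 / n)" "g (real (Suc j) / n)" "g (real j / n)"] by simp
  qed simp
  from this[of n] have "ennreal (cone_dist k (g 0) (g 1))
    \<le> ennreal (\<Sum>i<n. cmod (cone_proj k (g (real i / n)) - cone_proj k (g (real (Suc i) / n))))"
    using n by (intro ennreal_leI) simp
  also have "\<dots> \<le> curve_length (\<lambda>u v. cmod (cone_proj k u - cone_proj k v)) g"
    using n by (intro curve_length_ge_sum[of "\<lambda>i. real i / n"]) (auto simp: mono_on_def divide_right_mono)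
  finally show ?thesis .
qed

subsection \<open>Charts at interior points\<close>

text \<open>In the coordinate \<open>log (poly p z)\<close> the map \<open>i_A\<close> is \<open>w \<mapsto> (tanh (Re w), Im w)\<close>, so that it
  turns every small circle around a point into a curve which winds once around the image of that point.\<close>

definition strip_map :: "real \<Rightarrow> complex \<Rightarrow> complex" where
  "strip_map \<alpha> w = Complex (tanh (\<alpha> + Re w) - tanh \<alpha>) (Im w)"

lemma strip_map_0 [simp]: "strip_map \<alpha> 0 = 0"
  by (simp add: strip_map_def complex_eq_iff)

lemma inj_strip_map: "inj (strip_map \<alpha>)"
proof (rule injI)
  fix v w assume e: "strip_map \<alpha> v = strip_map \<alpha> w"
  then have "tanh (\<alpha> + Re v) = tanh (\<alpha> + Re w)" "Im v = Im w" by (simp_all add: strip_map_def)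
  then show "v = w" by (simp add: complex_eq_iff)
qed

lemma continuous_strip_map: "continuous_on A (strip_map \<alpha>)"
proof -
  have "strip_map \<alpha> = (\<lambda>w. of_real (tanh (\<alpha> + Re w) - tanh \<alpha>) + \<i> * of_real (Im w))"
    by (auto simp: strip_map_def complex_eq_iff)
  moreover have "continuous_on A (\<lambda>w. of_real (tanh (\<alpha> + Re w) - tanh \<alpha>) + \<i> * of_real (Im w))"
    by (intro continuous_intros) (simp add: cosh_real_pos less_imp_neq[OF cosh_real_pos, symmetric])
  ultimately show ?thesis by simp
qed

text \<open>The coordinates of \<open>strip_map \<alpha> w\<close> have the signs of those of
  \<open>w\<close>, so as vectors the two have a positive inner product and form an angle below
  \<open>pi / 2\<close>.\<close>

lemma strip_map_quotient_Re_pos: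
  assumes "w \<noteq> 0" shows "0 < Re (strip_map \<alpha> w / w)"
proof -
  have "0 < (tanh (\<alpha> + Re w) - tanh \<alpha>) * Re w" if "Re w \<noteq> 0"
  proof (cases "Re w > 0")
    case True then show ?thesis by simp
  next
    case False then have "Re w < 0" using that by simp
    then show ?thesis by (intro mult_neg_neg) auto
  qed
  then have "0 < (tanh (\<alpha> + Re w) - tanh \<alpha>) * Re w + (Im w)\<^sup>2"
    using assms by (cases "Re w = 0") (auto simp: complex_eq_iff intro: add_pos_nonneg)
  moreover have "0 < (Re w)\<^sup>2 + (Im w)\<^sup>2" using assms by (simp add: complex_neq_0)
  ultimately have "0 < ((tanh (\<alpha> + Re w) - tanh \<alpha>) * Re w + (Im w)\<^sup>2) / ((Re w)\<^sup>2 + (Im w)\<^sup>2)"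
    by (rule divide_pos_pos)
  then show ?thesis by (simp only: strip_map_def Re_divide complex.sel power2_eq_square[of "Im w"])
qed

text \<open>The continuous \<open>k\<close>-th root of \<open>strip_map \<alpha> (h ^ k)\<close> in polar coordinates of the cone; the
  quotient by \<open>h ^ k\<close> avoids the negative real axis, so its principal root is continuous.\<close>

definition cone_root :: "nat \<Rightarrow> real \<Rightarrow> complex \<Rightarrow> complex" where
  "cone_root k \<alpha> h = of_real (cmod (strip_map \<alpha> (h ^ k))) *
     (sgn h * cis (Arg (strip_map \<alpha> (h ^ k) / h ^ k) / k))"

lemma cone_root_0 [simp]: "0 < k \<Longrightarrow> cone_root k \<alpha> 0 = 0"
  by (simp add: cone_root_def)

lemma cone_proj_cone_root:
  assumes k: "0 < k" shows "cone_proj k (cone_root k \<alpha> h) = strip_map \<alpha> (h ^ k)"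
proof (cases "h = 0")
  case False
  define G where "G = strip_map \<alpha> (h ^ k)"
  have hk: "h ^ k \<noteq> 0" using False by simp
  have "cone_proj k (cone_root k \<alpha> h) = of_real (cmod G) * (sgn h * cis (Arg (G / h ^ k) / k)) ^ k"
    unfolding cone_root_def G_def using False by (intro cone_proj_of_real_mult_sgn k) (auto simp: norm_mult norm_sgn)
  also have "\<dots> = of_real (cmod G) * (sgn h ^ k * cis (Arg (G / h ^ k)))"
    using k by (simp add: power_mult_distrib Complex.DeMoivre)
  also have "sgn h ^ k = sgn (h ^ k)"
    by (induction k) (simp_all add: sgn_mult)
  also have "cis (Arg (G / h ^ k)) = sgn (G / h ^ k)"
    by (rule sgn_complex_cis_Arg[symmetric]) (use strip_map_quotient_Re_pos[OF hk, of \<alpha>] in \<open>metis G_def less_irrefl zero_complex.sel(1)\<close>)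
  also have "sgn (h ^ k) * sgn (G / h ^ k) = sgn G"
    unfolding sgn_mult[symmetric] using hk by simp
  also have "of_real (cmod G) * sgn G = G" by (simp add: sgn_eq)
  finally show ?thesis by (simp add: G_def)
qed (use k in \<open>simp add: zero_power\<close>)

text \<open>Equality of the projections gives only \<open>x ^ k = y ^ k\<close>. The correcting
  factor in \<open>cone_root\<close> depends on this power alone, so cancelling it also yields
  \<open>sgn x = sgn y\<close>.\<close>

lemma inj_cone_root:
  assumes k: "0 < k" shows "inj (cone_root k \<alpha>)"
proof (rule injI)
  fix x y assume e: "cone_root k \<alpha> x = cone_root k \<alpha> y"
  then have "strip_map \<alpha> (x ^ k) = strip_map \<alpha> (y ^ k)" by (metis cone_proj_cone_root[OF k])
  then have xy: "x ^ k = y ^ k" by (rule injD[OF inj_strip_map])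
  show "x = y"
  proof (cases "x = 0 \<or> y = 0")
    case True
    then show ?thesis using xy k by (auto simp: power_0_left)
  next
    case False
    then have "strip_map \<alpha> (x ^ k) \<noteq> 0" using strip_map_quotient_Re_pos[of "x ^ k" \<alpha>] by auto
    then have "sgn x = sgn y" using e xy unfolding cone_root_def by simp
    moreover have "cmod x = cmod y" using arg_cong[OF xy, of cmod] k by (simp add: norm_power power_eq_iff_eq_base)
    ultimately have "of_real (cmod x) * sgn x = of_real (cmod y) * sgn y" by simp
    then show ?thesis using False by (simp only: sgn_eq) simp
  qed
qed

lemma continuous_cone_root:
  assumes k: "0 < k" shows "continuous_on A (cone_root k \<alpha>)"
proof -
  have S: "isCont (\<lambda>h. strip_map \<alpha> (h ^ k)) h" for h
  proof -
    have "isCont (strip_map \<alpha>) (h ^ k)"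
      using continuous_strip_map[of UNIV \<alpha>] by (simp add: continuous_on_eq_continuous_at)
    moreover have "isCont (\<lambda>h. h ^ k) h" by (intro continuous_intros)
    ultimately show ?thesis by (rule isCont_o2[rotated])
  qed
  have "isCont (cone_root k \<alpha>) h" for h
  proof (cases "h = 0")
    case True
    have lim: "((\<lambda>h. cmod (strip_map \<alpha> (h ^ k))) \<longlongrightarrow> 0) (at 0)"
      using tendsto_norm[OF S[of 0, unfolded isCont_def]] k by (simp add: zero_power)
    have le: "norm (cone_root k \<alpha> h) \<le> cmod (strip_map \<alpha> (h ^ k))" for h
      by (simp add: cone_root_def norm_mult norm_sgn)
    have "(cone_root k \<alpha> \<longlongrightarrow> 0) (at 0)"
      by (rule Lim_null_comparison[OF always_eventually[OF allI[OF le]] lim])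
    then show ?thesis using True k by (simp add: isCont_def)
  next
    case False
    then have "0 < Re (strip_map \<alpha> (h ^ k) / h ^ k)" by (intro strip_map_quotient_Re_pos) simp
    then have "strip_map \<alpha> (h ^ k) / h ^ k \<notin> \<real>\<^sub>\<le>\<^sub>0" by (simp only: complex_nonpos_Reals_iff) linarith
    moreover have "isCont (\<lambda>h. strip_map \<alpha> (h ^ k) / h ^ k) h"
      using False S[of h] by (intro continuous_divide continuous_power continuous_ident) auto
    ultimately have "isCont (\<lambda>h. Arg (strip_map \<alpha> (h ^ k) / h ^ k)) h"
      by (intro isCont_o2[OF _ continuous_at_Arg])
    then have "isCont (\<lambda>h. Arg (strip_map \<alpha> (h ^ k) / h ^ k) / k) h"
      using k by (intro continuous_divide continuous_const) auto
    moreover have "isCont (\<lambda>w. exp (\<i> * of_real w)) w" for w :: real by (intro continuous_intros)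
    then have "isCont cis w" for w by (simp add: cis_conv_exp[abs_def])
    ultimately have "isCont (\<lambda>h. cis (Arg (strip_map \<alpha> (h ^ k) / h ^ k) / k)) h"
      by (rule isCont_o2)
    moreover have "isCont sgn h" using False by (intro isCont_sgn) auto
    ultimately show ?thesis unfolding cone_root_def[abs_def]
      by (intro continuous_mult continuous_of_real continuous_norm S)
  qed
  then show ?thesis by (simp add: continuous_at_imp_continuous_on)
qed

text \<open>\<open>k\<close> is the order of vanishing at \<open>b\<close> of \<open>L\<close>, the
  logarithm of \<open>p\<close> divided by its value at \<open>b\<close>. A holomorphic function
  with a zero of order \<open>k\<close> is locally the \<open>k\<close>-th power of a coordinate,
  here \<open>h\<close>.\<close>

lemma poly_log_power:
  fixes p :: "complex poly"
  assumes p: "degree p \<ge> 1" and b: "poly p b \<noteq> 0"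
  obtains k r h where "0 < k" "0 < r" "h holomorphic_on ball b r" "inj_on h (ball b r)" "h b = 0"
    "\<And>z. z \<in> ball b r \<Longrightarrow> poly p z = poly p b * exp (h z ^ k)"
    "\<And>z. z \<in> ball b r \<Longrightarrow> \<bar>Im (h z ^ k)\<bar> < pi / 2"
    "poly (pderiv p) b \<noteq> 0 \<Longrightarrow> k = 1"
proof -
  define q where "q z = poly p z / poly p b" for z
  have qb: "q b = 1" using b by (simp add: q_def)
  have "isCont q b" unfolding q_def by (intro continuous_intros) (use b in auto)
  \<comment> \<open>The radius keeps \<open>q\<close> in the right half-plane: there
    \<open>Ln\<close> is holomorphic with imaginary part below \<open>pi / 2\<close> in absolute
    value, so two angles differ by less than \<open>pi\<close>.\<close>
  then obtain e where e: "e > 0" "\<And>z. dist z b < e \<Longrightarrow> dist (q z) 1 < 1"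
    unfolding continuous_at_eps_delta using qb zero_less_one by metis
  have Req: "Re (q z) > 0" if "z \<in> ball b e" for z
    using e(2)[of z] that abs_Re_le_cmod[of "q z - 1"] by (auto simp: dist_norm norm_minus_commute)
  define L where "L z = Ln (q z)" for z
  have qhol: "q holomorphic_on ball b e" unfolding q_def by (intro holomorphic_intros) (use b in auto)
  have Lhol: "L holomorphic_on ball b e" unfolding L_def
    by (rule holomorphic_on_Ln'[OF _ qhol]) (use Req in \<open>force simp: complex_nonpos_Reals_iff\<close>)
  have Lb: "L b = 0" by (simp add: L_def qb)
  have expL: "poly p z = poly p b * exp (L z)" if "z \<in> ball b e" for z
  proof -
    have "q z \<noteq> 0" using Req[OF that] by auto
    then have "exp (L z) = q z" by (simp add: L_def)
    then show ?thesis using b by (simp add: q_def)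
  qed
  have ImL: "\<bar>Im (L z)\<bar> < pi / 2" if "z \<in> ball b e" for z
    using Req[OF that] Re_Ln_pos_lt[of "q z"] by (force simp: L_def)
  \<comment> \<open>If all derivatives vanished, \<open>L\<close> and hence \<open>p\<close> would
    be constant near \<open>b\<close>, against \<open>degree p >= 1\<close>.\<close>
  have "\<exists>n>0. (deriv ^^ n) L b \<noteq> 0"
  proof (rule ccontr)
    assume no: "\<not> ?thesis"
    have "L z = L b" if "z \<in> ball b e" for z
    proof (rule holomorphic_fun_eq_const_on_connected[OF Lhol open_ball connected_ball _ _ that])
      show "(deriv ^^ n) L b = 0" if "0 < n" for n using no that by blast
    qed (use e in simp)
    then have "poly (p - [:poly p b:]) z = 0" if "z \<in> ball b e" for z
      using expL that Lb by simp
    then have "ball b e \<subseteq> {z. poly (p - [:poly p b:]) z = 0}" by auto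
    moreover have "degree [:poly p b:] = 0" by simp
    then have "p \<noteq> [:poly p b:]" using p by (metis not_one_le_zero)
    then have "p - [:poly p b:] \<noteq> 0" by simp
    ultimately have "finite (ball b e)" using poly_roots_finite finite_subset by blast
    then show False using finite_imp_not_open[of "ball b e"] e(1) by simp
  qed
  then obtain n0 where n0: "n0 > 0" "(deriv ^^ n0) L b \<noteq> 0" by blast
  define k where "k = (LEAST n. n > 0 \<and> (deriv ^^ n) L b \<noteq> 0)"
  have k: "k > 0" "(deriv ^^ k) L b \<noteq> 0"
    using LeastI[of "\<lambda>n. n > 0 \<and> (deriv ^^ n) L b \<noteq> 0" n0] n0 by (auto simp: k_def)
  have kmin: "(deriv ^^ i) L b = 0" if "0 < i" "i < k" for i
    using not_less_Least[of i "\<lambda>n. n > 0 \<and> (deriv ^^ n) L b \<noteq> 0"] that by (auto simp: k_def)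
  have bb: "b \<in> ball b e" using e by simp
  have "\<exists>g r. 0 < r \<and> g holomorphic_on ball b r \<and>
      (\<forall>w\<in>ball b r. L w - L b = ((w - b) * g w) ^ k) \<and> (\<forall>w\<in>ball b r. g w \<noteq> 0)"
  proof (rule holomorphic_factor_order_of_zero_strong[OF Lhol open_ball bb k kmin])
    fix g r
    assume "0 < r" "g holomorphic_on ball b r" "\<And>w. w \<in> ball b r \<Longrightarrow> L w - L b = ((w - b) * g w) ^ k"
      "\<And>w. w \<in> ball b r \<Longrightarrow> g w \<noteq> 0"
    then show ?thesis by (intro exI[of _ g] exI[of _ r]) simp
  qed
  then obtain g r where g: "0 < r" "g holomorphic_on ball b r"
    "\<And>w. w \<in> ball b r \<Longrightarrow> L w - L b = ((w - b) * g w) ^ k" "\<And>w. w \<in> ball b r \<Longrightarrow> g w \<noteq> 0"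
    by blast
  define h where "h w = (w - b) * g w" for w
  have hhol: "h holomorphic_on ball b r" unfolding h_def using g(2) by (intro holomorphic_intros)
  have "(g has_field_derivative deriv g b) (at b)"
    using g(1,2) holomorphic_derivI by (metis centre_in_ball open_ball)
  then have "(h has_field_derivative g b) (at b)"
    unfolding h_def by (auto intro!: derivative_eq_intros)
  then have "deriv h b \<noteq> 0" using g(1,4) by (simp add: DERIV_imp_deriv)
  then obtain r' where r': "r' > 0" "ball b r' \<subseteq> ball b r" "inj_on h (ball b r')"
    using has_complex_derivative_locally_injective[OF hhol _ open_ball, of b] g(1) by auto
  define \<rho> where "\<rho> = min r' e"
  have sub: "ball b \<rho> \<subseteq> ball b r'" "ball b \<rho> \<subseteq> ball b r" "ball b \<rho> \<subseteq> ball b e" using r'(2) by (auto simp: \<rho>_def)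
  have hL: "h z ^ k = L z" if "z \<in> ball b \<rho>" for z
    using g(3)[of z] sub that Lb by (auto simp: h_def)
  show ?thesis
  proof (rule that[of k \<rho> h])
    show "0 < k" "0 < \<rho>" using k r' e by (auto simp: \<rho>_def)
    show "h holomorphic_on ball b \<rho>" "inj_on h (ball b \<rho>)"
      using hhol r'(3) sub holomorphic_on_subset inj_on_subset by blast+
    show "h b = 0" by (simp add: h_def)
    show "poly p z = poly p b * exp (h z ^ k)" "\<bar>Im (h z ^ k)\<bar> < pi / 2" if "z \<in> ball b \<rho>" for z
      using hL[OF that] expL[of z] ImL[of z] sub that by auto
    show "k = 1" if pd: "poly (pderiv p) b \<noteq> 0"
    proof -
      have "(q has_field_derivative poly (pderiv p) b / poly p b) (at b)"
        unfolding q_def using b by (auto intro!: derivative_eq_intros)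
      then have "(L has_field_derivative poly (pderiv p) b / poly p b) (at b)"
        unfolding L_def using qb by (auto intro!: derivative_eq_intros simp: complex_nonpos_Reals_iff)
      then have "(deriv ^^ 1) L b \<noteq> 0" using pd b by (simp add: DERIV_imp_deriv)
      then show ?thesis using kmin[of 1] k by (cases "k = 1") auto
    qed
  qed
qed

lemma annulus_dist_strip_map:
  assumes "\<bar>Im v - Im w\<bar> \<le> pi"
  shows "annulus_dist (i_A (exp (a + v))) (i_A (exp (a + w))) = cmod (strip_map (Re a) v - strip_map (Re a) w)"
  using annulus_dist_cis[of "Im a + Im v" "Im a + Im w"] assms
  by (simp add: i_A_exp strip_map_def cmod_def add.commute)

text \<open>The coordinate \<open>\<zeta>\<close> is a continuous injection, so invariance of domain
  provides an open image and a continuous inverse. Angles differ by at most \<open>pi\<close> on the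
  chart, so no arc of the circle is shorter than the difference of the angles.\<close>

lemma interior_chart:
  fixes p :: "complex poly"
  assumes p: "degree p \<ge> 1" and b: "b \<notin> rts p"
  obtains k R U \<zeta> \<zeta>' where "0 < k" "0 < R" "open U" "b \<in> U" "U \<subseteq> - rts p"
    "homeomorphism U (ball 0 R) \<zeta> \<zeta>'" "\<zeta> b = 0"
    "\<And>x y. x \<in> U \<Longrightarrow> y \<in> U \<Longrightarrow>
       annulus_dist ((i_A \<circ> poly p) x) ((i_A \<circ> poly p) y) = cmod (cone_proj k (\<zeta> x) - cone_proj k (\<zeta> y))"
    "b \<notin> cpt p \<Longrightarrow> k = 1"
proof -
  have pb: "poly p b \<noteq> 0" using b by (simp add: rts_def)
  obtain k r h where kr: "0 < k" "0 < r" and h: "h holomorphic_on ball b r" "inj_on h (ball b r)" "h b = 0"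
    "\<And>z. z \<in> ball b r \<Longrightarrow> poly p z = poly p b * exp (h z ^ k)"
    "\<And>z. z \<in> ball b r \<Longrightarrow> \<bar>Im (h z ^ k)\<bar> < pi / 2"
    "poly (pderiv p) b \<noteq> 0 \<Longrightarrow> k = 1"
    using poly_log_power[OF p pb] by blast
  define a where "a = Ln (poly p b)"
  define \<zeta> where "\<zeta> = cone_root k (Re a) \<circ> h"
  have cont: "continuous_on (ball b r) \<zeta>" unfolding \<zeta>_def
    by (intro continuous_on_compose holomorphic_on_imp_continuous_on[OF h(1)] continuous_cone_root kr)
  have inj: "inj_on \<zeta> (ball b r)" unfolding \<zeta>_def
    using h(2) inj_cone_root[OF kr(1)] by (intro comp_inj_on) (auto intro: inj_on_subset)
  have op: "open (\<zeta> ` ball b r)" by (rule invariance_of_domain[OF cont open_ball inj])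
  have \<zeta>b: "\<zeta> b = 0" using h(3) kr by (simp add: \<zeta>_def)
  then have "0 \<in> \<zeta> ` ball b r" using kr by (metis centre_in_ball image_eqI)
  then obtain R where R: "R > 0" "ball 0 R \<subseteq> \<zeta> ` ball b r" using op by (auto simp: open_contains_ball)
  obtain \<zeta>' where hom: "homeomorphism (ball b r) (\<zeta> ` ball b r) \<zeta> \<zeta>'"
    using invariance_of_domain_homeomorphism[OF open_ball cont _ inj] by auto
  define U where "U = ball b r \<inter> \<zeta> -` ball 0 R"
  have U: "open U" unfolding U_def by (rule continuous_open_preimage[OF cont]) auto
  have "\<zeta> ` U = ball 0 R" using R by (auto simp: U_def)
  then have homU: "homeomorphism U (ball 0 R) \<zeta> \<zeta>'"
    using homeomorphism_of_subsets[OF hom, of U "{}" "ball 0 R"] by (auto simp: U_def)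
  show ?thesis
  proof (rule that[OF kr(1) R(1) U _ _ homU \<zeta>b])
    show "b \<in> U" using kr R \<zeta>b by (simp add: U_def)
    show "U \<subseteq> - rts p" using h(4) pb by (auto simp: U_def rts_def)
    show "k = 1" if "b \<notin> cpt p" using h(6) that by (simp add: cpt_def)
    fix x y assume xy: "x \<in> U" "y \<in> U"
    have e: "poly p z = exp (a + h z ^ k)" if "z \<in> U" for z
      using h(4)[of z] that pb by (simp add: U_def exp_add a_def exp_Ln)
    have "\<bar>Im (h x ^ k) - Im (h y ^ k)\<bar> \<le> pi"
      using h(5)[of x] h(5)[of y] xy by (auto simp: U_def)
    then show "annulus_dist ((i_A \<circ> poly p) x) ((i_A \<circ> poly p) y) = cmod (cone_proj k (\<zeta> x) - cone_proj k (\<zeta> y))"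
      using annulus_dist_strip_map[of "h x ^ k" "h y ^ k" a] xy
      by (simp add: e \<zeta>_def cone_proj_cone_root[OF kr(1)])
  qed
qed

text \<open>The closed sublevel sets are images of closed discs, hence compact; this makes them
  closed in all of \<open>S\<close> and not only in \<open>U\<close>.\<close>

lemma interior_pullback_chart:
  assumes k: "0 < k" and U: "open U" "U \<subseteq> S" and hom: "homeomorphism U (ball 0 R) \<zeta> \<zeta>'"
    and f: "\<And>x y. x \<in> U \<Longrightarrow> y \<in> U \<Longrightarrow> d (f x) (f y) = cmod (cone_proj k (\<zeta> x) - cone_proj k (\<zeta> y))"
  shows "pullback_chart S f d (U :: complex set) (\<lambda>x. cmod (\<zeta> x)) (\<lambda>x y. cone_dist k (\<zeta> x) (\<zeta> y)) R"
proof
  have \<zeta>: "continuous_on U \<zeta>" "continuous_on (ball 0 R) \<zeta>'" "\<And>x. x \<in> U \<Longrightarrow> \<zeta>' (\<zeta> x) = x"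
    "\<And>w. w \<in> ball 0 R \<Longrightarrow> \<zeta> (\<zeta>' w) = w" "\<And>w. w \<in> ball 0 R \<Longrightarrow> \<zeta>' w \<in> U" "\<And>x. x \<in> U \<Longrightarrow> \<zeta> x \<in> ball 0 R"
    using hom unfolding homeomorphism_def by auto
  fix r assume r: "r < R"
  have "{x \<in> U. cmod (\<zeta> x) \<le> r} = \<zeta>' ` cball 0 r"
  proof (intro equalityI subsetI)
    fix x assume "x \<in> {x \<in> U. cmod (\<zeta> x) \<le> r}"
    then show "x \<in> \<zeta>' ` cball 0 r" using \<zeta>(3)[of x] by (metis (mono_tags, lifting) image_eqI mem_Collect_eq mem_cball_0)
  next
    fix x assume "x \<in> \<zeta>' ` cball 0 r"
    then obtain w where "cmod w \<le> r" "x = \<zeta>' w" by auto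
    then show "x \<in> {x \<in> U. cmod (\<zeta> x) \<le> r}" using \<zeta>(4)[of w] \<zeta>(5)[of w] r by simp
  qed
  moreover have "compact (\<zeta>' ` cball 0 r)"
    using r by (intro compact_continuous_image continuous_on_subset[OF \<zeta>(2)]) auto
  ultimately show "closedin (top_of_set S) {x \<in> U. cmod (\<zeta> x) \<le> r}"
    using U by (auto intro!: closed_subset compact_imp_closed)
  have "open (U \<inter> \<zeta> -` ball 0 r)" by (rule continuous_open_preimage[OF \<zeta>(1) U(1)]) auto
  moreover have "U \<inter> \<zeta> -` ball 0 r = {x \<in> U. cmod (\<zeta> x) < r}" by auto
  ultimately show "openin (top_of_set S) {x \<in> U. cmod (\<zeta> x) < r}"
    using U by (intro open_subset) auto
next
  fix x y assume "x \<in> U" "y \<in> U"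
  then show "\<bar>cmod (\<zeta> x) - cmod (\<zeta> y)\<bar> \<le> d (f x) (f y)"
    using norm_triangle_ineq3[of "cone_proj k (\<zeta> x)" "cone_proj k (\<zeta> y)"] by (simp add: f norm_cone_proj[OF k])
next
  fix g assume g: "path g" "path_image g \<subseteq> U"
  have "path (\<zeta> \<circ> g)" using g hom by (intro path_continuous_image) (auto simp: homeomorphism_def intro: continuous_on_subset)
  then have "ennreal (cone_dist k (\<zeta> (g 0)) (\<zeta> (g 1))) \<le> curve_length (\<lambda>u v. cmod (cone_proj k u - cone_proj k v)) (\<zeta> \<circ> g)"
    using cone_length_ge[OF k, of "\<zeta> \<circ> g"] by simp
  also have "\<dots> = curve_length d (f \<circ> g)"
    using g(2) by (intro curve_length_cong) (auto simp: path_image_def f image_subset_iff)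
  finally show "ennreal (cone_dist k (\<zeta> (pathstart g)) (\<zeta> (pathfinish g))) \<le> curve_length d (f \<circ> g)"
    by (simp add: pathstart_def pathfinish_def)
next
  fix x y assume xy: "x \<in> U" "y \<in> U"
  have \<zeta>: "continuous_on (ball 0 R) \<zeta>'" "\<And>x. x \<in> U \<Longrightarrow> \<zeta>' (\<zeta> x) = x"
    "\<And>w. w \<in> ball 0 R \<Longrightarrow> \<zeta> (\<zeta>' w) = w" "\<And>w. w \<in> ball 0 R \<Longrightarrow> \<zeta>' w \<in> U" "\<And>x. x \<in> U \<Longrightarrow> \<zeta> x \<in> ball 0 R"
    using hom unfolding homeomorphism_def by auto
  obtain \<gamma> where \<gamma>: "path \<gamma>" "\<gamma> 0 = \<zeta> x" "\<gamma> 1 = \<zeta> y" "\<forall>t\<in>{0..1}. cmod (\<gamma> t) \<le> max (cmod (\<zeta> x)) (cmod (\<zeta> y))"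
    "\<forall>s\<in>{0..1}. \<forall>t\<in>{0..1}. cmod (cone_proj k (\<gamma> s) - cone_proj k (\<gamma> t)) \<le> cone_dist k (\<zeta> x) (\<zeta> y) * \<bar>s - t\<bar>"
    using cone_short_path[OF k] by blast
  have in_ball: "\<gamma> t \<in> ball 0 R" if "t \<in> {0..1}" for t
    using \<gamma>(4)[rule_format, OF that] \<zeta>(5)[OF xy(1)] \<zeta>(5)[OF xy(2)] by (auto simp: max_def split: if_splits)
  show "\<exists>g. path g \<and> path_image g \<subseteq> S \<and> pathstart g = x \<and> pathfinish g = y \<and>
     curve_length d (f \<circ> g) \<le> ennreal (cone_dist k (\<zeta> x) (\<zeta> y))"
  proof (intro exI[of _ "\<zeta>' \<circ> \<gamma>"] conjI)
    show "path (\<zeta>' \<circ> \<gamma>)" using \<gamma>(1) in_ball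
      by (intro path_continuous_image continuous_on_subset[OF \<zeta>(1)]) (auto simp: path_image_def)
    show "path_image (\<zeta>' \<circ> \<gamma>) \<subseteq> S" using in_ball \<zeta>(4) U by (auto simp: path_image_def)
    show "pathstart (\<zeta>' \<circ> \<gamma>) = x" "pathfinish (\<zeta>' \<circ> \<gamma>) = y"
      using \<gamma> \<zeta>(2) xy by (simp_all add: pathstart_def pathfinish_def)
    show "curve_length d (f \<circ> (\<zeta>' \<circ> \<gamma>)) \<le> ennreal (cone_dist k (\<zeta> x) (\<zeta> y))"
    proof (rule curve_length_le_Lipschitz)
      fix s t :: real assume st: "0 \<le> s" "s \<le> t" "t \<le> 1"
      have "d ((f \<circ> (\<zeta>' \<circ> \<gamma>)) s) ((f \<circ> (\<zeta>' \<circ> \<gamma>)) t) = cmod (cone_proj k (\<gamma> s) - cone_proj k (\<gamma> t))"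
        using f[of "\<zeta>' (\<gamma> s)" "\<zeta>' (\<gamma> t)"] in_ball[of s] in_ball[of t] st by (simp add: \<zeta>(3,4))
      also have "\<dots> \<le> cone_dist k (\<zeta> x) (\<zeta> y) * \<bar>s - t\<bar>" using \<gamma>(5)[rule_format, of s t] st by simp
      finally show "d ((f \<circ> (\<zeta>' \<circ> \<gamma>)) s) ((f \<circ> (\<zeta>' \<circ> \<gamma>)) t) \<le> cone_dist k (\<zeta> x) (\<zeta> y) * (t - s)"
        using st by simp
    qed simp
  qed
qed (simp_all add: cone_dist_le)

section \<open>The length metric of the punctured plane and its completion\<close>

locale separable_poly =
  fixes p :: "complex poly"
  assumes degree_pos: "degree p \<ge> 1" and card_rts: "card (rts p) = degree p"
begin

abbreviation S :: "complex set" where "S \<equiv> - rts p"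
abbreviation f :: "complex \<Rightarrow> complex \<times> real" where "f \<equiv> i_A \<circ> poly p"
abbreviation dS :: "complex \<Rightarrow> complex \<Rightarrow> real" where "dS \<equiv> open_branched_annulus_dist p"
abbreviation B :: "(nat \<Rightarrow> complex) set set" where "B \<equiv> branched_annulus p"
abbreviation dB :: "(nat \<Rightarrow> complex) set \<Rightarrow> (nat \<Rightarrow> complex) set \<Rightarrow> real" where "dB \<equiv> branched_annulus_dist p"

lemma dS_eq: "dS = pullback_dist S f annulus_dist"
  by (intro ext) (simp add: open_branched_annulus_dist_def)

lemma p_nonzero: "p \<noteq> 0"
  using degree_pos by auto

lemma finite_rts: "finite (rts p)"
  unfolding rts_def using p_nonzero by (rule poly_roots_finite)

lemma connected_S: "connected S"
  using connected_open_delete_finite[of UNIV "rts p"] finite_rts connected_UNIV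
  by (simp add: Compl_eq_Diff_UNIV)

lemma f_image: "f ` S \<subseteq> sphere 0 1 \<times> UNIV"
  using i_A_eq unfolding rts_def by fastforce

definition chart_at :: "complex \<Rightarrow> nat \<Rightarrow> real \<Rightarrow> complex set \<Rightarrow> (complex \<Rightarrow> complex) \<Rightarrow> (complex \<Rightarrow> complex) \<Rightarrow> bool" where
  "chart_at b k R U \<zeta> \<zeta>' \<longleftrightarrow> 0 < k \<and> 0 < R \<and> open U \<and> b \<in> U \<and> U \<subseteq> S \<and> homeomorphism U (ball 0 R) \<zeta> \<zeta>' \<and> \<zeta> b = 0 \<and>
    (b \<notin> cpt p \<longrightarrow> k = 1) \<and>
    pullback_chart S f annulus_dist U (\<lambda>x. cmod (\<zeta> x)) (\<lambda>x y. cone_dist k (\<zeta> x) (\<zeta> y)) R"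

lemma interior_chart_exists:
  assumes b: "b \<in> S"
  shows "\<exists>k R U \<zeta> \<zeta>'. chart_at b k R U \<zeta> \<zeta>'"
proof (rule interior_chart[OF degree_pos])
  show "b \<notin> rts p" using b by simp
  fix k R U \<zeta> \<zeta>'
  assume *: "0 < k" "0 < R" "open U" "b \<in> U" "U \<subseteq> - rts p" "homeomorphism U (ball 0 R) \<zeta> \<zeta>'" "\<zeta> b = 0"
    "\<And>x y. x \<in> U \<Longrightarrow> y \<in> U \<Longrightarrow>
       annulus_dist ((i_A \<circ> poly p) x) ((i_A \<circ> poly p) y) = cmod (cone_proj k (\<zeta> x) - cone_proj k (\<zeta> y))"
    "b \<notin> cpt p \<Longrightarrow> k = 1"
  then have "chart_at b k R U \<zeta> \<zeta>'"
    using interior_pullback_chart[of k U S R \<zeta> \<zeta>' annulus_dist f] by (simp add: chart_at_def)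
  then show ?thesis by blast
qed

text \<open>Being joined by a rectifiable path is an equivalence relation with open classes, since
  every point has a chart, and the plane stays connected when finitely many points are
  removed.\<close>

lemma rect_paths_nonempty:
  assumes "x \<in> S" "y \<in> S"
  shows "rect_paths S f annulus_dist x y \<noteq> {}"
proof (rule connected_equivalence_relation[OF connected_S assms, of "\<lambda>x y. rect_paths S f annulus_dist x y \<noteq> {}"])
  show "rect_paths S f annulus_dist y x \<noteq> {}" if "rect_paths S f annulus_dist x y \<noteq> {}" for x y
    using rect_paths_reverse[of annulus_dist, OF annulus_dist_commute] that by blast
  show "rect_paths S f annulus_dist x z \<noteq> {}"
    if "rect_paths S f annulus_dist x y \<noteq> {}" "rect_paths S f annulus_dist y z \<noteq> {}" for x y z
    using rect_paths_join[OF Metric_space_annulus f_image] that by blast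
  fix b assume b: "b \<in> S"
  obtain k R U \<zeta> \<zeta>' where "chart_at b k R U \<zeta> \<zeta>'" using interior_chart_exists[OF b] by blast
  then have *: "open U" "b \<in> U" "U \<subseteq> S"
    "pullback_chart S f annulus_dist U (\<lambda>x. cmod (\<zeta> x)) (\<lambda>x y. cone_dist k (\<zeta> x) (\<zeta> y)) R"
    by (auto simp: chart_at_def)
  then have "\<forall>x\<in>U. rect_paths S f annulus_dist b x \<noteq> {}"
    using pullback_chart.rect_paths_chart by fastforce
  then show "\<exists>T. openin (top_of_set S) T \<and> b \<in> T \<and> (\<forall>x\<in>T. rect_paths S f annulus_dist b x \<noteq> {})"
    using * by (intro exI[of _ U]) (auto intro: open_subset)
qed

lemma Metric_space_dS: "Metric_space S dS"
proof
  show "0 \<le> dS x y" for x y by (simp add: dS_eq)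
  show "dS x y = dS y x" for x y
    unfolding dS_eq by (rule pullback_dist_commute) (rule annulus_dist_commute)
  show "dS x z \<le> dS x y + dS y z" if "x \<in> S" "y \<in> S" "z \<in> S" for x y z
    unfolding dS_eq using that
    by (intro pullback_dist_triangle[OF Metric_space_annulus f_image] rect_paths_nonempty)
  show "dS x y = 0 \<longleftrightarrow> x = y" if x: "x \<in> S" and y: "y \<in> S" for x y
  proof -
    obtain k R U \<zeta> \<zeta>' where "chart_at x k R U \<zeta> \<zeta>'" using interior_chart_exists[OF x] by blast
    then have *: "0 < k" "0 < R" "x \<in> U" "homeomorphism U (ball 0 R) \<zeta> \<zeta>'" "\<zeta> x = 0"
      "pullback_chart S f annulus_dist U (\<lambda>x. cmod (\<zeta> x)) (\<lambda>x y. cone_dist k (\<zeta> x) (\<zeta> y)) R"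
      by (auto simp: chart_at_def)
    interpret pullback_chart S f annulus_dist U "\<lambda>x. cmod (\<zeta> x)" "\<lambda>x y. cone_dist k (\<zeta> x) (\<zeta> y)" R by fact
    have "dS x x = 0" using pullback_dist_chart[of x x] * by (simp add: dS_eq)
    \<comment> \<open>A point outside the chart, or inside it at radius at least
      \<open>R / 2\<close>, has distance at least \<open>R / 2\<close> from \<open>x\<close>;
      otherwise the distance is the radius of \<open>\<zeta> y\<close>.\<close>
    moreover have "x = y" if "dS x y = 0"
    proof (cases "y \<in> U \<and> cmod (\<zeta> y) < R/2")
      case True
      then have "cone_dist k (\<zeta> x) (\<zeta> y) = 0" using pullback_dist_chart[of x y] * that by (simp add: dS_eq)
      then have "\<zeta> x = \<zeta> y" using *(5) by simp
      then show ?thesis using *(3,4) True by (metis homeomorphism_def)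
    next
      case False
      then show ?thesis
        using pullback_dist_ge_chart[of x "R/2" y] * that rect_paths_nonempty[OF x y] by (simp add: dS_eq)
    qed
    ultimately show ?thesis by auto
  qed
qed

sublocale MS: Metric_space S dS
  by (rule Metric_space_dS)

lemma B_eq: "B = completion_carrier S dS" and dB_eq: "dB = completion_dist S dS"
  and i_B_eq: "i_B p = completion_embed S dS"
  by (simp_all add: branched_annulus_def branched_annulus_dist_def i_B_def fun_eq_iff)

sublocale MB: Metric_space B dB
  unfolding B_eq dB_eq by (rule MS.Metric_space_completion)

lemma i_B_in: "x \<in> S \<Longrightarrow> i_B p x \<in> B"
  unfolding B_eq i_B_eq by (rule MS.completion_embed_in)

lemma dB_i_B: "x \<in> S \<Longrightarrow> y \<in> S \<Longrightarrow> dB (i_B p x) (i_B p y) = dS x y"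
  unfolding dB_eq i_B_eq by (rule MS.completion_dist_embed)

lemma inj_i_B: "inj_on (i_B p) S"
  by (rule inj_onI) (metis MS.zero dB_i_B MB.mdist_zero i_B_in)

lemma i_B_dense:
  assumes "x \<in> B"
  obtains \<sigma> where "\<And>n. \<sigma> n \<in> S" "(\<lambda>n. dB (i_B p (\<sigma> n)) x) \<longlonglongrightarrow> 0"
proof -
  obtain \<sigma> where "MS.MCauchy \<sigma>" "x = MS.cclass \<sigma>"
    using MS.completion_carrier_cases assms unfolding B_eq by blast
  then show ?thesis using that[of \<sigma>] MS.completion_embed_dense[of \<sigma>] MS.MCauchy_in
    unfolding i_B_eq dB_eq by blast
qed

lemma limitin_B: "limitin MB.mtopology g x sequentially" if "\<And>n. g n \<in> B" "x \<in> B" "(\<lambda>n. dB (g n) x) \<longlonglongrightarrow> 0"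
  using that by (simp add: MB.limitin_metric_dist_null)

text \<open>A ball of the completion is determined by the dense set \<open>i_B p ` S\<close> as soon as the smaller closed
  balls of the model are compact.\<close>

lemma mball_eq_model_image:
  assumes x0: "x0 \<in> B"
    and \<Phi>: "\<And>v. v \<in> Q \<Longrightarrow> \<Phi> v \<in> B" "\<And>v. v \<in> Q \<Longrightarrow> dB x0 (\<Phi> v) = N v"
    and cover: "\<And>y. y \<in> S \<Longrightarrow> dB x0 (i_B p y) < r \<Longrightarrow> i_B p y \<in> \<Phi> ` Q"
    and comp: "\<And>s. s < r \<Longrightarrow> compactin MB.mtopology (\<Phi> ` {v \<in> Q. N v \<le> s})"
  shows "MB.mball x0 r = \<Phi> ` {v \<in> Q. N v < r}"
proof (intro equalityI subsetI)
  fix x assume "x \<in> \<Phi> ` {v \<in> Q. N v < r}"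
  then show "x \<in> MB.mball x0 r" using x0 \<Phi> by auto
next
  fix x assume "x \<in> MB.mball x0 r"
  then have x: "x \<in> B" "dB x0 x < r" by auto
  define s where "s = (dB x0 x + r) / 2"
  have s: "dB x0 x < s" "s < r" using x by (auto simp: s_def)
  obtain \<sigma> where \<sigma>: "\<And>n. \<sigma> n \<in> S" "(\<lambda>n. dB (i_B p (\<sigma> n)) x) \<longlonglongrightarrow> 0"
    using i_B_dense[OF x(1)] by blast
  have cl: "closedin MB.mtopology (\<Phi> ` {v \<in> Q. N v \<le> s})"
    using comp[OF s(2)] MB.Hausdorff_space_mtopology by (simp add: compactin_imp_closedin)
  have ev: "eventually (\<lambda>n. i_B p (\<sigma> n) \<in> \<Phi> ` {v \<in> Q. N v \<le> s}) sequentially"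
  proof -
    have "eventually (\<lambda>n. dB (i_B p (\<sigma> n)) x < s - dB x0 x) sequentially"
      using \<sigma>(2) s by (intro order_tendstoD(2)) auto
    then show ?thesis
    proof (rule eventually_mono)
      fix n assume n: "dB (i_B p (\<sigma> n)) x < s - dB x0 x"
      have "dB x0 (i_B p (\<sigma> n)) \<le> dB x0 x + dB (i_B p (\<sigma> n)) x"
        using MB.triangle'[OF x0 x(1) i_B_in[OF \<sigma>(1)]] .
      then have le: "dB x0 (i_B p (\<sigma> n)) < s" using n by linarith
      then obtain v where "v \<in> Q" "i_B p (\<sigma> n) = \<Phi> v" using cover[OF \<sigma>(1)[of n]] s by auto
      then show "i_B p (\<sigma> n) \<in> \<Phi> ` {v \<in> Q. N v \<le> s}" using \<Phi>(2)[of v] le by auto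
    qed
  qed
  have "limitin MB.mtopology (\<lambda>n. i_B p (\<sigma> n)) x sequentially"
    using \<sigma> x by (intro limitin_B i_B_in)
  from limitin_closedin[OF this cl ev] have "x \<in> \<Phi> ` {v \<in> Q. N v \<le> s}" by simp
  then show "x \<in> \<Phi> ` {v \<in> Q. N v < r}" using \<Phi>(2) x by auto
qed

lemma continuous_i_B: "continuous_map (top_of_set S) MB.mtopology (i_B p)"
  unfolding MB.continuous_map_to_metric
proof (intro ballI allI impI)
  fix b and e :: real assume "b \<in> topspace (top_of_set S)" and e: "e > 0"
  then have b: "b \<in> S" by simp
  obtain k R U \<zeta> \<zeta>' where "chart_at b k R U \<zeta> \<zeta>'" using interior_chart_exists[OF b] by blast
  then have *: "0 < k" "0 < R" "open U" "b \<in> U" "U \<subseteq> S" "homeomorphism U (ball 0 R) \<zeta> \<zeta>'" "\<zeta> b = 0"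
      "pullback_chart S f annulus_dist U (\<lambda>x. cmod (\<zeta> x)) (\<lambda>x y. cone_dist k (\<zeta> x) (\<zeta> y)) R"
      by (auto simp: chart_at_def)
  interpret pullback_chart S f annulus_dist U "\<lambda>x. cmod (\<zeta> x)" "\<lambda>x y. cone_dist k (\<zeta> x) (\<zeta> y)" R by fact
  have "open (U \<inter> \<zeta> -` ball 0 e)"
    using *(6) by (intro continuous_open_preimage[OF _ *(3)]) (auto simp: homeomorphism_def)
  moreover have "i_B p y \<in> MB.mball (i_B p b) e" if y: "y \<in> U \<inter> \<zeta> -` ball 0 e" for y
    using pullback_dist_le_chart[of b y] y * b by (auto simp: i_B_in dB_i_B dS_eq)
  ultimately show "\<exists>U. openin (top_of_set S) U \<and> b \<in> U \<and> (\<forall>y\<in>U. i_B p y \<in> MB.mball (i_B p b) e)"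
    using * e by (intro exI[of _ "U \<inter> \<zeta> -` ball 0 e"]) (auto intro: open_subset)
qed

lemma interior_ball_model:
  assumes b: "b \<in> S"
  obtains k r \<Phi> where "0 < k" "0 < r" "b \<notin> cpt p \<Longrightarrow> k = 1" "MB.mball (i_B p b) r = \<Phi> ` ball 0 r"
    "\<And>u v. u \<in> ball 0 r \<Longrightarrow> v \<in> ball 0 r \<Longrightarrow> dB (\<Phi> u) (\<Phi> v) = cone_dist k u v"
proof -
  obtain k R U \<zeta> \<zeta>' where "chart_at b k R U \<zeta> \<zeta>'" using interior_chart_exists[OF b] by blast
  then have *: "0 < k" "0 < R" "open U" "b \<in> U" "U \<subseteq> S" "homeomorphism U (ball 0 R) \<zeta> \<zeta>'" "\<zeta> b = 0"
      "b \<notin> cpt p \<Longrightarrow> k = 1"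
      "pullback_chart S f annulus_dist U (\<lambda>x. cmod (\<zeta> x)) (\<lambda>x y. cone_dist k (\<zeta> x) (\<zeta> y)) R"
      by (auto simp: chart_at_def)
  interpret pullback_chart S f annulus_dist U "\<lambda>x. cmod (\<zeta> x)" "\<lambda>x y. cone_dist k (\<zeta> x) (\<zeta> y)" R by fact
  have \<zeta>: "continuous_on (ball 0 R) \<zeta>'" "\<And>x. x \<in> U \<Longrightarrow> \<zeta>' (\<zeta> x) = x"
    "\<And>w. w \<in> ball 0 R \<Longrightarrow> \<zeta> (\<zeta>' w) = w" "\<And>w. w \<in> ball 0 R \<Longrightarrow> \<zeta>' w \<in> U"
    using *(6) unfolding homeomorphism_def by auto
  \<comment> \<open>With half the chart radius, any two points of the ball satisfy
    \<open>N x + N y < R\<close>, so the chart computes their distance.\<close>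
  define r where "r = R / 2"
  have r: "0 < r" "r < R" "r + r = R" using *(2) by (auto simp: r_def)
  define \<Phi> where "\<Phi> = i_B p \<circ> \<zeta>'"
  have in_U: "\<zeta>' u \<in> U" "\<zeta> (\<zeta>' u) = u" "\<zeta>' u \<in> S" if "u \<in> ball 0 r" for u
    using \<zeta>(3,4)[of u] that r(2) *(5) by auto
  have iso: "dB (\<Phi> u) (\<Phi> v) = cone_dist k u v" if "u \<in> ball 0 r" "v \<in> ball 0 r" for u v
    using pullback_dist_chart[of "\<zeta>' u" "\<zeta>' v"] that in_U[OF that(1)] in_U[OF that(2)] r
    by (simp add: \<Phi>_def dB_i_B dS_eq)
  have \<Phi>0: "\<Phi> 0 = i_B p b" using \<zeta>(2)[of b] * by (simp add: \<Phi>_def)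
  have "MB.mball (i_B p b) r = \<Phi> ` {v \<in> ball 0 r. cmod v < r}"
  proof (rule mball_eq_model_image)
    show "i_B p b \<in> B" by (rule i_B_in[OF b])
    show "\<Phi> v \<in> B" if "v \<in> ball 0 r" for v using in_U[OF that] by (simp add: \<Phi>_def i_B_in)
    show "dB (i_B p b) (\<Phi> v) = cmod v" if "v \<in> ball 0 r" for v
      using iso[of 0 v] that r by (simp add: \<Phi>0)
    show "i_B p y \<in> \<Phi> ` ball 0 r" if y: "y \<in> S" "dB (i_B p b) (i_B p y) < r" for y
    proof -
      have "y \<in> U \<and> cmod (\<zeta> y) < r"
        using pullback_dist_ge_chart[of b r y] y b * r rect_paths_nonempty[OF b y(1)]
        by (force simp: dB_i_B dS_eq)
      then show ?thesis using \<zeta>(2)[of y] by (intro image_eqI[of _ _ "\<zeta> y"]) (auto simp: \<Phi>_def)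
    qed
    show "compactin MB.mtopology (\<Phi> ` {v \<in> ball 0 r. cmod v \<le> s})" if "s < r" for s
    proof -
      have "{v \<in> ball 0 r. cmod v \<le> s} = cball 0 s" using that by auto
      moreover have "compactin (top_of_set S) (\<zeta>' ` cball 0 s)"
        using that r in_U by (auto simp: compactin_subtopology intro!: compact_continuous_image continuous_on_subset[OF \<zeta>(1)])
      ultimately show ?thesis using image_compactin[OF _ continuous_i_B, of "\<zeta>' ` cball 0 s"]
        by (simp add: \<Phi>_def image_image)
    qed
  qed
  moreover have "{v \<in> ball 0 r. cmod v < r} = ball (0::complex) r" by auto
  ultimately show ?thesis using that[of k r \<Phi>] * r iso by simp
qed

end

subsection \<open>The sphere and the ends of the punctured plane\<close>

text \<open>Inverse stereographic projection; the pole with third coordinate 1 stands for infinity,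
  and the third coordinate of \<open>stereo z\<close> is the height of \<open>i_A z\<close>.\<close>

definition stereo :: "complex \<Rightarrow> real^3" where
  "stereo z = (\<chi> i. if i = 1 then 2 * Re z / ((cmod z)\<^sup>2 + 1) else
      if i = 2 then 2 * Im z / ((cmod z)\<^sup>2 + 1) else ((cmod z)\<^sup>2 - 1) / ((cmod z)\<^sup>2 + 1))"

definition stereo_inv :: "real^3 \<Rightarrow> complex" where
  "stereo_inv v = Complex (v $ 1 / (1 - v $ 3)) (v $ 2 / (1 - v $ 3))"

text \<open>The rotation of the sphere which corresponds to \<open>z \<mapsto> 1 / z\<close>.\<close>

definition flip3 :: "real^3 \<Rightarrow> real^3" where
  "flip3 v = (\<chi> i. if i = 1 then v $ 1 else if i = 2 then - v $ 2 else - v $ 3)"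

lemma three_neq [simp]: "(2::3) \<noteq> 1" "(1::3) \<noteq> 2" "(3::3) \<noteq> 1" "(1::3) \<noteq> 3" "(3::3) \<noteq> 2" "(2::3) \<noteq> 3"
  by auto

lemma stereo_nth [simp]:
  "stereo z $ 1 = 2 * Re z / ((cmod z)\<^sup>2 + 1)" "stereo z $ 2 = 2 * Im z / ((cmod z)\<^sup>2 + 1)"
  "stereo z $ 3 = ((cmod z)\<^sup>2 - 1) / ((cmod z)\<^sup>2 + 1)"
  by (simp_all add: stereo_def)

lemma flip3_nth [simp]: "flip3 v $ 1 = v $ 1" "flip3 v $ 2 = - v $ 2" "flip3 v $ 3 = - v $ 3"
  by (simp_all add: flip3_def)

lemma vec3_eq_iff: "(v :: real^3) = w \<longleftrightarrow> v $ 1 = w $ 1 \<and> v $ 2 = w $ 2 \<and> v $ 3 = w $ 3"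
  by (simp add: vec_eq_iff forall_3)

lemma in_sphere3_iff: "(v :: real^3) \<in> sphere 0 1 \<longleftrightarrow> (v $ 1)\<^sup>2 + (v $ 2)\<^sup>2 + (v $ 3)\<^sup>2 = 1"
  by (simp add: norm_eq_1 inner_vec_def sum_3 power2_eq_square)

lemma flip3_flip3 [simp]: "flip3 (flip3 v) = v"
  by (simp add: vec3_eq_iff)

lemma flip3_in_sphere [simp]: "flip3 v \<in> sphere 0 1 \<longleftrightarrow> v \<in> sphere 0 1"
  unfolding in_sphere3_iff by simp

lemma stereo_denom_pos: "0 < (cmod z)\<^sup>2 + 1"
  by (simp add: add_nonneg_pos)

lemma stereo_in_sphere: "stereo z \<in> sphere 0 1"
proof -
  have "(2 * Re z)\<^sup>2 + (2 * Im z)\<^sup>2 + ((cmod z)\<^sup>2 - 1)\<^sup>2 = ((cmod z)\<^sup>2 + 1)\<^sup>2"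
    unfolding cmod_power2 by (simp add: power2_eq_square algebra_simps)
  then have "(2 * Re z / ((cmod z)\<^sup>2 + 1))\<^sup>2 + (2 * Im z / ((cmod z)\<^sup>2 + 1))\<^sup>2 + (((cmod z)\<^sup>2 - 1) / ((cmod z)\<^sup>2 + 1))\<^sup>2
    = ((cmod z)\<^sup>2 + 1)\<^sup>2 / ((cmod z)\<^sup>2 + 1)\<^sup>2"
    by (simp only: power_divide add_divide_distrib[symmetric])
  also have "\<dots> = 1" using stereo_denom_pos[of z] by simp
  finally show ?thesis unfolding in_sphere3_iff stereo_nth .
qed

lemma one_minus_stereo_3: "1 - stereo z $ 3 = 2 / ((cmod z)\<^sup>2 + 1)"
  using stereo_denom_pos[of z] by (simp add: field_simps)

lemma stereo_inv_stereo [simp]: "stereo_inv (stereo z) = z"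
  unfolding stereo_inv_def one_minus_stereo_3 using stereo_denom_pos[of z] by (simp add: complex_eq_iff)

lemma inj_stereo: "inj stereo"
  by (rule inj_on_inverseI[of _ stereo_inv]) simp

lemma stereo_3_neq_1: "stereo z $ 3 \<noteq> 1"
  using one_minus_stereo_3[of z] stereo_denom_pos[of z] by auto

lemma stereo_stereo_inv:
  assumes "v \<in> sphere 0 1" "v $ 3 \<noteq> 1" shows "stereo (stereo_inv v) = v"
proof -
  define t where "t = 1 - v $ 3"
  have t: "t \<noteq> 0" "v $ 3 = 1 - t" using assms(2) by (simp_all add: t_def)
  have "(v $ 1)\<^sup>2 + (v $ 2)\<^sup>2 = 1 - (1 - t)\<^sup>2" using assms(1) unfolding in_sphere3_iff t(2) by linarith
  also have "\<dots> = 2 * t - t\<^sup>2" by (simp add: power2_eq_square algebra_simps)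
  finally have s: "(v $ 1)\<^sup>2 + (v $ 2)\<^sup>2 = 2 * t - t\<^sup>2" .
  have n: "(cmod (stereo_inv v))\<^sup>2 = (2 * t - t\<^sup>2) / t\<^sup>2"
    unfolding s[symmetric] by (simp add: stereo_inv_def cmod_power2 power_divide t_def add_divide_distrib)
  then have n1: "(cmod (stereo_inv v))\<^sup>2 + 1 = 2 / t" "(cmod (stereo_inv v))\<^sup>2 - 1 = 2 * (1 - t) / t"
    unfolding n using t(1) by (simp_all add: field_simps power2_eq_square)
  have "stereo_inv v = Complex (v $ 1 / t) (v $ 2 / t)" by (simp add: stereo_inv_def t_def)
  then show ?thesis unfolding vec3_eq_iff stereo_nth n1 using t by simp
qed

lemma continuous_stereo: "continuous_on A stereo"
  unfolding stereo_def[abs_def]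
proof (rule continuous_on_vec_lambda)
  have D: "(cmod z)\<^sup>2 + 1 \<noteq> 0" for z using stereo_denom_pos[of z] by simp
  fix i :: 3
  show "continuous_on A (\<lambda>z. if i = 1 then 2 * Re z / ((cmod z)\<^sup>2 + 1) else
      if i = 2 then 2 * Im z / ((cmod z)\<^sup>2 + 1) else ((cmod z)\<^sup>2 - 1) / ((cmod z)\<^sup>2 + 1))"
    using D by (cases "i = 1"; cases "i = 2"; simp; intro continuous_intros; simp)
qed

lemma continuous_flip3: "continuous_on A flip3"
  unfolding flip3_def[abs_def]
proof (rule continuous_on_vec_lambda)
  fix i :: 3
  show "continuous_on A (\<lambda>v :: real^3. if i = 1 then v $ 1 else if i = 2 then - v $ 2 else - v $ 3)"
    by (cases "i = 1"; cases "i = 2"; simp; intro continuous_intros)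
qed

lemma continuous_stereo_inv: "continuous_on {v. v $ 3 \<noteq> 1} stereo_inv"
  unfolding stereo_inv_def[abs_def] Complex_eq by (intro continuous_intros) auto

lemma openin_stereo_image:
  assumes "open V" shows "openin (top_of_set (sphere 0 1)) (stereo ` V)"
proof -
  have o: "open {v :: real^3. v $ 3 \<noteq> 1}"
    by (intro open_Collect_neq continuous_intros)
  have "open ({v. v $ 3 \<noteq> 1} \<inter> stereo_inv -` V)"
    by (rule continuous_open_preimage[OF continuous_stereo_inv o assms])
  moreover have "stereo ` V = sphere 0 1 \<inter> ({v. v $ 3 \<noteq> 1} \<inter> stereo_inv -` V)"
  proof (intro equalityI subsetI)
    fix v :: "real^3" assume v: "v \<in> sphere 0 1 \<inter> ({v. v $ 3 \<noteq> 1} \<inter> stereo_inv -` V)"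
    then have "v = stereo (stereo_inv v)" using stereo_stereo_inv[of v] by auto
    then show "v \<in> stereo ` V" by (rule image_eqI) (use v in auto)
  qed (use stereo_in_sphere stereo_3_neq_1 in auto)
  ultimately show ?thesis by (metis openin_open)
qed

lemma openin_flip3_image:
  assumes "openin (top_of_set (sphere 0 1)) V" shows "openin (top_of_set (sphere 0 1)) (flip3 ` V)"
proof -
  obtain T where T: "open T" "V = sphere 0 1 \<inter> T" using assms by (auto simp: openin_open)
  have "open (flip3 -` T)" by (rule open_vimage[OF T(1) continuous_flip3])
  moreover have "flip3 ` V = sphere 0 1 \<inter> flip3 -` T"
  proof (intro equalityI subsetI)
    fix v assume v: "v \<in> sphere 0 1 \<inter> flip3 -` T"
    then have "flip3 v \<in> V" using flip3_in_sphere[of v] unfolding T(2) by blast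
    then show "v \<in> flip3 ` V" by (intro image_eqI[of _ _ "flip3 v"]) auto
  next
    fix v assume "v \<in> flip3 ` V"
    then obtain w where w: "w \<in> sphere 0 1" "w \<in> T" "v = flip3 w" unfolding T(2) by blast
    then show "v \<in> sphere 0 1 \<inter> flip3 -` T" using flip3_in_sphere[of w] by (metis IntI flip3_flip3 vimageI)
  qed
  ultimately show ?thesis by (metis openin_open)
qed

lemma stereo_inverse:
  assumes "u \<noteq> 0" shows "stereo (inverse u) = flip3 (stereo u)"
proof -
  have u: "(cmod u)\<^sup>2 > 0" using assms by simp
  have e: "Re (inverse u) = Re u / (cmod u)\<^sup>2" "Im (inverse u) = - Im u / (cmod u)\<^sup>2" "(cmod (inverse u))\<^sup>2 = 1 / (cmod u)\<^sup>2"
    by (simp_all add: cmod_power2[of u] norm_inverse power_inverse) (simp add: cmod_power2 inverse_eq_divide)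
  have *: "2 * (x / N) / (1 / N + 1) = 2 * x / (N + 1)" "(1 / N - 1) / (1 / N + 1) = - ((N - 1) / (N + 1))"
    if "N > 0" for x N :: real
    using that by (simp_all add: divide_simps)
  show ?thesis unfolding vec3_eq_iff stereo_nth flip3_nth e using *[OF u] by simp
qed

lemma local_inverse_at_zero:
  assumes \<psi>: "\<psi> holomorphic_on V" "open V" "a \<in> V" "\<psi> a = 0" "deriv \<psi> a \<noteq> 0"
  obtains e g where "0 < e" "continuous_on (ball 0 e) g" "inj_on g (ball 0 e)" "g 0 = a" "g ` ball 0 e \<subseteq> V"
    "\<And>w. w \<in> ball 0 e \<Longrightarrow> \<psi> (g w) = w" "\<And>W. open W \<Longrightarrow> W \<subseteq> ball 0 e \<Longrightarrow> open (g ` W)"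
proof -
  have "\<exists>r>0. ball a r \<subseteq> V \<and> open (\<psi> ` ball a r) \<and> inj_on \<psi> (ball a r)"
  proof (rule has_complex_derivative_locally_invertible[OF \<psi>(1,3,2,5)])
    fix r assume "0 < r" "ball a r \<subseteq> V" "open (\<psi> ` ball a r)" "inj_on \<psi> (ball a r)"
    then show ?thesis by (intro exI[of _ r]) simp
  qed
  then obtain r where r: "r > 0" "ball a r \<subseteq> V" "open (\<psi> ` ball a r)" "inj_on \<psi> (ball a r)"
    by blast
  have cont: "continuous_on (ball a r) \<psi>"
    using \<psi>(1) r(2) holomorphic_on_imp_continuous_on holomorphic_on_subset by blast
  obtain g where hom: "homeomorphism (ball a r) (\<psi> ` ball a r) \<psi> g"
    using invariance_of_domain_homeomorphism[OF open_ball cont _ r(4)] by auto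
  have "0 \<in> \<psi> ` ball a r" using r(1) \<psi>(4) by (metis centre_in_ball image_eqI)
  then obtain e where e: "e > 0" "ball 0 e \<subseteq> \<psi> ` ball a r" using r(3) by (auto simp: open_contains_ball)
  have g: "g w \<in> ball a r" "\<psi> (g w) = w" if "w \<in> ball 0 e" for w
    using hom that e(2) unfolding homeomorphism_def by auto
  have g': "g (\<psi> z) = z" if "z \<in> ball a r" for z using hom that by (auto simp: homeomorphism_def)
  show ?thesis
  proof (rule that[of e g])
    show "0 < e" by fact
    show "continuous_on (ball 0 e) g" by (rule continuous_on_subset[OF homeomorphism_cont2[OF hom] e(2)])
    show "inj_on g (ball 0 e)" using g by (metis inj_onI)
    show "g 0 = a" using g'[of a] r(1) \<psi>(4) by simp
    show "g ` ball 0 e \<subseteq> V" using g r(2) by auto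
    show "\<psi> (g w) = w" if "w \<in> ball 0 e" for w using g that by simp
    show "open (g ` W)" if W: "open W" "W \<subseteq> ball 0 e" for W
    proof -
      have "g ` W = ball a r \<inter> \<psi> -` W"
      proof (intro equalityI subsetI)
        fix z assume "z \<in> g ` W"
        then obtain w where "w \<in> W" "z = g w" by auto
        then show "z \<in> ball a r \<inter> \<psi> -` W" using g[of w] W by auto
      next
        fix z assume "z \<in> ball a r \<inter> \<psi> -` W"
        then show "z \<in> g ` W" using g'[of z] by (metis IntD1 IntD2 image_eqI vimageD)
      qed
      then show ?thesis using continuous_open_preimage[OF cont open_ball W(1)] by simp
    qed
  qed
qed

section \<open>The roots and infinity as ends of the punctured plane\<close>

context separable_poly
begin

text \<open>\<open>H\<close> parametrises a disc of the sphere around the missing point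
  \<open>H 0\<close>, and \<open>h\<close> is the same map seen in the plane, constrained only away
  from the centre. The coordinate turns \<open>p\<close> into a pure power, with
  \<open>n = 1\<close> at a root and \<open>n = - degree p\<close> at infinity, so that all ends are
  treated alike.\<close>

definition is_end :: "(complex \<Rightarrow> real^3) \<Rightarrow> (complex \<Rightarrow> complex) \<Rightarrow> int \<Rightarrow> real \<Rightarrow> bool" where
  "is_end H h n R \<longleftrightarrow> n \<noteq> 0 \<and> 0 < R \<and> continuous_on (ball 0 R) H \<and> inj_on H (ball 0 R) \<and>
     (\<forall>W. open W \<longrightarrow> W \<subseteq> ball 0 R \<longrightarrow> openin (top_of_set (sphere 0 1)) (H ` W)) \<and>
     (\<forall>w\<in>ball 0 R - {0}. h w \<in> S \<and> H w = stereo (h w) \<and> poly p (h w) = w powi n)"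

lemma is_end_mono:
  assumes "is_end H h n R" "0 < R'" "R' \<le> R" shows "is_end H h n R'"
proof -
  have "ball (0::complex) R' \<subseteq> ball 0 R" using assms(3) by (rule subset_ball)
  then show ?thesis using assms(1,2) unfolding is_end_def
    by (auto intro: continuous_on_subset inj_on_subset)
qed

text \<open>A double root would leave at most \<open>degree p - 1\<close> distinct roots,
  contradicting \<open>card_rts\<close>.\<close>

lemma simple_root:
  assumes "poly p a = 0" shows "poly (pderiv p) a \<noteq> 0"
proof
  assume d: "poly (pderiv p) a = 0"
  obtain q where q: "p = [:-a, 1:] * q" using assms by (metis dvdE poly_eq_0_iff_dvd)
  have "pderiv p = q + [:-a, 1:] * pderiv q" unfolding q pderiv_mult by (simp add: pderiv_pCons)
  then have "poly q a = 0" using d by simp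
  then obtain r where r: "q = [:-a, 1:] * r" by (metis dvdE poly_eq_0_iff_dvd)
  have q0: "q \<noteq> 0" using p_nonzero q by auto
  then have r0: "r \<noteq> 0" using r by auto
  have "degree q = 1 + degree r" unfolding r using r0 by (subst degree_mult_eq) auto
  moreover have "degree p = 1 + degree q" unfolding q using q0 by (subst degree_mult_eq) auto
  ultimately have deg: "degree p = 2 + degree r" by simp
  have "rts p \<subseteq> insert a {z. poly r z = 0}" unfolding rts_def q r by auto
  then have "card (rts p) \<le> card (insert a {z. poly r z = 0})"
    using poly_roots_finite[OF r0] by (intro card_mono) auto
  also have "\<dots> \<le> 1 + card {z. poly r z = 0}" by (metis card_insert_le_m1 add.commute card_insert_if poly_roots_finite[OF r0] le_add1 order_refl plus_1_eq_Suc le_SucI)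
  also have "\<dots> \<le> 1 + degree r" using card_poly_roots_bound[OF r0] by simp
  finally show False using card_rts deg by simp
qed

lemma root_end:
  assumes a: "a \<in> rts p"
  shows "\<exists>H h n R. is_end H h n R \<and> H 0 = stereo a"
proof -
  have pa: "poly p a = 0" using a by (simp add: rts_def)
  have d: "deriv (poly p) a \<noteq> 0" using simple_root[OF pa] by (simp add: DERIV_imp_deriv[OF poly_DERIV])
  have hol: "poly p holomorphic_on UNIV"
    by (auto simp: holomorphic_on_def field_differentiable_def intro: poly_DERIV)
  obtain e g where g: "0 < e" "continuous_on (ball 0 e) g" "inj_on g (ball 0 e)" "g 0 = a"
    "\<And>w. w \<in> ball 0 e \<Longrightarrow> poly p (g w) = w" "\<And>W. open W \<Longrightarrow> W \<subseteq> ball 0 e \<Longrightarrow> open (g ` W)"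
    using local_inverse_at_zero[OF hol open_UNIV UNIV_I pa d] by auto
  have "is_end (stereo \<circ> g) g 1 e"
    unfolding is_end_def
  proof (intro conjI ballI allI impI)
    show "continuous_on (ball 0 e) (stereo \<circ> g)" by (intro continuous_on_compose g continuous_stereo)
    show "inj_on (stereo \<circ> g) (ball 0 e)" by (intro comp_inj_on g inj_on_subset[OF inj_stereo]) auto
    show "openin (top_of_set (sphere 0 1)) ((stereo \<circ> g) ` W)" if "open W" "W \<subseteq> ball 0 e" for W
      using openin_stereo_image[OF g(6)[OF that]] by (simp add: image_comp)
    show "g w \<in> S" if "w \<in> ball 0 e - {0}" for w using g(5)[of w] that by (auto simp: rts_def)
  qed (use g in auto)
  then show ?thesis using g(4) by (intro exI[of _ "stereo \<circ> g"]) auto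
qed

text \<open>With \<open>u = 1 / z\<close>, \<open>p\<close> equals \<open>u\<close> to the power
  \<open>- d\<close> times the reflected polynomial, whose value at 0 is the leading coefficient. A
  holomorphic \<open>d\<close>-th root \<open>T\<close> of this factor makes \<open>u / T u\<close>
  a local coordinate of which \<open>p\<close> is the power with exponent
  \<open>- d\<close>.\<close>

lemma infinity_end: "\<exists>H h n R. is_end H h n R \<and> H 0 = flip3 (stereo 0)"
proof -
  define d where "d = degree p"
  define c where "c = lead_coeff p"
  define Q where "Q u = poly (reflect_poly p) u / c" for u
  have d: "d > 0" and c: "c \<noteq> 0" using degree_pos p_nonzero by (auto simp: d_def c_def)
  have Q0: "Q 0 = 1" using c by (simp add: Q_def c_def)
  have "isCont Q 0" unfolding Q_def by (intro continuous_intros) (use c in auto)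
  then obtain r where r: "r > 0" "\<And>u. dist u 0 < r \<Longrightarrow> dist (Q u) 1 < 1"
    unfolding continuous_at_eps_delta using Q0 zero_less_one by metis
  have ReQ: "Re (Q u) > 0" if "u \<in> ball 0 r" for u
    using r(2)[of u] that abs_Re_le_cmod[of "Q u - 1"] by (auto simp: dist_norm)
  \<comment> \<open>Dividing by \<open>c\<close> puts \<open>Q\<close> near 1, where
    \<open>Ln\<close> is holomorphic; \<open>c\<close> itself contributes a constant root.\<close>
  define T where "T u = exp (Ln c / d) * exp (Ln (Q u) / d)" for u
  have Td: "T u ^ d = c * Q u" if "u \<in> ball 0 r" for u
  proof -
    have "Q u \<noteq> 0" using ReQ[OF that] by auto
    then show ?thesis using d c by (simp add: T_def power_mult_distrib exp_of_nat_mult[symmetric])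
  qed
  have Qhol: "Q holomorphic_on ball 0 r" unfolding Q_def by (intro holomorphic_intros) (use c in auto)
  have "(\<lambda>u. Ln (Q u)) holomorphic_on ball 0 r"
    by (rule holomorphic_on_Ln'[OF _ Qhol]) (use ReQ in \<open>force simp: complex_nonpos_Reals_iff\<close>)
  then have "(\<lambda>u. Ln (Q u) / d) holomorphic_on ball 0 r"
    by (rule holomorphic_on_divide[OF _ holomorphic_on_const]) (use d in auto)
  then have "(\<lambda>u. exp (Ln (Q u) / d)) holomorphic_on ball 0 r"
    using holomorphic_on_compose[OF _ holomorphic_on_exp] by (simp add: o_def)
  then have Thol: "T holomorphic_on ball 0 r"
    unfolding T_def by (rule holomorphic_on_mult[OF holomorphic_on_const])
  define \<psi> where "\<psi> u = u / T u" for u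
  have T0: "T u \<noteq> 0" for u by (simp add: T_def)
  have \<psi>hol: "\<psi> holomorphic_on ball 0 r" unfolding \<psi>_def by (intro holomorphic_intros Thol) (simp add: T0)
  have "(T has_field_derivative deriv T 0) (at 0)"
    using Thol r(1) holomorphic_derivI by (metis centre_in_ball open_ball)
  then have "(\<psi> has_field_derivative 1 / T 0) (at 0)"
    unfolding \<psi>_def using T0[of 0] by (auto intro!: derivative_eq_intros simp: field_simps)
  then have "deriv \<psi> 0 \<noteq> 0" using T0[of 0] by (simp add: DERIV_imp_deriv)
  then obtain e g where g: "0 < e" "continuous_on (ball 0 e) g" "inj_on g (ball 0 e)" "g 0 = 0" "g ` ball 0 e \<subseteq> ball 0 r"
    "\<And>w. w \<in> ball 0 e \<Longrightarrow> \<psi> (g w) = w" "\<And>W. open W \<Longrightarrow> W \<subseteq> ball 0 e \<Longrightarrow> open (g ` W)"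
    using local_inverse_at_zero[OF \<psi>hol open_ball, of 0] r(1) by (auto simp: \<psi>_def)
  have gp: "g w \<noteq> 0 \<and> poly p (inverse (g w)) = w powi (- int d)" if w: "w \<in> ball 0 e - {0}" for w
  proof -
    have gw: "g w \<noteq> 0" using g(6)[of w] w by (auto simp: \<psi>_def)
    have "g w \<in> ball 0 r" using g(5) w by (meson DiffD1 image_subset_iff)
    then have "T (g w) ^ d = poly (reflect_poly p) (g w)" using Td c by (simp add: Q_def)
    also have "\<dots> = g w ^ d * poly p (inverse (g w))"
      using gw by (simp add: poly_reflect_poly_nz d_def)
    finally have "poly p (inverse (g w)) = inverse ((g w / T (g w)) ^ d)"
      using gw T0[of "g w"] by (simp add: power_divide field_simps)
    also have "g w / T (g w) = w" using g(6)[of w] w by (simp add: \<psi>_def)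
    finally show ?thesis using gw d by (simp add: power_int_def power_inverse)
  qed
  have "is_end (flip3 \<circ> (stereo \<circ> g)) (\<lambda>w. inverse (g w)) (- int d) e"
    unfolding is_end_def
  proof (intro conjI ballI allI impI)
    show "continuous_on (ball 0 e) (flip3 \<circ> (stereo \<circ> g))"
      by (intro continuous_on_compose g continuous_stereo continuous_flip3)
    have "inj flip3" by (metis flip3_flip3 injI)
    then show "inj_on (flip3 \<circ> (stereo \<circ> g)) (ball 0 e)"
      by (intro comp_inj_on g inj_on_subset[OF inj_stereo]) (auto intro: inj_on_subset)
    show "openin (top_of_set (sphere 0 1)) ((flip3 \<circ> (stereo \<circ> g)) ` W)" if "open W" "W \<subseteq> ball 0 e" for W
      using openin_flip3_image[OF openin_stereo_image[OF g(7)[OF that]]] by (simp add: image_comp o_assoc)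
    fix w :: complex assume w: "w \<in> ball 0 e - {0}"
    show "inverse (g w) \<in> S" using gp[OF w] w by (auto simp: rts_def)
    show "(flip3 \<circ> (stereo \<circ> g)) w = stereo (inverse (g w))" using gp[OF w] by (simp add: stereo_inverse)
    show "poly p (inverse (g w)) = w powi (- int d)" using gp[OF w] by simp
  qed (use g d in auto)
  then show ?thesis using g(4) by (intro exI[of _ "flip3 \<circ> (stereo \<circ> g)"]) auto
qed

text \<open>The radius \<open>3 * e\<close> leaves room for three concentric discs at each end: the
  open disc of radius \<open>e\<close> is later removed, the collar between \<open>e\<close> and
  \<open>2 * e\<close> is stretched, and between \<open>2 * e\<close> and \<open>3 * e\<close>
  nothing moves.\<close>

lemma ends_exist:
  obtains H h n e where "0 < e" "\<And>j. j \<le> degree p \<Longrightarrow> is_end (H j) (h j) (n j) (3 * e)"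
    "\<And>i j. i \<le> degree p \<Longrightarrow> j \<le> degree p \<Longrightarrow> i \<noteq> j \<Longrightarrow> H i ` ball 0 (3 * e) \<inter> H j ` ball 0 (3 * e) = {}"
    "sphere 0 1 - stereo ` S = (\<lambda>j. H j 0) ` {..degree p}"
proof -
  define d where "d = degree p"
  obtain a where a: "bij_betw a {0..<d} (rts p)"
    using ex_bij_betw_nat_finite[OF finite_rts] card_rts by (auto simp: d_def)
  \<comment> \<open>The roots take the indices below \<open>d\<close> and infinity takes the index
    \<open>d\<close>, which accounts for \<open>d + 1\<close> boundary components.\<close>
  define P where "P j = (if j < d then stereo (a j) else flip3 (stereo 0))" for j
  have arts: "a j \<in> rts p" if "j < d" for j using a that by (auto simp: bij_betw_def)
  have N3: "flip3 (stereo 0) $ 3 = 1" by simp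
  have Pinj: "inj_on P {..d}"
  proof (rule inj_onI)
    fix i j assume ij: "i \<in> {..d}" "j \<in> {..d}" "P i = P j"
    have "i < d \<longleftrightarrow> j < d" using ij(3) N3 stereo_3_neq_1 by (metis P_def)
    moreover have "i = j" if "i < d" "j < d"
    proof -
      have "a i = a j" using ij(3) that injD[OF inj_stereo] by (simp add: P_def)
      then show ?thesis using a that by (auto simp: bij_betw_def inj_on_def)
    qed
    ultimately show "i = j" using ij by force
  qed
  have "\<forall>j. \<exists>H h n R. j \<le> d \<longrightarrow> is_end H h n R \<and> H 0 = P j"
    using root_end arts infinity_end unfolding P_def by auto
  then obtain H h n R where H: "\<And>j. j \<le> d \<Longrightarrow> is_end (H j) (h j) (n j) (R j) \<and> H j 0 = P j" by metis
  define D where "D = {dist (P i) (P j) | i j. i \<le> d \<and> j \<le> d \<and> i \<noteq> j}"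
  have "D \<subseteq> (\<lambda>(i, j). dist (P i) (P j)) ` ({..d} \<times> {..d})" by (auto simp: D_def)
  then have "finite D" by (rule finite_subset) auto
  moreover have "\<forall>x\<in>D. 0 < x" using Pinj by (auto simp: D_def inj_on_def)
  \<comment> \<open>\<open>\<delta>\<close> bounds the distances between distinct punctures from
    below, so the balls of radius \<open>\<delta> / 2\<close> around them are disjoint.\<close>
  ultimately obtain \<delta> where \<delta>: "\<delta> > 0" "\<forall>x\<in>D. \<delta> \<le> x"
    by (metis Min_gr_iff Min_le empty_iff zero_less_one)
  have "\<exists>s>0. s \<le> R j \<and> H j ` ball 0 s \<subseteq> ball (P j) (\<delta>/2)" if j: "j \<le> d" for j
  proof -
    have Rj: "R j > 0" and c: "continuous_on (ball 0 (R j)) (H j)" using H[OF j] by (auto simp: is_end_def)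
    have "isCont (H j) 0" using c Rj by (simp add: continuous_on_interior)
    then obtain s where s: "s > 0" "\<And>w. dist w 0 < s \<Longrightarrow> dist (H j w) (H j 0) < \<delta>/2"
      unfolding continuous_at_eps_delta using \<delta>(1) half_gt_zero by metis
    show ?thesis
      by (intro exI[of _ "min s (R j)"]) (use s Rj H[OF j] in \<open>auto simp: dist_commute\<close>)
  qed
  then obtain s where s: "\<And>j. j \<le> d \<Longrightarrow> 0 < s j \<and> s j \<le> R j \<and> H j ` ball 0 (s j) \<subseteq> ball (P j) (\<delta>/2)" by metis
  define e where "e = Min (s ` {..d}) / 3"
  have e: "3 * e \<le> s j" if "j \<le> d" for j using that by (simp add: e_def)
  have e0: "e > 0" using s by (simp add: e_def)
  show ?thesis
  proof (rule that[of e H h n])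
    show "0 < e" by fact
    show "is_end (H j) (h j) (n j) (3 * e)" if "j \<le> degree p" for j
    proof (rule is_end_mono)
      show "is_end (H j) (h j) (n j) (R j)" using H that by (simp add: d_def)
      show "3 * e \<le> R j" using e[of j] s[of j] that by (simp add: d_def)
    qed (use e0 in simp)
    show "H i ` ball 0 (3 * e) \<inter> H j ` ball 0 (3 * e) = {}" if ij: "i \<le> degree p" "j \<le> degree p" "i \<noteq> j" for i j
    proof -
      have sub: "H i ` ball 0 (3 * e) \<subseteq> ball (P i) (\<delta>/2)" if "i \<le> degree p" for i
        using s[of i] e[of i] that subset_ball[of "3 * e" "s i" 0] unfolding d_def by (meson image_mono order.trans)
      have "\<delta> \<le> dist (P i) (P j)" using \<delta>(2) ij by (auto simp: D_def d_def)
      then have "ball (P i) (\<delta>/2) \<inter> ball (P j) (\<delta>/2) = {}" by (intro disjoint_ballI) simp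
      then show ?thesis using sub[OF ij(1)] sub[OF ij(2)] by blast
    qed
    have "sphere 0 1 - stereo ` S = stereo ` rts p \<union> {flip3 (stereo 0)}"
    proof (intro equalityI subsetI)
      fix v :: "real^3" assume v: "v \<in> sphere 0 1 - stereo ` S"
      show "v \<in> stereo ` rts p \<union> {flip3 (stereo 0)}"
      proof (cases "v $ 3 = 1")
        case True
        then have "(v $ 1)\<^sup>2 + (v $ 2)\<^sup>2 = 0" using v unfolding in_sphere3_iff by (simp only: in_sphere3_iff Diff_iff) simp
        then show ?thesis using True by (simp add: vec3_eq_iff sum_power2_eq_zero_iff)
      next
        case False
        then have "v = stereo (stereo_inv v)" using v stereo_stereo_inv by (metis DiffD1)
        then show ?thesis using v by blast
      qed
    next
      fix v assume "v \<in> stereo ` rts p \<union> {flip3 (stereo 0)}"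
      moreover have "stereo z \<notin> stereo ` S" if "z \<in> rts p" for z using that inj_stereo by (auto dest: injD)
      moreover have "flip3 (stereo 0) \<notin> stereo ` S" by (metis N3 imageE stereo_3_neq_1)
      ultimately show "v \<in> sphere 0 1 - stereo ` S" using stereo_in_sphere flip3_in_sphere by auto
    qed
    also have "\<dots> = P ` {..d}"
    proof -
      have "P ` {..d} = P ` {0..<d} \<union> {P d}" by (auto simp: le_less)
      also have "P ` {0..<d} = stereo ` a ` {0..<d}" unfolding image_image by (intro image_cong) (auto simp: P_def)
      also have "a ` {0..<d} = rts p" using a by (simp add: bij_betw_def)
      finally show ?thesis by (simp add: P_def)
    qed
    also have "\<dots> = (\<lambda>j. H j 0) ` {..degree p}" using H by (auto simp: d_def)
    finally show "sphere 0 1 - stereo ` S = (\<lambda>j. H j 0) ` {..degree p}" .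
  qed
qed

end

subsection \<open>Charts at boundary points\<close>

text \<open>For a number of modulus \<open>r ^ k\<close>, the distance of its image under
  \<open>i_A\<close> from the boundary circle at height -1; inverting the number exchanges the two
  boundary circles.\<close>

definition collar_height :: "nat \<Rightarrow> real \<Rightarrow> real" where
  "collar_height k r = 2 * (r ^ k)\<^sup>2 / ((r ^ k)\<^sup>2 + 1)"

text \<open>Solves \<open>collar_height k r = s\<close> for \<open>r\<close> when
  \<open>0 <= s < 2\<close>.\<close>

definition collar_radius :: "nat \<Rightarrow> real \<Rightarrow> real" where
  "collar_radius k s = root k (sqrt (s / (2 - s)))"

lemma collar_height_0 [simp]: "0 < k \<Longrightarrow> collar_height k 0 = 0"
  by (simp add: collar_height_def zero_power)

lemma collar_height_bounds: "0 \<le> collar_height k r" "collar_height k r < 2"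
proof -
  have "(r ^ k)\<^sup>2 + 1 > 0" by (simp add: add_nonneg_pos)
  then show "0 \<le> collar_height k r" "collar_height k r < 2" by (simp_all add: collar_height_def field_simps)
qed

lemma collar_radius_height:
  assumes "0 < k" "0 \<le> r" shows "collar_radius k (collar_height k r) = r"
proof -
  have "(r ^ k)\<^sup>2 + 1 > 0" by (simp add: add_nonneg_pos)
  then have "collar_height k r / (2 - collar_height k r) = (r ^ k)\<^sup>2"
    by (simp add: collar_height_def divide_simps)
  then show ?thesis using assms by (simp add: collar_radius_def real_sqrt_abs real_root_power_cancel)
qed

lemma collar_radius_nonneg: "0 < k \<Longrightarrow> 0 \<le> s \<Longrightarrow> s < 2 \<Longrightarrow> 0 \<le> collar_radius k s"
  by (simp add: collar_radius_def)

lemma collar_height_radius: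
  assumes "0 < k" "0 \<le> s" "s < 2" shows "collar_height k (collar_radius k s) = s"
proof -
  have "(collar_radius k s ^ k)\<^sup>2 = s / (2 - s)"
    using assms by (simp add: collar_radius_def)
  then show ?thesis unfolding collar_height_def using assms by (simp only:) (simp add: divide_simps)
qed

lemma collar_height_strict_mono:
  assumes "0 < k" "0 \<le> r" "r < r'" shows "collar_height k r < collar_height k r'"
proof -
  have "(r ^ k)\<^sup>2 < (r' ^ k)\<^sup>2" using assms by (intro power_strict_mono) auto
  moreover have "(r ^ k)\<^sup>2 + 1 > 0" "(r' ^ k)\<^sup>2 + 1 > 0" by (simp_all add: add_nonneg_pos)
  ultimately show ?thesis by (simp add: collar_height_def divide_simps) (simp add: algebra_simps)
qed

lemma collar_radius_pos_iff:
  assumes "0 < k" "0 \<le> s" "s < 2" shows "0 < collar_radius k s \<longleftrightarrow> 0 < s"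
  using assms by (simp add: collar_radius_def zero_less_divide_iff)

lemma collar_radius_less:
  assumes "0 < k" "0 \<le> s" "s < collar_height k r" "0 \<le> r" shows "collar_radius k s < r"
proof (rule ccontr)
  assume "\<not> collar_radius k s < r"
  then have "r \<le> collar_radius k s" by simp
  have s2: "s < 2" using assms(3) collar_height_bounds(2)[of k r] by simp
  have "collar_height k r \<le> collar_height k (collar_radius k s)"
    using collar_height_strict_mono[of k r "collar_radius k s"] assms \<open>r \<le> collar_radius k s\<close> by (cases "r = collar_radius k s") auto
  then show False using collar_height_radius[of k s] assms s2 by simp
qed

lemma continuous_collar_radius: "0 < k \<Longrightarrow> continuous_on {0..<2} (collar_radius k)"
  unfolding collar_radius_def[abs_def] by (intro continuous_intros) auto

lemma continuous_collar_height: "continuous_on A (collar_height k)"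
proof -
  have "(r ^ k)\<^sup>2 + 1 \<noteq> 0" for r :: real using add_nonneg_pos[of "(r ^ k)\<^sup>2" 1] by simp
  then show ?thesis unfolding collar_height_def[abs_def] by (intro continuous_intros) auto
qed

lemma i_A_polar: "0 < r \<Longrightarrow> i_A (of_real r * cis a) = (cis a, (r\<^sup>2 - 1) / (r\<^sup>2 + 1))"
  by (simp add: i_A_def sgn_mult sgn_of_real norm_mult)

locale poly_end = separable_poly p for p :: "complex poly" +
  fixes H :: "complex \<Rightarrow> real^3" and h :: "complex \<Rightarrow> complex" and n :: int and R :: real
  assumes H_end: "is_end H h n R" and H_0: "H 0 \<notin> stereo ` S"
begin

definition "k = nat \<bar>n\<bar>"
definition "\<delta> = collar_height k R"
definition "strip = {v. 0 < Re v \<and> Re v < \<delta>}"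
definition "closed_strip = {v. 0 \<le> Re v \<and> Re v < \<delta>}"
text \<open>Flat coordinates at the end: \<open>Re v\<close> is the distance from the boundary and
  \<open>Im v\<close> the arc length along it. The boundary circle winds \<open>k\<close> times
  around a circle of length \<open>2 * pi\<close>, so the angle in the end coordinate is
  \<open>Im v / k\<close>.\<close>

definition "W v = of_real (collar_radius k (Re v)) * cis (Im v / k)"
definition "E v = h (W v)"

lemma R_pos: "0 < R" and n_nonzero: "n \<noteq> 0" using H_end by (auto simp: is_end_def)

lemma k_pos: "0 < k" using n_nonzero by (simp add: k_def)

lemma \<delta>_pos: "0 < \<delta>" and \<delta>_less: "\<delta> < 2"
  using collar_height_strict_mono[OF k_pos, of 0 R] R_pos collar_height_bounds k_pos by (auto simp: \<delta>_def)

lemma strip_subset: "strip \<subseteq> closed_strip" by (auto simp: strip_def closed_strip_def)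

lemma convex_strip: "convex strip"
proof -
  have "strip = {v. Re v > 0} \<inter> {v. Re v < \<delta>}" by (auto simp: strip_def)
  then show ?thesis by (simp add: convex_Int convex_halfspace_Re_gt convex_halfspace_Re_lt)
qed

lemma norm_W:
  assumes "v \<in> closed_strip" shows "cmod (W v) = collar_radius k (Re v)"
  using assms collar_radius_nonneg[OF k_pos, of "Re v"] \<delta>_less by (simp add: W_def norm_mult closed_strip_def)

lemma W_in_ball: "v \<in> closed_strip \<Longrightarrow> W v \<in> ball 0 R"
  using norm_W[of v] collar_radius_less[OF k_pos, of "Re v" R] R_pos by (simp add: closed_strip_def \<delta>_def)

lemma W_nonzero: "v \<in> strip \<Longrightarrow> W v \<noteq> 0"
  using norm_W[of v] strip_subset collar_radius_pos_iff[OF k_pos, of "Re v"] \<delta>_less by (auto simp: strip_def)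

lemma W_boundary: "Re v = 0 \<Longrightarrow> W v = 0"
  using k_pos by (simp add: W_def collar_radius_def)

lemma continuous_W: "continuous_on closed_strip W"
proof -
  have "continuous_on closed_strip (\<lambda>v. collar_radius k (Re v))"
    using \<delta>_less by (intro continuous_on_compose2[OF continuous_collar_radius[OF k_pos]] continuous_intros)
      (auto simp: closed_strip_def)
  then show ?thesis unfolding W_def[abs_def] cis_conv_exp using k_pos by (intro continuous_intros) auto
qed

lemma W_props: assumes "v \<in> strip" shows "W v \<in> ball 0 R" "W v \<noteq> 0"
  using assms W_in_ball W_nonzero strip_subset by auto

lemma h_props:
  assumes "w \<in> ball 0 R" "w \<noteq> 0" shows "h w \<in> S" "H w = stereo (h w)" "poly p (h w) = w powi n"
  using H_end assms unfolding is_end_def by auto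

lemma E_in_S: "v \<in> strip \<Longrightarrow> E v \<in> S"
  unfolding E_def by (intro h_props W_props)

lemma stereo_E: "v \<in> strip \<Longrightarrow> stereo (E v) = H (W v)"
  unfolding E_def by (intro h_props(2)[symmetric] W_props)

lemma continuous_E: "continuous_on strip E"
proof -
  have "continuous_on strip (\<lambda>v. H (W v))"
    using H_end W_in_ball strip_subset unfolding is_end_def
    by (intro continuous_on_compose2[of "ball 0 R" H strip W] continuous_on_subset[OF continuous_W]) auto
  then have "continuous_on strip (\<lambda>v. stereo_inv (H (W v)))"
    by (rule continuous_on_compose2[OF continuous_stereo_inv])
      (use stereo_3_neq_1 in \<open>auto simp: stereo_E[symmetric]\<close>)
  then show ?thesis by (rule continuous_on_eq) (simp add: stereo_E[symmetric])
qed

text \<open>\<open>E\<close> followed by \<open>f\<close> rolls the strip onto a collar of the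
  annulus. For \<open>n < 0\<close> the collar is that of the other boundary circle and both
  coordinates change sign, which does not affect distances.\<close>

lemma f_E:
  assumes v: "v \<in> strip"
  shows "f (E v) = (cis (sgn (of_int n) * Im v), sgn (of_int n) * (Re v - 1))"
proof -
  define r where "r = collar_radius k (Re v)"
  have r: "0 < r" using v collar_radius_pos_iff[OF k_pos, of "Re v"] \<delta>_less by (simp add: strip_def r_def)
  have s: "2 * (r ^ k)\<^sup>2 / ((r ^ k)\<^sup>2 + 1) = Re v"
    using collar_height_radius[OF k_pos, of "Re v"] v \<delta>_less by (simp add: strip_def r_def collar_height_def)
  have rk: "r ^ k > 0" using r by simp
  have D: "(r ^ k)\<^sup>2 + 1 > 0" by (simp add: add_nonneg_pos)
  have p: "poly p (E v) = W v powi n"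
    unfolding E_def by (intro h_props(3) W_props v)
  have Wv: "W v = of_real r * cis (Im v / k)" by (simp add: W_def r_def)
  show ?thesis
  proof (cases "n > 0")
    case True
    then have "W v powi n = W v ^ k" by (simp add: power_int_def k_def)
    also have "\<dots> = of_real (r ^ k) * cis (Im v)"
      unfolding Wv power_mult_distrib Complex.DeMoivre using k_pos by simp
    finally have "f (E v) = i_A (of_real (r ^ k) * cis (Im v))" by (simp add: p)
    also have "\<dots> = (cis (Im v), ((r ^ k)\<^sup>2 - 1) / ((r ^ k)\<^sup>2 + 1))" using rk by (rule i_A_polar)
    also have "((r ^ k)\<^sup>2 - 1) / ((r ^ k)\<^sup>2 + 1) = Re v - 1" unfolding s[symmetric] using D by (simp add: field_simps)
    finally show ?thesis using True by simp
  next
    case False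
    then have "W v powi n = inverse (W v ^ k)" using n_nonzero by (simp add: power_int_def k_def power_inverse)
    also have "\<dots> = of_real (inverse (r ^ k)) * cis (- Im v)"
      unfolding Wv power_mult_distrib Complex.DeMoivre using k_pos by simp
    finally have "f (E v) = i_A (of_real (inverse (r ^ k)) * cis (- Im v))" by (simp add: p)
    also have "\<dots> = (cis (- Im v), ((inverse (r ^ k))\<^sup>2 - 1) / ((inverse (r ^ k))\<^sup>2 + 1))"
      using rk by (intro i_A_polar) simp
    also have "((inverse (r ^ k))\<^sup>2 - 1) / ((inverse (r ^ k))\<^sup>2 + 1) = - (Re v - 1)"
    proof -
      have *: "((inverse a)\<^sup>2 - 1) / ((inverse a)\<^sup>2 + 1) = - (2 * a\<^sup>2 / (a\<^sup>2 + 1) - 1)" if "a > 0" for a :: real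
      proof -
        have b: "a\<^sup>2 > 0" using that by simp
        have "((inverse a)\<^sup>2 - 1) / ((inverse a)\<^sup>2 + 1) = (1 / a\<^sup>2 - 1) / (1 / a\<^sup>2 + 1)"
          by (simp add: inverse_eq_divide power_divide)
        moreover have "(1 / b - 1) / (1 / b + 1) = (1 - b) / (1 + b)" if "b > 0" for b :: real
        proof -
          have "1 / b - 1 = (1 - b) / b" "1 / b + 1 = (1 + b) / b" using that by (simp_all add: field_simps)
          then show ?thesis using that by simp
        qed
        from this[OF b] have "(1 / a\<^sup>2 - 1) / (1 / a\<^sup>2 + 1) = (1 - a\<^sup>2) / (1 + a\<^sup>2)" .
        moreover have "(1 - a\<^sup>2) / (1 + a\<^sup>2) = - (2 * a\<^sup>2 / (a\<^sup>2 + 1) - 1)" using add_pos_pos[OF zero_less_one b] by (simp add: field_simps)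
        ultimately show ?thesis by simp
      qed
      show ?thesis unfolding s[symmetric] by (rule *[OF rk])
    qed
    finally show ?thesis using False n_nonzero by simp
  qed
qed

lemma annulus_dist_E_le:
  assumes "v \<in> strip" "v' \<in> strip" shows "annulus_dist (f (E v)) (f (E v')) \<le> cmod (v - v')"
proof -
  have sg: "sgn (real_of_int n) = 1 \<or> sgn (real_of_int n) = - 1" using n_nonzero by (auto simp: sgn_if)
  have "annulus_dist (f (E v)) (f (E v')) \<le> sqrt ((sgn (real_of_int n) * Im v - sgn (real_of_int n) * Im v')\<^sup>2 +
    (sgn (real_of_int n) * (Re v - 1) - sgn (real_of_int n) * (Re v' - 1))\<^sup>2)"
    unfolding f_E[OF assms(1)] f_E[OF assms(2)] by (rule annulus_dist_cis_le)
  also have "\<dots> = cmod (v - v')" using sg by (auto simp: cmod_def power2_commute add.commute)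
  finally show ?thesis .
qed

lemma annulus_dist_E:
  assumes "v \<in> strip" "v' \<in> strip" "\<bar>Im v - Im v'\<bar> \<le> pi"
  shows "annulus_dist (f (E v)) (f (E v')) = cmod (v - v')"
proof -
  have sg: "sgn (real_of_int n) = 1 \<or> sgn (real_of_int n) = - 1" using n_nonzero by (auto simp: sgn_if)
  have "annulus_dist (f (E v)) (f (E v')) = sqrt ((sgn (real_of_int n) * Im v - sgn (real_of_int n) * Im v')\<^sup>2 +
    (sgn (real_of_int n) * (Re v - 1) - sgn (real_of_int n) * (Re v' - 1))\<^sup>2)"
    unfolding f_E[OF assms(1)] f_E[OF assms(2)] using sg assms(3) by (intro annulus_dist_cis) auto
  also have "\<dots> = cmod (v - v')" using sg by (auto simp: cmod_def power2_commute add.commute)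
  finally show ?thesis .
qed

lemma strip_path:
  assumes "v \<in> strip" "v' \<in> strip"
  shows "path (E \<circ> linepath v v')" "path_image (E \<circ> linepath v v') \<subseteq> S" "pathstart (E \<circ> linepath v v') = E v"
    "pathfinish (E \<circ> linepath v v') = E v'" "curve_length annulus_dist (f \<circ> (E \<circ> linepath v v')) \<le> ennreal (cmod (v - v'))"
proof -
  have seg: "closed_segment v v' \<subseteq> strip" using assms convex_strip by (simp add: closed_segment_subset)
  show "path (E \<circ> linepath v v')"
    by (intro path_continuous_image continuous_on_subset[OF continuous_E]) (simp_all add: seg)
  show "path_image (E \<circ> linepath v v') \<subseteq> S" using seg E_in_S by (auto simp: path_image_compose)
  show "pathstart (E \<circ> linepath v v') = E v" "pathfinish (E \<circ> linepath v v') = E v'"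
    by (simp_all add: pathstart_compose pathfinish_compose)
  show "curve_length annulus_dist (f \<circ> (E \<circ> linepath v v')) \<le> ennreal (cmod (v - v'))"
  proof (rule curve_length_le_Lipschitz)
    fix s t :: real assume st: "0 \<le> s" "s \<le> t" "t \<le> 1"
    have in_strip: "linepath v v' u \<in> strip" if "0 \<le> u" "u \<le> 1" for u using seg that by (auto simp: linepath_in_path)
    have "annulus_dist (f (E (linepath v v' s))) (f (E (linepath v v' t))) \<le> cmod (linepath v v' s - linepath v v' t)"
      using st by (intro annulus_dist_E_le in_strip) auto
    also have "linepath v v' s - linepath v v' t = (t - s) *\<^sub>R (v - v')" by (simp add: linepath_def algebra_simps)
    also have "cmod \<dots> = cmod (v - v') * (t - s)" using st by simp
    finally show "annulus_dist ((f \<circ> (E \<circ> linepath v v')) s) ((f \<circ> (E \<circ> linepath v v')) t) \<le> cmod (v - v') * (t - s)"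
      by simp
  qed simp
qed

lemma dS_E_le:
  assumes "v \<in> strip" "v' \<in> strip" shows "dS (E v) (E v') \<le> cmod (v - v')"
proof -
  note P = strip_path[OF assms]
  have "E \<circ> linepath v v' \<in> rect_paths S f annulus_dist (E v) (E v')"
    using P le_less_trans[OF P(5) ennreal_less_top] by (simp add: rect_paths_def rectifiable_curve_def)
  then show ?thesis unfolding dS_eq by (rule pullback_dist_le[OF _ P(5)]) simp
qed

text \<open>Pushes boundary points into the open strip. The denominator \<open>i + 2\<close> keeps
  the bound below \<open>\<delta>\<close> already for \<open>i = 0\<close>, and a point of the open
  strip is fixed from some index on.\<close>

definition approx :: "complex \<Rightarrow> nat \<Rightarrow> complex" where
  "approx v i = Complex (max (Re v) (\<delta> / (real i + 2))) (Im v)"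

definition E_bar :: "complex \<Rightarrow> (nat \<Rightarrow> complex) set" where
  "E_bar v = MS.cclass (\<lambda>i. E (approx v i))"

lemma approx_in_strip: "v \<in> closed_strip \<Longrightarrow> approx v i \<in> strip"
proof -
  assume v: "v \<in> closed_strip"
  have "\<delta> < \<delta> * (real i + 2)" using \<delta>_pos mult_strict_left_mono[of 1 "real i + 2" \<delta>] by simp
  then have "\<delta> / (real i + 2) < \<delta>" by (simp add: divide_less_eq)
  moreover have "\<delta> / (real i + 2) > 0" using \<delta>_pos by simp
  ultimately show ?thesis using v by (auto simp: approx_def strip_def closed_strip_def less_max_iff_disj)
qed

lemma approx_tendsto: "v \<in> closed_strip \<Longrightarrow> approx v \<longlonglongrightarrow> v"
proof -
  assume v: "v \<in> closed_strip"
  have "(\<lambda>i. \<delta> / (real i + 2)) \<longlonglongrightarrow> 0"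
    using LIMSEQ_ignore_initial_segment[OF lim_const_over_n[of \<delta>], of 2] by (simp add: add.commute)
  then have "(\<lambda>i. max (Re v) (\<delta> / (real i + 2))) \<longlonglongrightarrow> max (Re v) 0" by (intro tendsto_intros)
  then have "(\<lambda>i. max (Re v) (\<delta> / (real i + 2))) \<longlonglongrightarrow> Re v" using v by (simp add: closed_strip_def max.absorb1)
  then have "(\<lambda>i. Complex (max (Re v) (\<delta> / (real i + 2))) (Im v)) \<longlonglongrightarrow> Complex (Re v) (Im v)"
    by (intro tendsto_Complex tendsto_const)
  then show ?thesis by (simp add: approx_def[abs_def])
qed

lemma MCauchy_E_approx:
  assumes v: "v \<in> closed_strip" shows "MS.MCauchy (\<lambda>i. E (approx v i))"
  unfolding MS.MCauchy_def
proof (intro conjI allI impI)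
  show "range (\<lambda>i. E (approx v i)) \<subseteq> S" using E_in_S approx_in_strip[OF v] by auto
  fix e :: real assume "e > 0"
  have "Cauchy (approx v)" using approx_tendsto[OF v] by (simp add: LIMSEQ_imp_Cauchy)
  then obtain N where N: "\<And>i j. N \<le> i \<Longrightarrow> N \<le> j \<Longrightarrow> dist (approx v i) (approx v j) < e"
    using \<open>e > 0\<close> unfolding Cauchy_def by metis
  show "\<exists>N. \<forall>i i'. N \<le> i \<longrightarrow> N \<le> i' \<longrightarrow> dS (E (approx v i)) (E (approx v i')) < e"
  proof (intro exI[of _ N] allI impI)
    fix i j assume "N \<le> i" "N \<le> j"
    then show "dS (E (approx v i)) (E (approx v j)) < e"
      using dS_E_le[OF approx_in_strip[OF v] approx_in_strip[OF v], of i j] N[of i j] by (simp add: dist_norm)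
  qed
qed

lemma E_bar_in: "v \<in> closed_strip \<Longrightarrow> E_bar v \<in> B"
  unfolding E_bar_def B_eq by (intro MS.cclass_in_carrier MCauchy_E_approx)

lemma E_bar_eq_i_B: assumes v: "v \<in> strip" shows "E_bar v = i_B p (E v)"
  unfolding E_bar_def i_B_eq
proof (rule MS.completion_cclass_eventually_const)
  have v': "v \<in> closed_strip" using v strip_subset by auto
  show "MS.MCauchy (\<lambda>i. E (approx v i))" by (rule MCauchy_E_approx[OF v'])
  show "E v \<in> S" by (rule E_in_S[OF v])
  have "(\<lambda>i. \<delta> / (real i + 2)) \<longlonglongrightarrow> 0"
    using LIMSEQ_ignore_initial_segment[OF lim_const_over_n[of \<delta>], of 2] by (simp add: add.commute)
  then have "eventually (\<lambda>i. \<delta> / (real i + 2) < Re v) sequentially"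
    using v by (intro order_tendstoD) (auto simp: strip_def)
  then show "eventually (\<lambda>i. E (approx v i) = E v) sequentially"
    by (rule eventually_mono) (simp add: approx_def max_def)
qed

text \<open>\<open>W\<close> sees the imaginary part only through this \<open>cis\<close>, so
  \<open>E_bar\<close> has period \<open>2 * pi * k\<close> along the boundary.\<close>

lemma E_bar_cong: "cis (y / k) = cis (y' / k) \<Longrightarrow> E_bar (Complex s y) = E_bar (Complex s y')"
  by (simp add: E_bar_def approx_def E_def W_def)

lemma dB_E_bar_lim:
  assumes "v \<in> closed_strip" "v' \<in> closed_strip"
  shows "(\<lambda>i. dS (E (approx v i)) (E (approx v' i))) \<longlonglongrightarrow> dB (E_bar v) (E_bar v')"
  unfolding E_bar_def dB_eq by (intro MS.completion_dist_lim MCauchy_E_approx assms)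

lemma dB_E_bar_le:
  assumes "v \<in> closed_strip" "v' \<in> closed_strip" shows "dB (E_bar v) (E_bar v') \<le> cmod (v - v')"
proof (rule LIMSEQ_le[OF dB_E_bar_lim[OF assms]])
  show "(\<lambda>i. cmod (approx v i - approx v' i)) \<longlonglongrightarrow> cmod (v - v')"
    by (intro tendsto_intros approx_tendsto assms)
  show "\<exists>N. \<forall>i\<ge>N. dS (E (approx v i)) (E (approx v' i)) \<le> cmod (approx v i - approx v' i)"
    using dS_E_le approx_in_strip assms by blast
qed

lemma continuous_E_bar: "continuous_map (top_of_set closed_strip) MB.mtopology E_bar"
  unfolding MB.continuous_map_to_metric
proof (intro ballI allI impI)
  fix v and e :: real assume v: "v \<in> topspace (top_of_set closed_strip)" and e: "e > 0"
  have "E_bar v' \<in> MB.mball (E_bar v) e" if "v' \<in> closed_strip \<inter> ball v e" for v'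
    using dB_E_bar_le[of v v'] that v E_bar_in by (auto simp: dist_norm)
  then show "\<exists>U. openin (top_of_set closed_strip) U \<and> v \<in> U \<and> (\<forall>y\<in>U. E_bar y \<in> MB.mball (E_bar v) e)"
    using v e by (intro exI[of _ "closed_strip \<inter> ball v e"]) auto
qed

text \<open>Radii up to \<open>\<delta>\<close> keep a half disc inside the strip. Radii up to
  \<open>pi / 2\<close> make imaginary parts differ by at most \<open>pi\<close>, so that the
  distance of the annulus is Euclidean there.\<close>

definition "\<rho>0 = min \<delta> (pi / 2)"

lemma \<rho>0_pos: "0 < \<rho>0" using \<delta>_pos by (simp add: \<rho>0_def)

definition half_disc :: "complex \<Rightarrow> real \<Rightarrow> complex set" where
  "half_disc v0 r = {v. 0 < Re v \<and> cmod (v - v0) < r}"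

context
  fixes v0 :: complex assumes v0: "Re v0 = 0"
begin

lemma half_disc_in_strip: "cmod (v - v0) < \<rho>0 \<Longrightarrow> 0 \<le> Re v \<Longrightarrow> v \<in> closed_strip"
  using abs_Re_le_cmod[of "v - v0"] v0 by (auto simp: closed_strip_def \<rho>0_def)

lemma half_disc_subset: "half_disc v0 \<rho>0 \<subseteq> strip"
  using half_disc_in_strip by (auto simp: half_disc_def strip_def closed_strip_def)

lemma half_disc_annulus_dist:
  assumes "v \<in> half_disc v0 \<rho>0" "v' \<in> half_disc v0 \<rho>0"
  shows "annulus_dist (f (E v)) (f (E v')) = cmod (v - v')"
proof (rule annulus_dist_E)
  show "v \<in> strip" "v' \<in> strip" using assms half_disc_subset by auto
  show "\<bar>Im v - Im v'\<bar> \<le> pi"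
    using abs_Im_le_cmod[of "v - v0"] abs_Im_le_cmod[of "v' - v0"] assms by (auto simp: half_disc_def \<rho>0_def)
qed

lemma inj_E_half_disc: "inj_on E (half_disc v0 \<rho>0)"
proof (rule inj_onI)
  fix v v' assume *: "v \<in> half_disc v0 \<rho>0" "v' \<in> half_disc v0 \<rho>0" "E v = E v'"
  have "E v \<in> S" using * half_disc_subset E_in_S by auto
  then have "f (E v) \<in> sphere 0 1 \<times> UNIV" using f_image by auto
  then have "annulus_dist (f (E v)) (f (E v')) = 0"
    using *(3) Metric_space.mdist_zero[OF Metric_space_annulus, of "f (E v)"] by simp
  then show "v = v'" using half_disc_annulus_dist[OF *(1,2)] by simp
qed

definition F :: "complex \<Rightarrow> complex" where "F = inv_into (half_disc v0 \<rho>0) E"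

lemma F_E: "v \<in> half_disc v0 \<rho>0 \<Longrightarrow> F (E v) = v"
  unfolding F_def by (rule inv_into_f_f[OF inj_E_half_disc])

lemma sublevel_eq: "r \<le> \<rho>0 \<Longrightarrow> {x \<in> E ` half_disc v0 \<rho>0. cmod (F x - v0) < r} = E ` half_disc v0 r"
  using F_E by (auto simp: half_disc_def)

text \<open>Here the centre \<open>v0\<close> is no point of \<open>S\<close>, and \<open>N\<close>
  measures the distance to a missing point. The closed half disc is compact and its diameter goes to
  the puncture \<open>H 0\<close>; intersecting with \<open>S\<close> removes exactly the diameter,
  so sublevel sets are closed in \<open>S\<close>.\<close>

lemma half_disc_pullback_chart:
  "pullback_chart S f annulus_dist (E ` half_disc v0 \<rho>0) (\<lambda>x. cmod (F x - v0)) (\<lambda>x y. cmod (F x - F y)) \<rho>0"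
proof
  fix r assume r: "r < \<rho>0"
  have Hc: "continuous_on (ball 0 R) H" using H_end by (simp add: is_end_def)
  show "closedin (top_of_set S) {x \<in> E ` half_disc v0 \<rho>0. cmod (F x - v0) \<le> r}"
  proof -
    define C where "C = {v. 0 \<le> Re v} \<inter> cball v0 r"
    have Cs: "C \<subseteq> closed_strip" using r by (auto simp: C_def dist_norm norm_minus_commute intro!: half_disc_in_strip)
    have "compact C" unfolding C_def by (intro closed_Int_compact closed_halfspace_Re_ge compact_cball)
    then have "compact ((\<lambda>v. H (W v)) ` C)"
      using W_in_ball Cs by (intro compact_continuous_image continuous_on_compose2[OF Hc] continuous_on_subset[OF continuous_W]) auto
    then have "closedin (top_of_set S) (S \<inter> stereo -` ((\<lambda>v. H (W v)) ` C))"
      by (intro continuous_closedin_preimage continuous_stereo compact_imp_closed)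
    also have "S \<inter> stereo -` ((\<lambda>v. H (W v)) ` C) = {x \<in> E ` half_disc v0 \<rho>0. cmod (F x - v0) \<le> r}"
    proof (intro equalityI subsetI)
      fix x assume "x \<in> S \<inter> stereo -` ((\<lambda>v. H (W v)) ` C)"
      then obtain v where v: "v \<in> C" "stereo x = H (W v)" "x \<in> S" by auto
      have "Re v \<noteq> 0" using v H_0 W_boundary[of v] by (metis image_eqI)
      then have hd: "v \<in> half_disc v0 \<rho>0" using v(1) r by (auto simp: C_def half_disc_def dist_norm norm_minus_commute)
      then have "stereo x = stereo (E v)" using v(2) stereo_E half_disc_subset by auto
      then have "x = E v" by (rule injD[OF inj_stereo])
      then show "x \<in> {x \<in> E ` half_disc v0 \<rho>0. cmod (F x - v0) \<le> r}"
        using hd v(1) by (auto simp: F_E C_def dist_norm norm_minus_commute)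
    next
      fix x assume "x \<in> {x \<in> E ` half_disc v0 \<rho>0. cmod (F x - v0) \<le> r}"
      then obtain v where v: "v \<in> half_disc v0 \<rho>0" "x = E v" "cmod (v - v0) \<le> r" by (auto simp: F_E)
      then have "v \<in> strip" "v \<in> C" using half_disc_subset by (auto simp: C_def half_disc_def dist_norm norm_minus_commute)
      then show "x \<in> S \<inter> stereo -` ((\<lambda>v. H (W v)) ` C)" using E_in_S stereo_E v(2) by auto
    qed
    finally show ?thesis .
  qed
  show "openin (top_of_set S) {x \<in> E ` half_disc v0 \<rho>0. cmod (F x - v0) < r}"
  proof -
    have sub: "half_disc v0 r \<subseteq> half_disc v0 \<rho>0" using r by (auto simp: half_disc_def)
    have hs: "half_disc v0 r \<subseteq> strip" using sub half_disc_subset by auto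
    have "half_disc v0 r = {v. Re v > 0} \<inter> ball v0 r" by (auto simp: half_disc_def dist_norm norm_minus_commute)
    then have o: "open (half_disc v0 r)" by (simp add: open_Int open_halfspace_Re_gt)
    \<comment> \<open>Since \<open>E\<close> is \<open>h\<close> after \<open>W\<close>, injectivity
      of \<open>E\<close> passes to \<open>W\<close>, and invariance of domain makes the image
      open.\<close>
    have "inj_on W (half_disc v0 r)"
      using inj_on_subset[OF inj_E_half_disc sub] unfolding E_def by (auto simp: inj_on_def)
    moreover have "continuous_on (half_disc v0 r) W"
      using continuous_W hs strip_subset by (meson continuous_on_subset)
    ultimately have "open (W ` half_disc v0 r)" using o by (intro invariance_of_domain)
    moreover have "W ` half_disc v0 r \<subseteq> ball 0 R" using W_in_ball hs strip_subset by auto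
    ultimately have "openin (top_of_set (sphere 0 1)) (H ` W ` half_disc v0 r)" using H_end by (simp add: is_end_def)
    then obtain T where T: "open T" "H ` W ` half_disc v0 r = sphere 0 1 \<inter> T" by (auto simp: openin_open)
    have "openin (top_of_set S) (S \<inter> stereo -` T)" by (intro continuous_openin_preimage_gen continuous_stereo T)
    also have "S \<inter> stereo -` T = E ` half_disc v0 r"
    proof (intro equalityI subsetI)
      fix x assume x: "x \<in> S \<inter> stereo -` T"
      then have "stereo x \<in> H ` W ` half_disc v0 r" unfolding T(2) using stereo_in_sphere by auto
      then obtain v where v: "v \<in> half_disc v0 r" "stereo x = H (W v)" by auto
      then have "stereo x = stereo (E v)" using hs stereo_E by auto
      then have "x = E v" by (rule injD[OF inj_stereo])
      then show "x \<in> E ` half_disc v0 r" using v by simp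
    next
      fix x assume "x \<in> E ` half_disc v0 r"
      then obtain v where v: "v \<in> half_disc v0 r" "x = E v" by auto
      then have "stereo x \<in> H ` W ` half_disc v0 r" using stereo_E hs by auto
      then show "x \<in> S \<inter> stereo -` T" unfolding T(2) using v E_in_S hs by auto
    qed
    finally show ?thesis using r by (simp add: sublevel_eq)
  qed
next
  fix x y assume "x \<in> E ` half_disc v0 \<rho>0" "y \<in> E ` half_disc v0 \<rho>0"
  then obtain v v' where v: "v \<in> half_disc v0 \<rho>0" "x = E v" "v' \<in> half_disc v0 \<rho>0" "y = E v'" by auto
  show "\<bar>cmod (F x - v0) - cmod (F y - v0)\<bar> \<le> annulus_dist (f x) (f y)"
    using half_disc_annulus_dist[OF v(1,3)] norm_triangle_ineq3[of "v - v0" "v' - v0"] by (simp add: v F_E del: o_apply)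
  show "cmod (F x - F y) \<le> cmod (F x - v0) + cmod (F y - v0)"
    using norm_triangle_ineq4[of "F x - v0" "F y - v0"] by simp
  show "\<exists>g. path g \<and> path_image g \<subseteq> S \<and> pathstart g = x \<and> pathfinish g = y \<and>
      curve_length annulus_dist (f \<circ> g) \<le> ennreal (cmod (F x - F y))"
    using strip_path[of v v'] v half_disc_subset by (intro exI[of _ "E \<circ> linepath v v'"]) (auto simp: F_E)
next
  fix g assume g: "path g" "path_image g \<subseteq> E ` half_disc v0 \<rho>0"
  \<comment> \<open>The half disc is embedded isometrically into the annulus, so the chord between
    the end points already bounds the length.\<close>
  have "pathstart g \<in> E ` half_disc v0 \<rho>0" "pathfinish g \<in> E ` half_disc v0 \<rho>0" using g by auto
  then have "cmod (F (pathstart g) - F (pathfinish g)) = annulus_dist (f (g 0)) (f (g 1))"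
    by (auto simp: F_E half_disc_annulus_dist pathstart_def pathfinish_def simp del: o_apply)
  then show "ennreal (cmod (F (pathstart g) - F (pathfinish g))) \<le> curve_length annulus_dist (f \<circ> g)"
    using curve_length_ge_chord[of 0 1 annulus_dist "f \<circ> g"] by (simp del: o_apply add: o_def)
qed simp

end

end

section \<open>Half disc neighbourhoods of boundary points and the collar map\<close>

context poly_end
begin

text \<open>The chart estimate needs a starting point in \<open>S\<close>, which \<open>v0\<close>
  is not. It is applied from a point at distance \<open>t\<close> from \<open>v0\<close>, where
  \<open>3 * t\<close> is the slack \<open>r - D\<close>; moving the start costs only
  \<open>2 * t\<close>, so a contradiction remains.\<close>

lemma i_B_near_boundary:
  assumes v0: "Re v0 = 0" and y: "y \<in> S" and r: "dB (E_bar v0) (i_B p y) < r" "r < \<rho>0"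
  shows "\<exists>v\<in>half_disc v0 r. y = E v"
proof (rule ccontr)
  assume no: "\<not> ?thesis"
  interpret ch: pullback_chart S f annulus_dist "E ` half_disc v0 \<rho>0" "\<lambda>x. cmod (F v0 x - v0)" "\<lambda>x y. cmod (F v0 x - F v0 y)" \<rho>0
    by (rule half_disc_pullback_chart[OF v0])
  define D where "D = dB (E_bar v0) (i_B p y)"
  have D: "0 \<le> D" "D < r" using r(1) by (simp_all add: D_def)
  define t where "t = (r - D) / 3"
  have t3: "3 * t = r - D" by (simp add: t_def)
  have t: "0 < t" "t < r" using D t3 by linarith+
  define v where "v = v0 + of_real t"
  have v: "v \<in> half_disc v0 \<rho>0" "cmod (v - v0) = t" using t r v0 by (auto simp: v_def half_disc_def)
  have vs: "v \<in> strip" "v \<in> closed_strip" using v half_disc_subset[OF v0] strip_subset by auto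
  have v0s: "v0 \<in> closed_strip" using half_disc_in_strip[OF v0, of v0] v0 \<rho>0_pos by simp
  have "\<not> (y \<in> E ` half_disc v0 \<rho>0 \<and> cmod (F v0 y - v0) < r)"
    using no sublevel_eq[OF v0, of r] r(2) by auto
  then have "r - t \<le> dS (E v) y"
    using ch.pullback_dist_ge_chart[of "E v" r y] v t r(2) rect_paths_nonempty[OF E_in_S[OF vs(1)] y]
    by (simp add: F_E[OF v0] dS_eq)
  also have "\<dots> = dB (E_bar v) (i_B p y)" using dB_i_B[OF E_in_S[OF vs(1)] y] by (simp add: E_bar_eq_i_B[OF vs(1)])
  also have "\<dots> \<le> dB (E_bar v) (E_bar v0) + dB (E_bar v0) (i_B p y)"
    using vs v0s y by (intro MB.triangle E_bar_in i_B_in)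
  also have "\<dots> \<le> t + dB (E_bar v0) (i_B p y)" using dB_E_bar_le[OF vs(2) v0s] v(2) by simp
  finally have "r - t \<le> t + D" by (simp only: D_def)
  then show False using D t3 by linarith
qed

text \<open>This passes to the limit from approximating points of the open half disc. The radius
  \<open>\<rho>0 / 2\<close> keeps the sum of two radii below \<open>\<rho>0\<close>, as the chart
  requires.\<close>

lemma dB_E_bar_eq:
  assumes v0: "Re v0 = 0" and v: "0 \<le> Re v" "cmod (v - v0) < \<rho>0 / 2" "0 \<le> Re v'" "cmod (v' - v0) < \<rho>0 / 2"
  shows "dB (E_bar v) (E_bar v') = cmod (v - v')"
proof -
  interpret ch: pullback_chart S f annulus_dist "E ` half_disc v0 \<rho>0" "\<lambda>x. cmod (F v0 x - v0)" "\<lambda>x y. cmod (F v0 x - F v0 y)" \<rho>0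
    by (rule half_disc_pullback_chart[OF v0])
  have vs: "v \<in> closed_strip" "v' \<in> closed_strip" using v \<rho>0_pos by (auto intro!: half_disc_in_strip[OF v0])
  have ev: "eventually (\<lambda>i. approx u i \<in> half_disc v0 \<rho>0 \<and> cmod (approx u i - v0) < \<rho>0 / 2) sequentially"
    if u: "u \<in> closed_strip" "cmod (u - v0) < \<rho>0 / 2" for u
  proof -
    have "(\<lambda>i. cmod (approx u i - v0)) \<longlonglongrightarrow> cmod (u - v0)" by (intro tendsto_intros approx_tendsto u)
    then have "eventually (\<lambda>i. cmod (approx u i - v0) < \<rho>0 / 2) sequentially" using u by (intro order_tendstoD)
    then show ?thesis
      using approx_in_strip[OF u(1)] \<rho>0_pos by (auto elim!: eventually_mono simp: half_disc_def strip_def)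
  qed
  have "eventually (\<lambda>i. dS (E (approx v i)) (E (approx v' i)) = cmod (approx v i - approx v' i)) sequentially"
    using ev[OF vs(1) v(2)] ev[OF vs(2) v(4)]
  proof eventually_elim
    case (elim i)
    moreover have "cmod (approx v i - v0) < \<rho>0" using elim by (simp add: half_disc_def)
    ultimately show ?case using ch.pullback_dist_chart[of "E (approx v i)" "E (approx v' i)"]
      by (simp add: F_E[OF v0] dS_eq)
  qed
  moreover have "(\<lambda>i. cmod (approx v i - approx v' i)) \<longlonglongrightarrow> cmod (v - v')"
    by (intro tendsto_intros approx_tendsto vs)
  ultimately have "(\<lambda>i. dS (E (approx v i)) (E (approx v' i))) \<longlonglongrightarrow> cmod (v - v')"
    by (simp add: tendsto_cong)
  then show ?thesis using dB_E_bar_lim[OF vs] LIMSEQ_unique by blast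
qed

lemma boundary_ball_model:
  assumes v0: "Re v0 = 0"
  shows "MB.mball (E_bar v0) (\<rho>0 / 2) = E_bar ` {v. 0 \<le> Re v \<and> cmod (v - v0) < \<rho>0 / 2}"
proof -
  define Q where "Q = {v. 0 \<le> Re v \<and> cmod (v - v0) < \<rho>0 / 2}"
  have Qs: "Q \<subseteq> closed_strip" using \<rho>0_pos by (auto simp: Q_def intro!: half_disc_in_strip[OF v0])
  have v0Q: "v0 \<in> Q" using v0 \<rho>0_pos by (simp add: Q_def)
  have "MB.mball (E_bar v0) (\<rho>0 / 2) = E_bar ` {v \<in> Q. cmod (v - v0) < \<rho>0 / 2}"
  proof (rule mball_eq_model_image)
    show "E_bar v0 \<in> B" using v0Q Qs by (auto intro: E_bar_in)
    show "E_bar v \<in> B" if "v \<in> Q" for v using that Qs by (auto intro: E_bar_in)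
    show "dB (E_bar v0) (E_bar v) = cmod (v - v0)" if "v \<in> Q" for v
      using dB_E_bar_eq[OF v0, of v0 v] that v0 \<rho>0_pos by (simp add: Q_def norm_minus_commute)
    show "i_B p y \<in> E_bar ` Q" if y: "y \<in> S" "dB (E_bar v0) (i_B p y) < \<rho>0 / 2" for y
    proof -
      have "\<rho>0 / 2 < \<rho>0" using \<rho>0_pos by simp
      then obtain v where v: "v \<in> half_disc v0 (\<rho>0 / 2)" "y = E v"
        using i_B_near_boundary[OF v0 y] by auto
      then have "v \<in> half_disc v0 \<rho>0" using \<rho>0_pos by (auto simp: half_disc_def)
      then have "v \<in> strip" using half_disc_subset[OF v0] by auto
      then show ?thesis using v by (intro image_eqI[of _ _ v]) (auto simp: E_bar_eq_i_B Q_def half_disc_def)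
    qed
    show "compactin MB.mtopology (E_bar ` {v \<in> Q. cmod (v - v0) \<le> s})" if s: "s < \<rho>0 / 2" for s
    proof -
      have "{v \<in> Q. cmod (v - v0) \<le> s} = {v. 0 \<le> Re v} \<inter> cball v0 s"
        using s by (auto simp: Q_def dist_norm norm_minus_commute)
      then have "compact {v \<in> Q. cmod (v - v0) \<le> s}"
        by (simp add: closed_Int_compact closed_halfspace_Re_ge)
      then have "compactin (top_of_set closed_strip) {v \<in> Q. cmod (v - v0) \<le> s}"
        using Qs by (auto simp: compactin_subtopology)
      then show ?thesis by (rule image_compactin[OF _ continuous_E_bar])
    qed
  qed
  also have "{v \<in> Q. cmod (v - v0) < \<rho>0 / 2} = Q" by (auto simp: Q_def)
  finally show ?thesis by (simp add: Q_def)
qed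

text \<open>A point of \<open>S\<close> with this image would be \<open>E v\<close> for some
  \<open>v\<close> near \<open>v0\<close> with \<open>Re v > 0\<close>, and the point of the
  completion would have the positive distance \<open>cmod (v0 - v)\<close> from itself.\<close>

lemma E_bar_not_i_B:
  assumes v0: "Re v0 = 0" and y: "y \<in> S" shows "E_bar v0 \<noteq> i_B p y"
proof
  assume e: "E_bar v0 = i_B p y"
  have d: "dB (E_bar v0) (i_B p y) < \<rho>0 / 2"
    using \<rho>0_pos MB.mdist_zero[OF i_B_in[OF y]] by (simp add: e)
  have "\<rho>0 / 2 < \<rho>0" using \<rho>0_pos by simp
  then obtain v where v: "v \<in> half_disc v0 (\<rho>0 / 2)" "y = E v"
    using i_B_near_boundary[OF v0 y d] by auto
  then have "v \<in> half_disc v0 \<rho>0" using \<rho>0_pos by (auto simp: half_disc_def)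
  then have "v \<in> strip" using half_disc_subset[OF v0] by auto
  then have "E_bar v = i_B p y" using v(2) by (simp add: E_bar_eq_i_B)
  then have "dB (E_bar v0) (E_bar v) = 0" unfolding e using i_B_in[OF y] by simp
  moreover have "dB (E_bar v0) (E_bar v) = cmod (v0 - v)"
    using dB_E_bar_eq[OF v0, of v0 v] v v0 \<rho>0_pos by (simp add: half_disc_def)
  ultimately have "v0 = v" by simp
  then show False using v v0 by (auto simp: half_disc_def)
qed

text \<open>The collar \<open>R / 3 < cmod w < R\<close> is stretched to the whole punctured disc, and its inner
  boundary circle is sent to the boundary circle of the completion.\<close>

definition stretch :: "real \<Rightarrow> real" where "stretch t = min t (2 * (t - R / 3))"
definition collar :: "complex set" where "collar = {w. R / 3 \<le> cmod w \<and> cmod w < R}"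
definition G :: "complex \<Rightarrow> (nat \<Rightarrow> complex) set" where
  "G w = E_bar (Complex (collar_height k (stretch (cmod w))) (k * Arg w))"

lemma stretch_bounds: "R / 3 \<le> t \<Longrightarrow> t < R \<Longrightarrow> 0 \<le> stretch t \<and> stretch t < R"
  using R_pos by (auto simp: stretch_def)

lemma stretch_pos: "R / 3 < t \<Longrightarrow> 0 < stretch t"
  using R_pos by (auto simp: stretch_def)

lemma collar_height_in: "0 \<le> r \<Longrightarrow> r < R \<Longrightarrow> Complex (collar_height k r) y \<in> closed_strip"
  using collar_height_bounds[of k r] collar_height_strict_mono[OF k_pos, of r R] by (simp add: closed_strip_def \<delta>_def)

lemma W_collar: fixes a :: real shows "0 \<le> r \<Longrightarrow> W (Complex (collar_height k r) (k * a)) = of_real r * cis a"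
  using k_pos by (simp add: W_def collar_radius_height)

lemma E_bar_collar:
  fixes a :: real
  assumes "0 < r" "r < R"
  shows "E_bar (Complex (collar_height k r) (k * a)) = i_B p (h (of_real r * cis a))"
proof -
  have "Complex (collar_height k r) (k * a) \<in> strip"
    using assms collar_height_strict_mono[OF k_pos, of 0 r] collar_height_strict_mono[OF k_pos, of r R] k_pos
    by (simp add: strip_def \<delta>_def)
  then show ?thesis using W_collar[of r a] assms by (simp add: E_bar_eq_i_B E_def)
qed

lemma G_interior:
  assumes "R / 3 < cmod w" "cmod w < R" shows "G w = i_B p (h (of_real (stretch (cmod w)) * sgn w))"
proof -
  have "w \<noteq> 0" using assms R_pos by auto
  then show ?thesis
    using assms stretch_bounds[of "cmod w"] stretch_pos[of "cmod w"]
      E_bar_collar[of "stretch (cmod w)" "Arg w"]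
    by (simp add: G_def sgn_complex_cis_Arg)
qed

lemma G_outer:
  assumes "2 * R / 3 \<le> cmod w" "cmod w < R" shows "G w = i_B p (h w)"
proof -
  have "R / 3 < cmod w" using assms R_pos by linarith
  moreover have "stretch (cmod w) = cmod w" using assms by (simp add: stretch_def)
  ultimately show ?thesis using G_interior assms by (simp add: sgn_eq)
qed

lemma G_boundary:
  assumes "cmod w = R / 3" shows "G w = E_bar (Complex 0 (k * Arg w))"
proof -
  have "stretch (cmod w) = 0" unfolding assms using R_pos by (simp add: stretch_def)
  then show ?thesis using k_pos by (simp add: G_def)
qed

text \<open>\<open>Arg\<close> jumps across the negative axis, but by periodicity of
  \<open>E_bar\<close> the second angle may be replaced by \<open>Arg w - Arg (w / w')\<close>,
  which is close to the first when \<open>w\<close> and \<open>w'\<close> are. This makes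
  \<open>G\<close> continuous across the cut.\<close>

lemma E_bar_polar_dist:
  assumes "0 \<le> s" "s < \<delta>" "0 \<le> s'" "s' < \<delta>" "w \<noteq> 0" "w' \<noteq> 0"
  shows "dB (E_bar (Complex s (k * Arg w))) (E_bar (Complex s' (k * Arg w'))) \<le> \<bar>s - s'\<bar> + k * \<bar>Arg (w / w')\<bar>"
proof -
  have "cis (Arg w') = cis (Arg w - Arg (w / w'))"
  proof -
    have "sgn (w / w') * sgn w' = sgn w" unfolding sgn_mult[symmetric] using assms(5,6) by simp
    then have "cis (Arg (w / w')) * cis (Arg w') = cis (Arg w)"
      using assms(5,6) by (simp only: cis_Arg[of "w / w'"] cis_Arg[of w] cis_Arg[of w'] divide_eq_0_iff simp_thms)
    then show ?thesis by (simp add: cis_divide[symmetric] field_simps)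
  qed
  then have e: "E_bar (Complex s' (k * Arg w')) = E_bar (Complex s' (k * (Arg w - Arg (w / w'))))"
    using k_pos by (intro E_bar_cong) simp
  have "dB (E_bar (Complex s (k * Arg w))) (E_bar (Complex s' (k * Arg w')))
    \<le> cmod (Complex s (k * Arg w) - Complex s' (k * (Arg w - Arg (w / w'))))"
    unfolding e using assms by (intro dB_E_bar_le) (simp_all add: closed_strip_def)
  also have "\<dots> \<le> \<bar>s - s'\<bar> + \<bar>k * Arg (w / w')\<bar>"
    using cmod_le[of "Complex s (k * Arg w) - Complex s' (k * (Arg w - Arg (w / w')))"]
    by (simp add: right_diff_distrib)
  finally show ?thesis by (simp add: abs_mult)
qed

lemma G_in: "w \<in> collar \<Longrightarrow> G w \<in> B"
  unfolding G_def using stretch_bounds by (intro E_bar_in collar_height_in) (auto simp: collar_def)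

lemma continuous_G: "continuous_map (top_of_set collar) MB.mtopology G"
  unfolding MB.continuous_map_to_metric
proof (intro ballI allI impI)
  fix w0 and e :: real assume "w0 \<in> topspace (top_of_set collar)" and e: "e > 0"
  then have w0: "w0 \<in> collar" by simp
  then have w00: "w0 \<noteq> 0" using R_pos by (auto simp: collar_def)
  define q where "q w = \<bar>collar_height k (stretch (cmod w0)) - collar_height k (stretch (cmod w))\<bar> + k * \<bar>Arg (w0 / w)\<bar>" for w
  have "isCont (\<lambda>w. Arg (w0 / w)) w0"
    using w00 by (intro isCont_o2[OF _ continuous_at_Arg] continuous_intros) auto
  moreover have "isCont (\<lambda>w. collar_height k (stretch (cmod w))) w0"
  proof (rule isCont_o2[where g = "collar_height k"])
    show "isCont (\<lambda>w. stretch (cmod w)) w0" unfolding stretch_def by (intro continuous_intros)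
    show "isCont (collar_height k) (stretch (cmod w0))"
      using continuous_collar_height[of UNIV k] by (simp add: continuous_on_eq_continuous_at)
  qed
  ultimately have "isCont q w0" unfolding q_def by (intro continuous_intros)
  moreover have "q w0 = 0" using w00 by (simp add: q_def)
  ultimately obtain \<eta> where \<eta>: "\<eta> > 0" "\<And>w. dist w w0 < \<eta> \<Longrightarrow> dist (q w) 0 < e"
    using e unfolding continuous_at_eps_delta by metis
  have "G w \<in> MB.mball (G w0) e" if w: "w \<in> collar \<inter> ball w0 \<eta>" for w
  proof -
    have "w \<noteq> 0" using w R_pos by (auto simp: collar_def)
    have st: "0 \<le> collar_height k (stretch (cmod u)) \<and> collar_height k (stretch (cmod u)) < \<delta>" if "u \<in> collar" for u
      using collar_height_in[of "stretch (cmod u)" 0] stretch_bounds[of "cmod u"] that by (auto simp: collar_def closed_strip_def)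
    have "dB (G w0) (G w) \<le> q w"
      unfolding G_def q_def using st[OF w0] st[of w] w w00 \<open>w \<noteq> 0\<close> by (intro E_bar_polar_dist) auto
    also have "\<dots> < e" using \<eta>(2)[of w] w by (auto simp: dist_commute)
    finally show ?thesis using G_in w w0 by auto
  qed
  then show "\<exists>U. openin (top_of_set collar) U \<and> w0 \<in> U \<and> (\<forall>y\<in>U. G y \<in> MB.mball (G w0) e)"
    using w0 \<eta>(1) by (intro exI[of _ "collar \<inter> ball w0 \<eta>"]) auto
qed

text \<open>Interior points arbitrarily close to a boundary point determine both its end and its angle.\<close>

lemma boundary_point_near:
  assumes v0: "Re v0 = 0" and x: "x \<in> B" "E_bar v0 = x" and t: "0 < t" "t < \<rho>0"
    and y: "y \<in> S" "dB x (i_B p y) < t"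
  obtains w where "w \<in> ball 0 R" "w \<noteq> 0" "stereo y = H w" "cmod (sgn w - cis (Im v0 / k)) \<le> t"
proof -
  obtain v where v: "v \<in> half_disc v0 t" "y = E v" using i_B_near_boundary[OF v0 y(1)] y(2) x t by auto
  then have "v \<in> half_disc v0 \<rho>0" using t by (auto simp: half_disc_def)
  then have vs: "v \<in> strip" using half_disc_subset[OF v0] by auto
  have r: "0 < collar_radius k (Re v)" using vs collar_radius_pos_iff[OF k_pos, of "Re v"] \<delta>_less by (simp add: strip_def)
  have "sgn (W v) = cis (Im v / k)" using r by (simp add: W_def sgn_mult sgn_of_real)
  moreover have "cmod (cis (Im v / k) - cis (Im v0 / k)) \<le> \<bar>Im v / k - Im v0 / k\<bar>"
  proof -
    have "cmod (cis a - cis b) \<le> \<bar>a - b\<bar>" for a b :: real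
    proof -
      have "(cmod (cis a - cis b))\<^sup>2 = 2 - 2 * cos (a - b)" using cmod_cis_diff_sq[of 1 a 1 b] by simp
      also have "\<dots> = 4 * (sin ((a - b) / 2))\<^sup>2"
      proof -
        have "2 * ((a - b) / 2) = a - b" by simp
        then have "cos (a - b) = 1 - 2 * (sin ((a - b) / 2))\<^sup>2" using cos_double_sin[of "(a - b) / 2"] by argo
        then show ?thesis by simp
      qed
      also have "\<dots> \<le> 4 * ((a - b) / 2)\<^sup>2" 
        by (intro mult_left_mono abs_le_square_iff[THEN iffD1] abs_sin_x_le_abs_x) simp
      also have "\<dots> = \<bar>a - b\<bar>\<^sup>2" by (simp add: power_divide)
      finally show ?thesis by (rule power2_le_imp_le) simp
    qed
    then show ?thesis .
  qed
  moreover have "\<bar>Im v / k - Im v0 / k\<bar> \<le> \<bar>Im (v - v0)\<bar>"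
    using k_pos by (simp add: diff_divide_distrib[symmetric] abs_divide divide_le_eq mult_le_cancel_left1)
  moreover have "\<bar>Im (v - v0)\<bar> \<le> t" using abs_Im_le_cmod[of "v - v0"] v by (simp add: half_disc_def)
  ultimately show ?thesis using that[of "W v"] W_props[OF vs] stereo_E[OF vs] v by auto
qed

end

section \<open>Local geometry of the completion\<close>

lemma isometric_sets_if_parametrised:
  fixes V :: "'a::metric_space set"
  assumes "\<Phi> ` V = U" "\<And>u v. u \<in> V \<Longrightarrow> v \<in> V \<Longrightarrow> d (\<Phi> u) (\<Phi> v) = dist u v"
  shows "isometric_sets U d V dist"
proof -
  have inj: "inj_on \<Phi> V"
  proof (rule inj_onI)
    fix u v assume *: "u \<in> V" "v \<in> V" "\<Phi> u = \<Phi> v"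
    have "dist u v = d (\<Phi> u) (\<Phi> v)" using assms(2)[OF *(1,2)] by simp
    also have "\<dots> = dist u u" unfolding *(3)[symmetric] using assms(2)[of u u] *(1) by simp
    finally show "u = v" by simp
  qed
  then have "bij_betw (inv_into V \<Phi>) U V" using assms(1) by (intro bij_betw_inv_into) (simp add: bij_betw_def)
  moreover have "dist (inv_into V \<Phi> x) (inv_into V \<Phi> y) = d x y" if "x \<in> U" "y \<in> U" for x y
    using that assms inj by (auto simp: inv_into_f_f)
  ultimately show ?thesis unfolding isometric_sets_def by blast
qed

lemma closure_image_ball:
  fixes H :: "complex \<Rightarrow> 'a::euclidean_space"
  assumes "continuous_on (cball 0 e) H" "0 < e"
  shows "closure (H ` ball 0 e) = H ` cball 0 e"
proof (rule antisym)
  have "compact (H ` cball 0 e)" by (rule compact_continuous_image[OF assms(1)]) simp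
  then show "closure (H ` ball 0 e) \<subseteq> H ` cball 0 e"
    by (intro closure_minimal image_mono ball_subset_cball compact_imp_closed)
  have "closure (ball 0 e) = cball (0::complex) e" using assms(2) by simp
  then show "H ` cball 0 e \<subseteq> closure (H ` ball 0 e)"
    using image_closure_subset[OF _ closed_closure closure_subset, of "ball 0 e" H] assms(1) by simp
qed

context poly_end
begin

lemma E_bar_in_B: assumes v0: "Re v0 = 0" shows "E_bar v0 \<in> B"
  using half_disc_in_strip[OF v0, of v0] v0 \<rho>0_pos by (intro E_bar_in) simp

text \<open>The inverse of a plane chart around this point, followed by the isometry onto the half
  disc, would be a continuous injection on an open plane set. By invariance of domain its image is
  open, yet it contains \<open>v0\<close> and lies in the closed right half-plane.\<close>

lemma E_bar_in_surface_boundary: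
  assumes v0: "Re v0 = 0"
  shows "E_bar v0 \<in> surface_boundary MB.mtopology"
proof -
  define r where "r = \<rho>0 / 2"
  have r: "r > 0" using \<rho>0_pos by (simp add: r_def)
  define Q where "Q = {v. 0 \<le> Re v \<and> cmod (v - v0) < r}"
  have ball: "MB.mball (E_bar v0) r = E_bar ` Q"
    using boundary_ball_model[OF v0] by (simp add: Q_def r_def)
  have iso: "dB (E_bar u) (E_bar v) = dist u v" if "u \<in> Q" "v \<in> Q" for u v
    using dB_E_bar_eq[OF v0, of u v] that by (simp add: Q_def r_def dist_norm)
  have v0Q: "v0 \<in> Q" using v0 r by (simp add: Q_def)
  have inj: "inj_on E_bar Q"
  proof (rule inj_onI)
    fix u v assume *: "u \<in> Q" "v \<in> Q" "E_bar u = E_bar v"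
    then show "u = v" using iso[of u v] iso[of u u] by simp
  qed
  define \<phi> where "\<phi> = inv_into Q E_bar"
  have \<phi>: "\<phi> (E_bar v) = v" if "v \<in> Q" for v using inj that by (simp add: \<phi>_def)
  have \<phi>Q: "\<phi> x \<in> Q" "E_bar (\<phi> x) = x" if "x \<in> MB.mball (E_bar v0) r" for x
    using that \<phi> unfolding ball by auto
  have "E_bar v0 \<notin> surface_interior MB.mtopology"
  proof
    assume "E_bar v0 \<in> surface_interior MB.mtopology"
    then obtain U and V :: "complex set" where UV: "openin MB.mtopology U" "E_bar v0 \<in> U" "open V"
      "subtopology MB.mtopology U homeomorphic_space top_of_set V"
      unfolding surface_interior_def by blast
    then obtain a b where ab: "homeomorphic_maps (subtopology MB.mtopology U) (top_of_set V) a b"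
      unfolding homeomorphic_space_def by blast
    have US: "U \<subseteq> B" using openin_subset[OF UV(1)] by simp
    have "continuous_map (top_of_set V) (subtopology MB.mtopology U) b"
      using ab by (simp add: homeomorphic_maps_def)
    then have bc: "continuous_map (top_of_set V) MB.mtopology b" by (rule continuous_map_into_fulltopology)
    have ba: "\<And>x. x \<in> U \<Longrightarrow> b (a x) = x" and aV: "\<And>x. x \<in> U \<Longrightarrow> a x \<in> V" and ab': "\<And>z. z \<in> V \<Longrightarrow> a (b z) = z"
      using ab US unfolding homeomorphic_maps_def by (auto simp: continuous_map_def Pi_iff)
    define V' where "V' = {z \<in> V. b z \<in> MB.mball (E_bar v0) r}"
    have "openin (top_of_set V) {z \<in> topspace (top_of_set V). b z \<in> MB.mball (E_bar v0) r}"
      by (rule openin_continuous_map_preimage[OF bc MB.openin_mball])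
    then have V': "open V'" using UV(3) by (simp add: V'_def openin_open_eq)
    define g where "g z = \<phi> (b z)" for z
    have "continuous_on V' g"
      unfolding continuous_on_iff
    proof (intro ballI allI impI)
      fix z and e :: real assume z: "z \<in> V'" and e: "e > 0"
      have "z \<in> topspace (top_of_set V)" using z by (simp add: V'_def)
      then obtain W where W: "openin (top_of_set V) W" "z \<in> W" "\<forall>y\<in>W. b y \<in> MB.mball (b z) e"
        using bc[unfolded MB.continuous_map_to_metric] e by meson
      then have "open W" using UV(3) by (simp add: openin_open_eq)
      then obtain \<eta> where \<eta>: "\<eta> > 0" "ball z \<eta> \<subseteq> W" using W(2) open_contains_ball by blast
      show "\<exists>\<eta>>0. \<forall>x'\<in>V'. dist x' z < \<eta> \<longrightarrow> dist (g x') (g z) < e"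
      proof (intro exI[of _ \<eta>] conjI ballI impI \<eta>(1))
        fix x' assume x': "x' \<in> V'" "dist x' z < \<eta>"
        then have "dB (b z) (b x') < e" using W(3) \<eta>(2) by (auto simp: dist_commute subset_iff)
        moreover have "dB (b z) (b x') = dist (g z) (g x')"
        proof -
          have m: "b z \<in> MB.mball (E_bar v0) r" "b x' \<in> MB.mball (E_bar v0) r" using x'(1) z by (simp_all only: V'_def mem_Collect_eq)
          show ?thesis
            using iso[OF \<phi>Q(1)[OF m(1)] \<phi>Q(1)[OF m(2)]] unfolding \<phi>Q(2)[OF m(1)] \<phi>Q(2)[OF m(2)] g_def .
        qed
        ultimately show "dist (g x') (g z) < e" by (metis dist_commute)
      qed
    qed
    moreover have "inj_on g V'"
    proof (rule inj_onI)
      fix z z' assume *: "z \<in> V'" "z' \<in> V'" "g z = g z'"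
      then have m: "b z \<in> MB.mball (E_bar v0) r" "b z' \<in> MB.mball (E_bar v0) r" by (simp_all only: V'_def mem_Collect_eq)
      have "b z = b z'" using \<phi>Q(2)[OF m(1)] \<phi>Q(2)[OF m(2)] *(3) by (metis g_def)
      then show "z = z'" using ab'[of z] ab'[of z'] *(1,2) unfolding V'_def by (metis (no_types, lifting) mem_Collect_eq)
    qed
    ultimately have "open (g ` V')" using V' by (intro invariance_of_domain)
    moreover have "v0 \<in> g ` V'"
    proof (rule image_eqI[of _ _ "a (E_bar v0)"])
      have "b (a (E_bar v0)) = E_bar v0" by (rule ba[OF UV(2)])
      then show "v0 = g (a (E_bar v0))" "a (E_bar v0) \<in> V'"
        using \<phi>[OF v0Q] aV[OF UV(2)] E_bar_in_B[OF v0] r by (simp_all add: g_def V'_def)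
    qed
    ultimately obtain s where s: "s > 0" "ball v0 s \<subseteq> g ` V'" using open_contains_ball by blast
    have "v0 - of_real (s / 2) \<in> ball v0 s" using s(1) by (simp add: dist_norm)
    then obtain z where z: "z \<in> V'" "v0 - of_real (s / 2) = g z" using s(2) by blast
    have "g z \<in> Q" using \<phi>Q(1)[of "b z"] z(1) unfolding g_def V'_def by blast
    then have "0 \<le> Re (v0 - of_real (s / 2))" using z(2) by (simp add: Q_def)
    then show False using v0 s(1) by simp
  qed
  then show ?thesis using E_bar_in_B[OF v0] by (simp add: surface_boundary_def)
qed

lemma boundary_locally_Euclidean:
  assumes v0: "Re v0 = 0"
  shows "locally_Euclidean_at B dB (E_bar v0)"
proof -
  define r where "r = \<rho>0 / 2"
  have r: "r > 0" using \<rho>0_pos by (simp add: r_def)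
  \<comment> \<open>The definition asks for the upper half-plane; multiplication by
    \<open>\<i>\<close> rotates the right half-plane onto it.\<close>
  define V where "V = {z. Im z \<ge> 0} \<inter> ball (\<i> * v0) r"
  define \<Phi> where "\<Phi> z = E_bar (- \<i> * z)" for z
  have rot: "(\<lambda>z. - \<i> * z) ` V = {v. 0 \<le> Re v \<and> cmod (v - v0) < r}"
  proof (intro equalityI subsetI)
    fix v assume "v \<in> (\<lambda>z. - \<i> * z) ` V"
    then obtain z where z: "z \<in> V" "v = - \<i> * z" by auto
    have "v - v0 = - \<i> * (z - \<i> * v0)" by (simp add: z(2) algebra_simps)
    then have "cmod (v - v0) = cmod (z - \<i> * v0)" by (simp add: norm_mult)
    then show "v \<in> {v. 0 \<le> Re v \<and> cmod (v - v0) < r}"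
      using z by (simp add: V_def dist_norm norm_minus_commute)
  next
    fix v assume v: "v \<in> {v. 0 \<le> Re v \<and> cmod (v - v0) < r}"
    have "\<i> * v0 - \<i> * v = \<i> * (v0 - v)" by (simp add: algebra_simps)
    then have "cmod (\<i> * v0 - \<i> * v) = cmod (v - v0)" by (simp add: norm_mult norm_minus_commute)
    then show "v \<in> (\<lambda>z. - \<i> * z) ` V"
      using v by (intro image_eqI[of _ _ "\<i> * v"]) (auto simp: V_def dist_norm mult.assoc[symmetric])
  qed
  have "isometric_sets (MB.mball (E_bar v0) r) dB V dist"
  proof (rule isometric_sets_if_parametrised)
    have "\<Phi> ` V = E_bar ` (\<lambda>z. - \<i> * z) ` V" by (simp add: \<Phi>_def image_image)
    then show "\<Phi> ` V = MB.mball (E_bar v0) r" unfolding rot r_def boundary_ball_model[OF v0] .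
    fix u v assume uv: "u \<in> V" "v \<in> V"
    have "- \<i> * u \<in> {v. 0 \<le> Re v \<and> cmod (v - v0) < r}" "- \<i> * v \<in> {v. 0 \<le> Re v \<and> cmod (v - v0) < r}"
      unfolding rot[symmetric] using uv by auto
    then have "dB (\<Phi> u) (\<Phi> v) = cmod (- \<i> * u - - \<i> * v)"
      unfolding \<Phi>_def r_def using dB_E_bar_eq[OF v0] by blast
    also have "- \<i> * u - - \<i> * v = - \<i> * (u - v)" by (simp add: algebra_simps)
    finally show "dB (\<Phi> u) (\<Phi> v) = dist u v" by (simp add: norm_mult dist_norm)
  qed
  moreover have "openin (top_of_set {z. Im z \<ge> 0}) V" by (simp add: V_def openin_open_Int)
  moreover have "openin MB.mtopology (MB.mball (E_bar v0) r)" "E_bar v0 \<in> MB.mball (E_bar v0) r"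
    using r E_bar_in_B[OF v0] by simp_all
  ultimately show ?thesis unfolding locally_Euclidean_at_def using E_bar_in_surface_boundary[OF v0] by blast
qed

lemma boundary_locally_CAT0:
  assumes v0: "Re v0 = 0"
  shows "\<exists>r>0. CAT0_space (MB.mball (E_bar v0) r) dB"
proof (intro exI[of _ "\<rho>0 / 2"] conjI)
  show "0 < \<rho>0 / 2" using \<rho>0_pos by simp
  interpret M: Metric_space "MB.mball (E_bar v0) (\<rho>0 / 2)" dB
    by (rule MB.subspace) (rule MB.mball_subset_mspace)
  define Q where "Q = {v. 0 \<le> Re v \<and> cmod (v - v0) < \<rho>0 / 2}"
  have "Q = {v. 0 \<le> Re v} \<inter> ball v0 (\<rho>0 / 2)" by (auto simp: Q_def dist_norm norm_minus_commute)
  then have "convex Q" by (simp add: convex_Int convex_halfspace_Re_ge)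
  then have "Stewart_space Q dist" by (rule Stewart_space_convex)
  then have "Stewart_space (MB.mball (E_bar v0) (\<rho>0 / 2)) dB"
  proof (rule Stewart_space_isometric)
    show "E_bar ` Q = MB.mball (E_bar v0) (\<rho>0 / 2)" using boundary_ball_model[OF v0] by (simp add: Q_def)
    show "dB (E_bar u) (E_bar v) = dist u v" if "u \<in> Q" "v \<in> Q" for u v
      using dB_E_bar_eq[OF v0, of u v] that by (simp add: Q_def dist_norm)
  qed
  then show "CAT0_space (MB.mball (E_bar v0) (\<rho>0 / 2)) dB" by (rule M.CAT0_space_if_Stewart)
qed

end

context separable_poly
begin

lemma interior_locally_CAT0:
  assumes b: "b \<in> S" shows "\<exists>r>0. CAT0_space (MB.mball (i_B p b) r) dB"
proof -
  obtain k r \<Phi> where *: "0 < k" "0 < r" "MB.mball (i_B p b) r = \<Phi> ` ball 0 r"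
    "\<And>u v. u \<in> ball 0 r \<Longrightarrow> v \<in> ball 0 r \<Longrightarrow> dB (\<Phi> u) (\<Phi> v) = cone_dist k u v"
    using interior_ball_model[OF b] by metis
  interpret M: Metric_space "MB.mball (i_B p b) r" dB
    by (rule MB.subspace) (rule MB.mball_subset_mspace)
  have "Stewart_space (MB.mball (i_B p b) r) dB"
    by (rule Stewart_space_isometric[OF Stewart_space_cone[OF *(1)] *(3)[symmetric] *(4)])
  then show ?thesis using *(2) M.CAT0_space_if_Stewart by blast
qed

lemma interior_locally_Euclidean:
  assumes b: "b \<in> S" "b \<notin> cpt p" shows "locally_Euclidean_at B dB (i_B p b)"
proof -
  obtain k r \<Phi> where *: "0 < r" "k = 1" "MB.mball (i_B p b) r = \<Phi> ` ball 0 r"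
    "\<And>u v. u \<in> ball 0 r \<Longrightarrow> v \<in> ball 0 r \<Longrightarrow> dB (\<Phi> u) (\<Phi> v) = cone_dist k u v"
    using interior_ball_model[OF b(1)] b(2) by metis
  have "isometric_sets (MB.mball (i_B p b) r) dB (ball (0::complex) r) dist"
  proof (rule isometric_sets_if_parametrised[OF *(3)[symmetric]])
    show "dB (\<Phi> u) (\<Phi> v) = dist u v" if "u \<in> ball 0 r" "v \<in> ball 0 r" for u v
      using *(4)[OF that] unfolding *(2) cone_dist_1 .
  qed
  moreover have "openin MB.mtopology (MB.mball (i_B p b) r)" "i_B p b \<in> MB.mball (i_B p b) r" "open (ball (0::complex) r)"
    using *(1) i_B_in[OF b(1)] by simp_all
  ultimately show ?thesis unfolding locally_Euclidean_at_def by blast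
qed

text \<open>All roots are simple, so no critical point is among the removed points.\<close>

lemma cpt_subset: "cpt p \<subseteq> S"
  using simple_root by (auto simp: cpt_def rts_def)

lemma finite_cpt: "finite (cpt p)"
proof -
  have "pderiv p \<noteq> 0" using degree_pos by (auto simp: pderiv_eq_0_iff)
  then show ?thesis unfolding cpt_def by (rule poly_roots_finite)
qed

end

subsection \<open>The homeomorphism with a sphere minus disks\<close>

locale poly_ends = separable_poly p for p :: "complex poly" +
  fixes H :: "nat \<Rightarrow> complex \<Rightarrow> real^3" and h :: "nat \<Rightarrow> complex \<Rightarrow> complex" and n :: "nat \<Rightarrow> int" and e :: real
  assumes e_pos: "0 < e" and ends: "\<And>j. j \<le> degree p \<Longrightarrow> is_end (H j) (h j) (n j) (3 * e)"
    and ends_disjoint: "\<And>i j. i \<le> degree p \<Longrightarrow> j \<le> degree p \<Longrightarrow> i \<noteq> j \<Longrightarrow>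
      H i ` ball 0 (3 * e) \<inter> H j ` ball 0 (3 * e) = {}"
    and punctures: "sphere 0 1 - stereo ` S = (\<lambda>j. H j 0) ` {..degree p}"
begin

abbreviation d :: nat where "d \<equiv> degree p"

lemma poly_end: "j \<le> d \<Longrightarrow> poly_end p (H j) (h j) (n j) (3 * e)"
  using ends punctures by (intro poly_end.intro separable_poly_axioms poly_end_axioms.intro) auto

abbreviation "kk j \<equiv> poly_end.k (n j)"
abbreviation "EE j \<equiv> poly_end.E_bar p (h j) (n j) (3 * e)"
abbreviation "GG j \<equiv> poly_end.G p (h j) (n j) (3 * e)"
abbreviation "stretched \<equiv> poly_end.stretch (3 * e)"

lemma stretched_eq: "stretched t = min t (2 * (t - e))"
  using poly_end.stretch_def[OF poly_end[of 0]] by simp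

definition K :: "(real^3) set" where "K = sphere 0 1 - (\<Union>j\<le>d. H j ` ball 0 e)"
definition A :: "complex set" where "A = {w. e \<le> cmod w \<and> cmod w < 3 * e}"
text \<open>Only closed discs of radius \<open>2 * e\<close> are removed, so \<open>core\<close>
  overlaps each collar where \<open>2 * e < cmod w\<close>; there \<open>G\<close> is the plain
  inclusion, and the two formulas for the map agree.\<close>

definition core :: "(real^3) set" where "core = K - (\<Union>j\<le>d. H j ` cball 0 (2 * e))"

lemma collar_eq: "j \<le> d \<Longrightarrow> poly_end.collar (3 * e) = A"
  using poly_end.collar_def[OF poly_end] by (simp add: A_def)

lemma H_props:
  assumes "j \<le> d"
  shows "continuous_on (ball 0 (3 * e)) (H j)" "inj_on (H j) (ball 0 (3 * e))"
    "\<And>W. open W \<Longrightarrow> W \<subseteq> ball 0 (3 * e) \<Longrightarrow> openin (top_of_set (sphere 0 1)) (H j ` W)"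
    "\<And>w. w \<in> ball 0 (3 * e) \<Longrightarrow> w \<noteq> 0 \<Longrightarrow> h j w \<in> S"
    "\<And>w. w \<in> ball 0 (3 * e) \<Longrightarrow> w \<noteq> 0 \<Longrightarrow> H j w = stereo (h j w)"
  using ends[OF assms] unfolding is_end_def by auto

lemma H_eq_iff:
  assumes "i \<le> d" "j \<le> d" "w \<in> ball 0 (3 * e)" "w' \<in> ball 0 (3 * e)"
  shows "H i w = H j w' \<longleftrightarrow> i = j \<and> w = w'"
proof
  assume eq: "H i w = H j w'"
  have "i = j"
  proof (rule ccontr)
    assume "i \<noteq> j"
    then show False using ends_disjoint[OF assms(1,2)] eq assms(3,4) by (metis IntI empty_iff imageI)
  qed
  then show "i = j \<and> w = w'" using inj_onD[OF H_props(2)[OF assms(2)]] eq assms by auto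
qed auto

lemma H_in_sphere: "j \<le> d \<Longrightarrow> w \<in> ball 0 (3 * e) \<Longrightarrow> H j w \<in> sphere 0 1"
  using H_props(3)[of j "ball 0 (3 * e)"] openin_imp_subset by fastforce

lemma H_in_K_iff:
  assumes "j \<le> d" "w \<in> ball 0 (3 * e)" shows "H j w \<in> K \<longleftrightarrow> e \<le> cmod w"
proof -
  have "H j w \<in> H i ` ball 0 e \<longleftrightarrow> i = j \<and> cmod w < e" if "i \<le> d" for i
  proof
    assume "H j w \<in> H i ` ball 0 e"
    then obtain w' where "w' \<in> ball 0 e" "H j w = H i w'" by auto
    then show "i = j \<and> cmod w < e" using H_eq_iff[OF assms(1) that assms(2), of w'] e_pos by auto
  qed auto
  then show ?thesis using H_in_sphere[OF assms] assms(1) by (auto simp: K_def not_less)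
qed

lemma not_in_ends:
  assumes "y \<in> sphere 0 1" "\<And>j. j \<le> d \<Longrightarrow> y \<noteq> H j 0"
  shows "y \<in> stereo ` S" "stereo_inv y \<in> S" "stereo (stereo_inv y) = y"
proof -
  show y: "y \<in> stereo ` S"
  proof (rule ccontr)
    assume "y \<notin> stereo ` S"
    then have "y \<in> (\<lambda>j. H j 0) ` {..d}" unfolding punctures[symmetric] using assms(1) by simp
    then show False using assms(2) by auto
  qed
  then show "stereo_inv y \<in> S" "stereo (stereo_inv y) = y" by auto
qed

lemma K_stereo:
  assumes "y \<in> K" shows "stereo_inv y \<in> S" "stereo (stereo_inv y) = y"
proof -
  have "y \<noteq> H j 0" if "j \<le> d" for j
  proof -
    have "H j 0 \<in> H j ` ball 0 e" using e_pos by simp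
    then show ?thesis using assms that unfolding K_def by blast
  qed
  then show "stereo_inv y \<in> S" "stereo (stereo_inv y) = y" using not_in_ends[of y] assms by (auto simp: K_def)
qed

lemma compact_K: "compact K"
proof -
  have "openin (top_of_set (sphere 0 1)) (\<Union>j\<le>d. H j ` ball 0 e)"
    by (intro openin_clauses(3)) (use e_pos in \<open>auto intro!: H_props(3)\<close>)
  then have "closedin (top_of_set (sphere 0 1)) K"
    unfolding K_def by (intro closedin_diff) auto
  then show ?thesis using closedin_compact compact_sphere by blast
qed

lemma image_A: "j \<le> d \<Longrightarrow> H j ` A = K \<inter> H j ` ball 0 (3 * e)"
  using H_in_K_iff[of j] by (auto simp: A_def)

lemma openin_collar: "j \<le> d \<Longrightarrow> openin (top_of_set K) (H j ` A)"
proof -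
  assume j: "j \<le> d"
  have "openin (top_of_set (sphere 0 1)) (H j ` ball 0 (3 * e))" by (rule H_props(3)[OF j]) auto
  then obtain T where "open T" "H j ` ball 0 (3 * e) = sphere 0 1 \<inter> T" by (auto simp: openin_open)
  moreover have "K \<subseteq> sphere 0 1" by (auto simp: K_def)
  ultimately have "H j ` A = K \<inter> T" using image_A[OF j] by blast
  then show ?thesis using \<open>open T\<close> by (auto simp: openin_open)
qed

lemma openin_core: "openin (top_of_set K) core"
proof -
  have "compact (H j ` cball 0 (2 * e))" if "j \<le> d" for j
    using e_pos by (intro compact_continuous_image continuous_on_subset[OF H_props(1)[OF that]]) auto
  then have "closed (\<Union>j\<le>d. H j ` cball 0 (2 * e))" by (intro closed_UN) (auto intro: compact_imp_closed)
  then have "open (- (\<Union>j\<le>d. H j ` cball 0 (2 * e)))" by (rule open_Compl)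
  then show ?thesis unfolding core_def Diff_eq by (rule openin_open_Int)
qed

lemma continuous_H_inverse:
  assumes j: "j \<le> d"
  shows "continuous_on (H j ` ball 0 (3 * e)) (inv_into (ball 0 (3 * e)) (H j))"
proof (rule continuous_on_inverse_open_map[OF H_props(1)[OF j] refl])
  show "inv_into (ball 0 (3 * e)) (H j) (H j x) = x" if "x \<in> ball 0 (3 * e)" for x
    using that H_props(2)[OF j] by simp
  fix U :: "complex set" assume "openin (top_of_set (ball 0 (3 * e))) U"
  then have U: "open U" "U \<subseteq> ball 0 (3 * e)" by (simp_all add: openin_open_eq)
  then have "openin (top_of_set (sphere 0 1)) (H j ` U)" by (rule H_props(3)[OF j])
  moreover have "H j ` U \<subseteq> H j ` ball 0 (3 * e)" "H j ` ball 0 (3 * e) \<subseteq> sphere 0 1" using U H_in_sphere[OF j] by auto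
  ultimately show "openin (top_of_set (H j ` ball 0 (3 * e))) (H j ` U)"
    by (rule openin_subset_trans)
qed

text \<open>The map is pasted over an open cover of \<open>K\<close>: indices up to \<open>d\<close>
  stand for the collars and \<open>Suc d\<close> for the core. The collars are pairwise disjoint, so
  only a collar and the core have to be compared.\<close>

lemma model_map_exists:
  obtains \<Psi> where "continuous_map (top_of_set K) MB.mtopology \<Psi>"
    "\<And>j w. j \<le> d \<Longrightarrow> w \<in> A \<Longrightarrow> \<Psi> (H j w) = GG j w"
    "\<And>y. y \<in> core \<Longrightarrow> \<Psi> y = i_B p (stereo_inv y)"
proof -
  define T where "T j = (if j \<le> d then H j ` A else core)" for j
  define g where "g j = (if j \<le> d then GG j \<circ> inv_into (ball 0 (3 * e)) (H j) else i_B p \<circ> stereo_inv)" for j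
  have A_ball: "A \<subseteq> ball 0 (3 * e)" by (auto simp: A_def)
  have inv: "inv_into (ball 0 (3 * e)) (H j) (H j w) = w" if "j \<le> d" "w \<in> A" for j w
    using inv_into_f_f[OF H_props(2)[OF that(1)], of w] that A_ball by auto
  have A_nz: "w \<noteq> 0" if "w \<in> A" for w using that e_pos by (auto simp: A_def)
  have TK: "T j \<subseteq> K" for j using image_A by (auto simp: T_def core_def)
  have overlap: "GG j w = i_B p (stereo_inv (H j w))" if jw: "j \<le> d" "w \<in> A" "H j w \<in> core" for j w
  proof -
    have "\<not> cmod w \<le> 2 * e"
    proof
      assume "cmod w \<le> 2 * e"
      then have "H j w \<in> H j ` cball 0 (2 * e)" by auto
      then show False using jw(1,3) unfolding core_def by blast
    qed
    then have "GG j w = i_B p (h j w)"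
      using poly_end.G_outer[OF poly_end[OF jw(1)], of w] jw(2) by (simp add: A_def)
    then show ?thesis using H_props(5)[OF jw(1), of w] A_ball A_nz jw(2) by auto
  qed
  show ?thesis
  proof (rule pasting_lemma_exists[where X = "top_of_set K" and I = "{..Suc d}" and T = T and Y = MB.mtopology and f = g])
    show "topspace (top_of_set K) \<subseteq> \<Union> (T ` {..Suc d})"
    proof
      fix y assume "y \<in> topspace (top_of_set K)"
      then have y: "y \<in> K" by simp
      show "y \<in> \<Union> (T ` {..Suc d})"
      proof (cases "y \<in> core")
        case True
        then show ?thesis by (intro UN_I[of "Suc d"]) (auto simp: T_def)
      next
        case False
        then obtain j where j: "j \<le> d" "y \<in> H j ` cball 0 (2 * e)" using y by (auto simp: core_def)
        then have "y \<in> H j ` ball 0 (3 * e)" using e_pos by auto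
        then show ?thesis using y j image_A[OF j(1)] by (intro UN_I[of j]) (auto simp: T_def)
      qed
    qed
    show "openin (top_of_set K) (T j)" for j using openin_collar openin_core by (simp add: T_def)
    show "continuous_map (subtopology (top_of_set K) (T j)) MB.mtopology (g j)" for j
    proof -
      have sub: "subtopology (top_of_set K) (T j) = top_of_set (T j)"
        using TK[of j] by (simp add: subtopology_subtopology inf.absorb2)
      show ?thesis
      proof (cases "j \<le> d")
        case True
        have "continuous_map (top_of_set (H j ` A)) (top_of_set A) (inv_into (ball 0 (3 * e)) (H j))"
          using continuous_on_subset[OF continuous_H_inverse[OF True] image_mono[OF A_ball]] inv[OF True] by auto
        moreover have "continuous_map (top_of_set A) MB.mtopology (GG j)"
          using poly_end.continuous_G[OF poly_end[OF True]] by (simp add: collar_eq[OF True])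
        ultimately have "continuous_map (top_of_set (H j ` A)) MB.mtopology (GG j \<circ> inv_into (ball 0 (3 * e)) (H j))"
          by (rule continuous_map_compose)
        then show ?thesis unfolding sub using True by (simp add: T_def g_def)
      next
        case False
        have "core \<subseteq> {v. v $ 3 \<noteq> 1}"
        proof
          fix v assume "v \<in> core"
          then have "v \<in> K" by (simp add: core_def)
          then show "v \<in> {v. v $ 3 \<noteq> 1}" using K_stereo(2)[of v] stereo_3_neq_1[of "stereo_inv v"] by simp
        qed
        then have "continuous_on core stereo_inv" by (rule continuous_on_subset[OF continuous_stereo_inv])
        moreover have "stereo_inv v \<in> S" if "v \<in> core" for v using K_stereo(1)[of v] that by (simp add: core_def)
        ultimately have "continuous_map (top_of_set core) (top_of_set S) stereo_inv" by auto
        then have "continuous_map (top_of_set core) MB.mtopology (i_B p \<circ> stereo_inv)"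
          by (rule continuous_map_compose[OF _ continuous_i_B])
        then show ?thesis unfolding sub using False by (simp add: T_def g_def)
      qed
    qed
    show "g i y = g j y" if ij: "i \<in> {..Suc d}" "j \<in> {..Suc d}" and y: "y \<in> topspace (top_of_set K) \<inter> T i \<inter> T j" for i j y
    proof -
      have *: "g i y = g j y" if a: "i \<le> d" "y \<in> T i" "y \<in> T j" for i j
      proof -
        obtain w where w: "w \<in> A" "y = H i w" using a by (auto simp: T_def)
        show ?thesis
        proof (cases "j \<le> d")
          case True
          then obtain w' where w': "w' \<in> A" "y = H j w'" using a by (auto simp: T_def)
          then have "i = j" using H_eq_iff[OF a(1) True subsetD[OF A_ball w(1)] subsetD[OF A_ball w'(1)]] w(2) w'(2) by simp
          then show ?thesis by simp
        next
          case False
          then show ?thesis using overlap[OF a(1) w(1)] a w inv by (simp add: T_def g_def)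
        qed
      qed
      have yT: "y \<in> T i" "y \<in> T j" using y by simp_all
      consider "i \<le> d" | "j \<le> d" | "i = Suc d" "j = Suc d" using ij by fastforce
      then show ?thesis
      proof cases
        case 1 then show ?thesis using yT by (rule *)
      next
        case 2 then show ?thesis using *[OF 2 yT(2,1)] by simp
      qed simp
    qed
    fix \<Psi> assume \<Psi>: "continuous_map (top_of_set K) MB.mtopology \<Psi>"
      "\<And>x i. i \<in> {..Suc d} \<Longrightarrow> x \<in> topspace (top_of_set K) \<inter> T i \<Longrightarrow> \<Psi> x = g i x"
    show thesis
    proof (rule that[OF \<Psi>(1)])
      show "\<Psi> (H j w) = GG j w" if "j \<le> d" "w \<in> A" for j w
        using \<Psi>(2)[of j "H j w"] TK[of j] that inv by (auto simp: T_def g_def)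
      show "\<Psi> y = i_B p (stereo_inv y)" if "y \<in> core" for y
        using \<Psi>(2)[of "Suc d" y] TK[of "Suc d"] that by (auto simp: T_def g_def)
    qed
  qed
qed

definition K_int :: "(real^3) set" where "K_int = sphere 0 1 - (\<Union>j\<le>d. H j ` cball 0 e)"

lemma K_int_subset: "K_int \<subseteq> K"
  by (auto simp: K_def K_int_def)

lemma K_cases:
  assumes "y \<in> K"
  obtains (core) "y \<in> core" | (collar) j w where "j \<le> d" "w \<in> A" "y = H j w"
proof (cases "y \<in> core")
  case False
  then obtain j where j: "j \<le> d" "y \<in> H j ` cball 0 (2 * e)" using assms by (auto simp: core_def)
  then have "y \<in> H j ` ball 0 (3 * e)" using e_pos by auto
  then have "y \<in> H j ` A" using assms image_A[OF j(1)] by simp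
  then show ?thesis using collar[OF j(1)] by auto
qed (rule core)

lemma H_in_K_int_iff:
  assumes "j \<le> d" "w \<in> ball 0 (3 * e)" shows "H j w \<in> K_int \<longleftrightarrow> e < cmod w"
proof -
  have "H j w \<in> H i ` cball 0 e \<longleftrightarrow> i = j \<and> cmod w \<le> e" if "i \<le> d" for i
  proof
    assume "H j w \<in> H i ` cball 0 e"
    then obtain w' where "w' \<in> cball 0 e" "H j w = H i w'" by auto
    then show "i = j \<and> cmod w \<le> e" using H_eq_iff[OF assms(1) that assms(2), of w'] e_pos by auto
  qed auto
  then show ?thesis using H_in_sphere[OF assms] assms(1) by (auto simp: K_int_def not_le)
qed

lemma core_subset_K_int: "core \<subseteq> K_int"
  using e_pos by (fastforce simp: core_def K_def K_int_def)

end

context poly_ends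
begin

context
  fixes \<Psi>
  assumes \<Psi>_cont: "continuous_map (top_of_set K) MB.mtopology \<Psi>"
    and \<Psi>_collar: "\<And>j w. j \<le> d \<Longrightarrow> w \<in> A \<Longrightarrow> \<Psi> (H j w) = GG j w"
    and \<Psi>_core: "\<And>y. y \<in> core \<Longrightarrow> \<Psi> y = i_B p (stereo_inv y)"
begin

lemma \<Psi>_collar_interior:
  assumes "j \<le> d" "e < cmod w" "cmod w < 3 * e"
  shows "\<Psi> (H j w) = i_B p (h j (of_real (stretched (cmod w)) * sgn w))"
  using \<Psi>_collar[OF assms(1), of w] poly_end.G_interior[OF poly_end[OF assms(1)], of w] assms by (simp add: A_def)

lemma stretched_in_ball:
  assumes "e < cmod w" "cmod w < 3 * e"
  shows "of_real (stretched (cmod w)) * sgn w \<in> ball 0 (3 * e)" "of_real (stretched (cmod w)) * sgn w \<noteq> 0"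
proof -
  have "w \<noteq> 0" using assms e_pos by auto
  moreover have "0 < stretched (cmod w)" "stretched (cmod w) < 3 * e" using assms e_pos by (auto simp: stretched_eq)
  ultimately show "of_real (stretched (cmod w)) * sgn w \<in> ball 0 (3 * e)" "of_real (stretched (cmod w)) * sgn w \<noteq> 0"
    by (auto simp: norm_mult norm_sgn sgn_zero_iff)
qed

lemma K_int_cases:
  assumes "y \<in> K_int"
  obtains (core) "y \<in> core" | (collar) j w where "j \<le> d" "e < cmod w" "cmod w < 3 * e" "y = H j w"
proof -
  have "y \<in> K" using assms K_int_subset by auto
  then show ?thesis
  proof (cases rule: K_cases)
    case core
    then show ?thesis by (rule that(1))
  next
    case (collar j w)
    then have "w \<in> ball 0 (3 * e)" by (simp add: A_def)
    then have "e < cmod w" using H_in_K_int_iff[of j w] collar assms by simp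
    then show ?thesis using collar that(2)[of j w] by (simp add: A_def)
  qed
qed

lemma core_notin_ball:
  assumes "y \<in> core" "j \<le> d" shows "y \<notin> H j ` cball 0 (2 * e)"
  using assms by (auto simp: core_def)

lemma \<Psi>_interior_surj:
  assumes x: "x \<in> S"
  shows "\<exists>y\<in>K_int. \<Psi> y = i_B p x"
proof (cases "\<exists>j\<le>d. stereo x \<in> H j ` ball 0 (3 * e)")
  case True
  then obtain j w where jw: "j \<le> d" "w \<in> ball 0 (3 * e)" "stereo x = H j w" by auto
  have "H j 0 \<notin> stereo ` S"
    using punctures jw(1) by auto
  then have w0: "w \<noteq> 0" using jw(3) x by (metis image_eqI)
  have xw: "x = h j w" using H_props(5)[OF jw(1,2) w0] jw(3) injD[OF inj_stereo] by metis
  \<comment> \<open>This solves \<open>stretched t = cmod w\<close>: the inverse of the minimum of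
    the increasing functions \<open>t\<close> and \<open>2 * (t - e)\<close> is the maximum of their
    inverses.\<close>
  define t where "t = max (cmod w) (cmod w / 2 + e)"
  have "stretched t = cmod w" unfolding stretched_eq t_def by (auto simp: max_def min_def field_simps)
  moreover have "e < t" "t < 3 * e" using w0 jw(2) e_pos by (auto simp: t_def max_def field_simps)
  ultimately have t: "e < t" "t < 3 * e" "stretched t = cmod w" by simp_all
  define w' where "w' = of_real t * sgn w"
  have nw: "cmod w' = t" and sw: "sgn w' = sgn w"
    using t e_pos w0 by (simp_all add: w'_def norm_mult norm_sgn sgn_mult sgn_of_real)
  have "\<Psi> (H j w') = i_B p (h j (of_real (stretched (cmod w')) * sgn w'))"
    by (rule \<Psi>_collar_interior[OF jw(1)]) (simp_all add: nw t)
  also have "of_real (stretched (cmod w')) * sgn w' = w" unfolding nw t(3) sw using w0 by (simp add: sgn_eq)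
  finally have "\<Psi> (H j w') = i_B p x" by (simp only: xw)
  moreover have "H j w' \<in> K_int" using H_in_K_int_iff[OF jw(1), of w'] nw t by simp
  ultimately show ?thesis by blast
next
  case False
  have "stereo x \<in> core"
    unfolding core_def K_def
  proof (intro DiffI)
    show "stereo x \<in> sphere 0 1" by (rule stereo_in_sphere)
    show "stereo x \<notin> (\<Union>j\<le>d. H j ` ball 0 e)"
    proof
      assume "stereo x \<in> (\<Union>j\<le>d. H j ` ball 0 e)"
      then obtain j w where "j \<le> d" "w \<in> ball 0 e" "stereo x = H j w" by auto
      then show False using False e_pos by auto
    qed
    show "stereo x \<notin> (\<Union>j\<le>d. H j ` cball 0 (2 * e))"
    proof
      assume "stereo x \<in> (\<Union>j\<le>d. H j ` cball 0 (2 * e))"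
      then obtain j w where "j \<le> d" "w \<in> cball 0 (2 * e)" "stereo x = H j w" by auto
      then show False using False e_pos by auto
    qed
  qed
  then show ?thesis using \<Psi>_core[of "stereo x"] core_subset_K_int by (intro bexI[of _ "stereo x"]) auto
qed

lemma \<Psi>_in_B: "y \<in> K \<Longrightarrow> \<Psi> y \<in> B"
  using \<Psi>_cont by (auto simp: continuous_map_def)

text \<open>The image of the compact set \<open>K\<close> is closed in the Hausdorff space
  \<open>B\<close>, and it contains the dense image of \<open>i_B\<close>.\<close>

lemma \<Psi>_image: "\<Psi> ` K = B"
proof (intro equalityI subsetI)
  fix x assume "x \<in> \<Psi> ` K" then show "x \<in> B" using \<Psi>_in_B by auto
next
  fix x assume x: "x \<in> B"
  have "compactin (top_of_set K) K" using compact_K by (simp add: compactin_subtopology)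
  then have "compactin MB.mtopology (\<Psi> ` K)" by (rule image_compactin[OF _ \<Psi>_cont])
  then have cl: "closedin MB.mtopology (\<Psi> ` K)"
    using MB.Hausdorff_space_mtopology by (simp add: compactin_imp_closedin)
  obtain \<sigma> where \<sigma>: "\<And>n. \<sigma> n \<in> S" "(\<lambda>n. dB (i_B p (\<sigma> n)) x) \<longlonglongrightarrow> 0"
    using i_B_dense[OF x] by blast
  have lim: "limitin MB.mtopology (\<lambda>n. i_B p (\<sigma> n)) x sequentially"
    using \<sigma> x by (intro limitin_B i_B_in)
  have "i_B p (\<sigma> n) \<in> \<Psi> ` K" for n
    using \<Psi>_interior_surj[OF \<sigma>(1)[of n]] K_int_subset by (metis image_eqI in_mono)
  then show "x \<in> \<Psi> ` K" using limitin_closedin[OF lim cl] by simp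
qed

text \<open>Besides the point \<open>x\<close> hit by \<open>y\<close>, this records where
  \<open>x\<close> lies on the sphere, so that injectivity can be decided in disc
  coordinates.\<close>

definition core_point :: "real^3 \<Rightarrow> complex \<Rightarrow> bool" where
  "core_point y x \<longleftrightarrow> x \<in> S \<and> \<Psi> y = i_B p x \<and>
     (y \<in> core \<and> stereo x = y \<or>
      (\<exists>j w. j \<le> d \<and> e < cmod w \<and> cmod w < 3 * e \<and> y = H j w \<and> stereo x = H j (of_real (stretched (cmod w)) * sgn w)))"

lemma core_point_exists:
  assumes "y \<in> K_int" shows "\<exists>x. core_point y x"
  using assms
proof (cases rule: K_int_cases)
  case core
  then have "y \<in> K" by (simp add: core_def)
  then show ?thesis using core K_stereo[of y] \<Psi>_core[of y] by (auto simp: core_point_def)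
next
  case (collar j w)
  then show ?thesis
    using \<Psi>_collar_interior[of j w] stretched_in_ball[of w] H_props(4,5)[of j "of_real (stretched (cmod w)) * sgn w"]
    unfolding core_point_def by metis
qed

lemma core_point_inj:
  assumes 1: "core_point y x" and 2: "core_point y' x" shows "y = y'"
proof -
  have mixed: "y = H j w"
    if y: "y \<in> core" "stereo x = y" and jw: "j \<le> d" "e < cmod w" "cmod w < 3 * e"
      "stereo x = H j (of_real (stretched (cmod w)) * sgn w)" for y j w
  proof -
    have w0: "w \<noteq> 0" using jw e_pos by auto
    \<comment> \<open>A point of the core lies outside every disc of radius \<open>2 * e\<close>,
      and there stretching is the identity.\<close>
    have "of_real (stretched (cmod w)) * sgn w \<notin> cball 0 (2 * e)"
      using core_notin_ball[OF y(1) jw(1)] y(2) jw(4) by auto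
    then have "2 * e < \<bar>stretched (cmod w)\<bar>" using w0 by (simp add: norm_mult norm_sgn)
    then have "stretched (cmod w) = cmod w" using jw by (auto simp: stretched_eq min_def split: if_splits)
    then show ?thesis using y(2) jw(4) by (simp add: sgn_eq)
  qed
  have collars: "H i v = H j w"
    if iv: "i \<le> d" "e < cmod v" "cmod v < 3 * e" "stereo x = H i (of_real (stretched (cmod v)) * sgn v)"
      and jw: "j \<le> d" "e < cmod w" "cmod w < 3 * e" "stereo x = H j (of_real (stretched (cmod w)) * sgn w)" for i j v w
  proof -
    have eq: "i = j" "of_real (stretched (cmod v)) * sgn v = of_real (stretched (cmod w)) * sgn w"
      using H_eq_iff[OF iv(1) jw(1) stretched_in_ball(1)[OF iv(2,3)] stretched_in_ball(1)[OF jw(2,3)]] iv(4) jw(4) by auto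
    have nz: "v \<noteq> 0" "w \<noteq> 0" using iv jw e_pos by auto
    have pos: "0 < stretched (cmod v)" "0 < stretched (cmod w)" using iv jw e_pos by (auto simp: stretched_eq)
    have "cmod (of_real (stretched (cmod v)) * sgn v) = cmod (of_real (stretched (cmod w)) * sgn w)" by (simp only: eq(2))
    then have st: "stretched (cmod v) = stretched (cmod w)" using nz pos by (simp add: norm_mult norm_sgn)
    then have n: "cmod v = cmod w" by (auto simp: stretched_eq min_def split: if_splits)
    have "sgn v = sgn w" using eq(2) st pos by simp
    then have "of_real (cmod v) * sgn v = of_real (cmod w) * sgn w" using n by simp
    then have "v = w" using nz by (simp add: sgn_eq)
    then show ?thesis using eq(1) by simp
  qed
  consider "y \<in> core" "stereo x = y"
    | i v where "i \<le> d" "e < cmod v" "cmod v < 3 * e" "y = H i v" "stereo x = H i (of_real (stretched (cmod v)) * sgn v)"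
    using 1 unfolding core_point_def by blast
  then show ?thesis
  proof cases
    case y: 1
    consider "y' \<in> core" "stereo x = y'"
      | j w where "j \<le> d" "e < cmod w" "cmod w < 3 * e" "y' = H j w" "stereo x = H j (of_real (stretched (cmod w)) * sgn w)"
      using 2 unfolding core_point_def by blast
    then show ?thesis
    proof cases
      case 1 then show ?thesis using y by simp
    next
      case 2 then show ?thesis using mixed[OF y] by simp
    qed
  next
    case y: (2 i v)
    consider "y' \<in> core" "stereo x = y'"
      | j w where "j \<le> d" "e < cmod w" "cmod w < 3 * e" "y' = H j w" "stereo x = H j (of_real (stretched (cmod w)) * sgn w)"
      using 2 unfolding core_point_def by blast
    then show ?thesis
    proof cases
      case 1 then show ?thesis using mixed[OF 1 y(1-3,5)] y(4) by simp
    next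
      case 2 then show ?thesis using collars[OF y(1-3,5) 2(1-3,5)] y(4) by simp
    qed
  qed
qed

lemma K_boundary_cases:
  assumes "y \<in> K" "y \<notin> K_int"
  shows "\<exists>j w. j \<le> d \<and> cmod w = e \<and> y = H j w \<and> \<Psi> y = EE j (Complex 0 (kk j * Arg w))"
proof -
  have "y \<in> sphere 0 1" using assms(1) by (simp add: K_def)
  then obtain j where j: "j \<le> d" "y \<in> H j ` cball 0 e" using assms(2) unfolding K_int_def by blast
  then obtain w where w: "cmod w \<le> e" "y = H j w" by auto
  have "w \<in> ball 0 (3 * e)" using w(1) e_pos by auto
  then have we: "cmod w = e" using H_in_K_iff[OF j(1), of w] assms(1) w by simp
  then have "\<Psi> y = GG j w" using \<Psi>_collar[OF j(1), of w] w(2) e_pos by (simp add: A_def)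
  also have "\<dots> = EE j (Complex 0 (kk j * Arg w))"
    using poly_end.G_boundary[OF poly_end[OF j(1)], of w] we by simp
  finally show ?thesis using j(1) we w(2) by (intro exI[of _ j] exI[of _ w]) simp
qed

text \<open>Inner and boundary points of \<open>K\<close> have different images by
  \<open>E_bar_not_i_B\<close>, and inner points are separated by \<open>core_point_inj\<close>. For
  two boundary points with the same image, interior points converging to that image lie in both
  ends, and their directions converge to those of both points.\<close>

lemma \<Psi>_inj: "inj_on \<Psi> K"
proof (rule inj_onI)
  fix y y' assume y: "y \<in> K" "y' \<in> K" and eq: "\<Psi> y = \<Psi> y'"
  have mixed: False if y: "y \<in> K_int" "y' \<in> K" "y' \<notin> K_int" "\<Psi> y = \<Psi> y'" for y y'
  proof -
    obtain x where "core_point y x" using core_point_exists[OF y(1)] by blast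
    then have x: "x \<in> S" "\<Psi> y = i_B p x" by (simp_all add: core_point_def)
    obtain j w where "j \<le> d" "\<Psi> y' = EE j (Complex 0 (kk j * Arg w))" using K_boundary_cases[OF y(2,3)] by blast
    then show False using poly_end.E_bar_not_i_B[OF poly_end, of j "Complex 0 (kk j * Arg w)" x] x y(4) by simp
  qed
  show "y = y'"
  proof (cases "y \<in> K_int")
    case True
    then have "y' \<in> K_int" using mixed[OF True y(2) _ eq] by blast
    obtain x where x: "core_point y x" using core_point_exists[OF True] by blast
    obtain x' where x': "core_point y' x'" using core_point_exists[OF \<open>y' \<in> K_int\<close>] by blast
    have "i_B p x = i_B p x'" using x x' eq by (simp add: core_point_def)
    then have "x = x'" using inj_onD[OF inj_i_B] x x' by (simp add: core_point_def)
    then show ?thesis using core_point_inj x x' by blast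
  next
    case False
    then have "y' \<notin> K_int" using mixed[of y' y] y eq by auto
    obtain j w where jw: "j \<le> d" "cmod w = e" "y = H j w" "\<Psi> y = EE j (Complex 0 (kk j * Arg w))"
      using K_boundary_cases[OF y(1) False] by blast
    obtain j' w' where jw': "j' \<le> d" "cmod w' = e" "y' = H j' w'" "\<Psi> y' = EE j' (Complex 0 (kk j' * Arg w'))"
      using K_boundary_cases[OF y(2) \<open>y' \<notin> K_int\<close>] by blast
    interpret E1: poly_end p "H j" "h j" "n j" "3 * e" by (rule poly_end[OF jw(1)])
    interpret E2: poly_end p "H j'" "h j'" "n j'" "3 * e" by (rule poly_end[OF jw'(1)])
    have nz: "w \<noteq> 0" "w' \<noteq> 0" using jw jw' e_pos by auto
    have s1: "cis (Im (Complex 0 (kk j * Arg w)) / kk j) = sgn w" using E1.k_pos nz by (simp add: sgn_complex_cis_Arg)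
    have s2: "cis (Im (Complex 0 (kk j' * Arg w')) / kk j') = sgn w'" using E2.k_pos nz by (simp add: sgn_complex_cis_Arg)
    \<comment> \<open>Both directions are compared with that of one interior point closer than
      \<open>t\<close> to the common image, hence the factor 2; this point lies in both ends, and
      disjointness of the ends forces \<open>j = j'\<close>.\<close>
    have close: "j = j' \<and> cmod (sgn w - sgn w') \<le> 2 * t" if t: "0 < t" "t < E1.\<rho>0" "t < E2.\<rho>0" for t
    proof -
      have xB: "\<Psi> y \<in> B" by (rule \<Psi>_in_B[OF y(1)])
      obtain \<sigma> where \<sigma>: "\<And>n. \<sigma> n \<in> S" "(\<lambda>n. dB (i_B p (\<sigma> n)) (\<Psi> y)) \<longlonglongrightarrow> 0"
        using i_B_dense[OF xB] by blast
      have "eventually (\<lambda>n. dB (i_B p (\<sigma> n)) (\<Psi> y) < t) sequentially" using \<sigma>(2) t(1) by (rule order_tendstoD(2))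
      then obtain m where m: "dB (i_B p (\<sigma> m)) (\<Psi> y) < t" by (auto simp: eventually_sequentially)
      then have z: "\<sigma> m \<in> S" "dB (\<Psi> y) (i_B p (\<sigma> m)) < t" using \<sigma>(1) MB.commute by auto
      obtain w1 where w1: "w1 \<in> ball 0 (3 * e)" "stereo (\<sigma> m) = H j w1" "cmod (sgn w1 - sgn w) \<le> t"
        using E1.boundary_point_near[OF _ xB jw(4)[symmetric] t(1,2) z] unfolding s1 by auto
      obtain w2 where w2: "w2 \<in> ball 0 (3 * e)" "stereo (\<sigma> m) = H j' w2" "cmod (sgn w2 - sgn w') \<le> t"
        using E2.boundary_point_near[OF _ xB jw'(4)[symmetric, folded eq] t(1,3) z] unfolding s2 by auto
      have "j = j'" "w1 = w2" using H_eq_iff[OF jw(1) jw'(1) w1(1) w2(1)] w1(2) w2(2) by auto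
      moreover have "cmod (sgn w - sgn w') \<le> cmod (sgn w1 - sgn w) + cmod (sgn w1 - sgn w')"
        using norm_triangle_ineq4[of "sgn w1 - sgn w'" "sgn w1 - sgn w"] by simp
      ultimately show ?thesis using w1(3) w2(3) by simp
    qed
    define t0 where "t0 = min E1.\<rho>0 E2.\<rho>0"
    have t0: "t0 > 0" using E1.\<rho>0_pos E2.\<rho>0_pos by (simp add: t0_def)
    have t0_le: "t0 \<le> E1.\<rho>0" "t0 \<le> E2.\<rho>0" by (simp_all add: t0_def)
    have "0 < t0 / 2" "t0 / 2 < E1.\<rho>0" "t0 / 2 < E2.\<rho>0" using t0 t0_le by linarith+
    then have jj: "j = j'" using close by blast
    have "cmod (sgn w - sgn w') \<le> 0"
    proof (rule field_le_epsilon)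
      fix \<epsilon> :: real assume \<epsilon>: "\<epsilon> > 0"
      define t where "t = min (t0 / 2) (\<epsilon> / 2)"
      have t: "0 < t" "t < t0" "2 * t \<le> \<epsilon>" using t0 \<epsilon> by (auto simp: t_def)
      then have "t < E1.\<rho>0" "t < E2.\<rho>0" using t0_le by linarith+
      then show "cmod (sgn w - sgn w') \<le> 0 + \<epsilon>" using close[OF t(1)] t(3) by simp
    qed
    then have "sgn w = sgn w'" by simp
    then have "of_real (cmod w) * sgn w = of_real (cmod w') * sgn w'" using jw(2) jw'(2) by simp
    then have "w = w'" using nz by (simp add: sgn_eq)
    then show ?thesis using jj jw(3) jw'(3) by simp
  qed
qed

lemma homeomorphic_map_\<Psi>: "homeomorphic_map (top_of_set K) MB.mtopology \<Psi>"
proof (rule continuous_imp_homeomorphic_map)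
  show "compact_space (top_of_set K)" using compact_K by (simp add: compact_space_subtopology compactin_subtopology)
  show "Hausdorff_space MB.mtopology" by (rule MB.Hausdorff_space_mtopology)
  show "\<Psi> ` topspace (top_of_set K) = topspace MB.mtopology" using \<Psi>_image by simp
  show "inj_on \<Psi> (topspace (top_of_set K))" using \<Psi>_inj by simp
qed (rule \<Psi>_cont)

lemma B_cases_\<Psi>:
  assumes "x \<in> B"
  shows "x \<in> i_B p ` S \<or> (\<exists>j\<le>d. \<exists>v0. Re v0 = 0 \<and> x = EE j v0)"
proof -
  obtain y where y: "y \<in> K" "x = \<Psi> y" using assms \<Psi>_image by auto
  show ?thesis
  proof (cases "y \<in> K_int")
    case True
    then show ?thesis using core_point_exists[OF True] y(2) by (auto simp: core_point_def)
  next
    case False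
    obtain j w where "j \<le> d" "\<Psi> y = EE j (Complex 0 (kk j * Arg w))" using K_boundary_cases[OF y(1) False] by blast
    then show ?thesis using y(2) by (intro disjI2 exI[of _ j] conjI exI[of _ "Complex 0 (kk j * Arg w)"]) simp_all
  qed
qed

text \<open>\<open>K_int\<close> is open in \<open>K\<close>, and stereographic projection
  identifies it with an open subset of the plane; the homeomorphism \<open>\<Psi>\<close> carries
  this chart to the completion.\<close>

lemma i_B_in_surface_interior_\<Psi>: "i_B p ` S \<subseteq> surface_interior MB.mtopology"
proof
  fix x assume "x \<in> i_B p ` S"
  then obtain y where y: "y \<in> K_int" "\<Psi> y = x" using \<Psi>_interior_surj by blast
  have cl: "closed (\<Union>j\<le>d. H j ` cball 0 e)"
  proof (intro closed_UN ballI)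
    fix j assume "j \<in> {..d}"
    then have "continuous_on (cball 0 e) (H j)" using e_pos by (intro continuous_on_subset[OF H_props(1)]) auto
    then show "closed (H j ` cball 0 e)" by (intro compact_imp_closed compact_continuous_image) auto
  qed simp
  define O' where "O' = - (\<Union>j\<le>d. H j ` cball 0 e)"
  have O': "open O'" unfolding O'_def by (rule open_Compl[OF cl])
  have KO: "K_int = sphere 0 1 \<inter> O'" by (auto simp: K_int_def O'_def)
  have "K_int = K \<inter> O'" using KO K_int_subset by (auto simp: K_def)
  then have opK: "openin (top_of_set K) K_int" using O' by (auto simp: openin_open)
  then have opU: "openin MB.mtopology (\<Psi> ` K_int)"
    using homeomorphic_imp_open_map[OF homeomorphic_map_\<Psi>] by (simp add: open_map_def)
  have sub: "subtopology (top_of_set K) K_int = top_of_set K_int"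
    using K_int_subset by (simp add: subtopology_subtopology inf.absorb2)
  have "homeomorphic_map (subtopology (top_of_set K) K_int) (subtopology MB.mtopology (\<Psi> ` K_int)) \<Psi>"
    using K_int_subset \<Psi>_in_B by (intro homeomorphic_map_subtopologies[OF homeomorphic_map_\<Psi>]) auto
  then have h1: "top_of_set K_int homeomorphic_space subtopology MB.mtopology (\<Psi> ` K_int)"
    unfolding sub by (rule homeomorphic_map_imp_homeomorphic_space)
  have h2: "top_of_set K_int homeomorphic_space top_of_set (stereo -` O')"
    unfolding homeomorphic_space_def homeomorphic_maps_def
  proof (intro exI[of _ stereo_inv] exI[of _ stereo] conjI ballI)
    have K3: "stereo (stereo_inv v) = v" if "v \<in> K_int" for v using K_stereo(2)[of v] that K_int_subset by auto
    have "K_int \<subseteq> {v. v $ 3 \<noteq> 1}" using K3 stereo_3_neq_1 by (metis (mono_tags, lifting) mem_Collect_eq subsetI)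
    then have "continuous_on K_int stereo_inv" by (rule continuous_on_subset[OF continuous_stereo_inv])
    then show "continuous_map (top_of_set K_int) (top_of_set (stereo -` O')) stereo_inv"
      using K3 KO by auto
    show "continuous_map (top_of_set (stereo -` O')) (top_of_set K_int) stereo"
      using KO stereo_in_sphere by (auto intro: continuous_stereo)
    show "stereo (stereo_inv v) = v" if "v \<in> topspace (top_of_set K_int)" for v using K3 that by simp
    show "stereo_inv (stereo z) = z" for z by simp
  qed
  have "subtopology MB.mtopology (\<Psi> ` K_int) homeomorphic_space top_of_set (stereo -` O')"
    by (rule homeomorphic_space_trans[OF homeomorphic_space_sym[THEN iffD1, OF h1] h2])
  moreover have "open (stereo -` O')" by (rule open_vimage[OF O' continuous_stereo])
  moreover have "x \<in> B" using y \<Psi>_in_B K_int_subset by auto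
  ultimately show "x \<in> surface_interior MB.mtopology"
    unfolding surface_interior_def using opU y by auto
qed

end

text \<open>\<open>\<Psi>\<close> serves only to derive these three facts, which do not mention it,
  so its existence is discharged here once.\<close>

lemma homeomorphic_space_K: "MB.mtopology homeomorphic_space top_of_set K"
  and B_cases: "x \<in> B \<Longrightarrow> x \<in> i_B p ` S \<or> (\<exists>j\<le>d. \<exists>v0. Re v0 = 0 \<and> x = EE j v0)"
  and i_B_in_surface_interior: "i_B p ` S \<subseteq> surface_interior MB.mtopology"
proof -
  obtain \<Psi> where \<Psi>: "continuous_map (top_of_set K) MB.mtopology \<Psi>"
    "\<And>j w. j \<le> d \<Longrightarrow> w \<in> A \<Longrightarrow> \<Psi> (H j w) = GG j w" "\<And>y. y \<in> core \<Longrightarrow> \<Psi> y = i_B p (stereo_inv y)"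
    using model_map_exists by blast
  show "MB.mtopology homeomorphic_space top_of_set K"
    using homeomorphic_map_\<Psi>[OF \<Psi>] homeomorphic_map_imp_homeomorphic_space homeomorphic_space_sym by blast
  show "x \<in> B \<Longrightarrow> x \<in> i_B p ` S \<or> (\<exists>j\<le>d. \<exists>v0. Re v0 = 0 \<and> x = EE j v0)" by (rule B_cases_\<Psi>[OF \<Psi>])
  show "i_B p ` S \<subseteq> surface_interior MB.mtopology" by (rule i_B_in_surface_interior_\<Psi>[OF \<Psi>])
qed

lemma compact_space_B: "compact_space MB.mtopology"
  using homeomorphic_compact_space[OF homeomorphic_space_K] compact_K
  by (simp add: compact_space_subtopology compactin_subtopology)

lemma genus_0_B: "genus_0_surface MB.mtopology (d + 1)"
  unfolding genus_0_surface_def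
proof (intro exI[of _ "\<lambda>j. H j ` ball 0 e"] conjI allI impI)
  have cont: "continuous_on (cball 0 e) (H j)" if "j \<le> d" for j
    using e_pos by (intro continuous_on_subset[OF H_props(1)[OF that]]) auto
  have clo: "closure (H j ` ball 0 e) = H j ` cball 0 e" if "j \<le> d" for j
    by (rule closure_image_ball[OF cont[OF that] e_pos])
  show "open_disk_with_closed_disk_closure (H j ` ball 0 e)" if "j < d + 1" for j
    unfolding open_disk_with_closed_disk_closure_def
  proof (intro conjI)
    have j: "j \<le> d" using that by simp
    show "openin (top_of_set (sphere 0 1)) (H j ` ball 0 e)" using e_pos by (intro H_props(3)[OF j]) auto
    \<comment> \<open>The definition asks for the unit disc together with its interior; scaling by
      \<open>e\<close> carries this pair to the removed disc and its closure in the end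
      coordinate.\<close>
    define s where "s z = e *\<^sub>R z" for z :: complex
    have sc: "s ` cball 0 1 = cball 0 e" "s ` ball 0 1 = ball 0 e"
      using cball_scale[of e "0::complex" 1] ball_scale[of e "0::complex" 1] e_pos by (simp_all add: s_def[abs_def])
    have "inj s" using e_pos by (auto simp: s_def inj_on_def)
    then have "inj_on (H j \<circ> s) (cball 0 1)"
    proof (intro comp_inj_on)
      have sub: "cball (0::complex) e \<subseteq> ball 0 (3 * e)" using e_pos by auto
      show "inj_on (H j) (s ` cball 0 1)" unfolding sc(1) by (rule inj_on_subset[OF H_props(2)[OF j] sub])
    qed (auto intro: inj_on_subset)
    moreover have "continuous_on (cball 0 1) (H j \<circ> s)"
      using cont[OF j] sc(1) by (intro continuous_on_compose) (auto simp: s_def intro!: continuous_intros)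
    moreover have "(H j \<circ> s) ` cball 0 1 = closure (H j ` ball 0 e)"
      by (simp only: image_comp[symmetric] sc(1) clo[OF j])
    ultimately obtain g where "homeomorphism (cball 0 1) (closure (H j ` ball 0 e)) (H j \<circ> s) g"
      using homeomorphism_compact[OF compact_cball] by metis
    moreover have "(H j \<circ> s) ` ball 0 1 = H j ` ball 0 e" by (simp only: image_comp[symmetric] sc(2))
    ultimately show "\<exists>h k. homeomorphism (cball (0 :: complex) 1) (closure (H j ` ball 0 e)) h k \<and> h ` ball 0 1 = H j ` ball 0 e"
      by blast
  qed
  show "disjoint_family_on (\<lambda>j. closure (H j ` ball 0 e)) {..<d + 1}"
    unfolding disjoint_family_on_def
  proof (intro ballI impI)
    fix i j assume ij: "i \<in> {..<d + 1}" "j \<in> {..<d + 1}" "i \<noteq> j"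
    have le: "i \<le> d" "j \<le> d" using ij by auto
    have "cball (0::complex) e \<subseteq> ball 0 (3 * e)" using e_pos by auto
    then show "closure (H i ` ball 0 e) \<inter> closure (H j ` ball 0 e) = {}"
      using ends_disjoint[OF le ij(3)] unfolding clo[OF le(1)] clo[OF le(2)] by blast
  qed
  have "{..<d + 1} = {..d}" by auto
  then show "MB.mtopology homeomorphic_space top_of_set (sphere 0 1 - (\<Union>j<d + 1. H j ` ball 0 e))"
    using homeomorphic_space_K by (simp only: K_def)
qed

lemma locally_CAT0_B: "locally_CAT0 B dB"
  unfolding locally_CAT0_def
proof
  fix x assume "x \<in> B"
  from B_cases[OF this] show "\<exists>r>0. CAT0_space (MB.mball x r) dB"
  proof
    assume "x \<in> i_B p ` S" then show ?thesis using interior_locally_CAT0 by auto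
  next
    assume "\<exists>j\<le>d. \<exists>v0. Re v0 = 0 \<and> x = EE j v0"
    then show ?thesis using poly_end.boundary_locally_CAT0[OF poly_end] by auto
  qed
qed

lemma locally_Euclidean_B: "x \<in> B - i_B p ` cpt p \<Longrightarrow> locally_Euclidean_at B dB x"
proof -
  assume x: "x \<in> B - i_B p ` cpt p"
  then have "x \<in> B" by simp
  from B_cases[OF this] show ?thesis
  proof
    assume "x \<in> i_B p ` S" then show ?thesis using interior_locally_Euclidean x by auto
  next
    assume "\<exists>j\<le>d. \<exists>v0. Re v0 = 0 \<and> x = EE j v0"
    then show ?thesis using poly_end.boundary_locally_Euclidean[OF poly_end] by auto
  qed
qed

end

lemma (in separable_poly) poly_ends_exist: "\<exists>H h n e. poly_ends p H h n e"
proof (rule ends_exist)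
  fix H h n e
  assume "0 < e" "\<And>j. j \<le> degree p \<Longrightarrow> is_end (H j) (h j) (n j) (3 * e)"
    "\<And>i j. i \<le> degree p \<Longrightarrow> j \<le> degree p \<Longrightarrow> i \<noteq> j \<Longrightarrow> H i ` ball 0 (3 * e) \<inter> H j ` ball 0 (3 * e) = {}"
    "sphere 0 1 - stereo ` S = (\<lambda>j. H j 0) ` {..degree p}"
  then have "poly_ends p H h n e" by unfold_locales
  then show ?thesis by (intro exI)
qed

theorem theorem1:
  fixes p :: "complex poly" and d :: nat
  assumes "degree p = d" and "d \<ge> 1" and "card (rts p) = d"
  defines "B \<equiv> branched_annulus p"
    and "dB \<equiv> branched_annulus_dist p"
  defines "X \<equiv> Metric_space.mtopology B dB"
  shows "Metric_space B dB \<and> compact_space X \<and> genus_0_surface X (d + 1) \<and>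
    locally_CAT0 B dB \<and>
    finite (i_B p ` cpt p) \<and> inj_on (i_B p) (cpt p) \<and>
    i_B p ` cpt p \<subseteq> surface_interior X \<and>
    (\<forall>x \<in> B - i_B p ` cpt p. locally_Euclidean_at B dB x)"
proof -
  interpret P: separable_poly p using assms by unfold_locales auto
  obtain H h n e where "poly_ends p H h n e" using P.poly_ends_exist by blast
  then interpret E: poly_ends p H h n e .
  show ?thesis
    unfolding B_def dB_def X_def assms(1)[symmetric]
  proof (intro conjI ballI)
    show "inj_on (i_B p) (cpt p)" using inj_on_subset[OF P.inj_i_B P.cpt_subset] .
    show "i_B p ` cpt p \<subseteq> surface_interior P.MB.mtopology"
      using E.i_B_in_surface_interior P.cpt_subset by blast
  qed (use P.MB.Metric_space_axioms E.compact_space_B E.genus_0_B E.locally_CAT0_B P.finite_cpt E.locally_Euclidean_B in auto)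
qed

end
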